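(* Let $A$ be a bounded non-positive right dg noetherian dg ring. Identify $\operatorname{Spec}^{\mathbb{Z}}(\mathsf{dgMod}\,A)$ with $\operatorname{Spec}(\mathsf{Mod}\,A^0)$ via the bijection sending $\overline{H}\in\operatorname{Spec}(\mathsf{Mod}\,A^0)$ to the $\mathbb{Z}$-orbit of $\overline{D(H)}$. (1) For any $M\in\mathsf{dgMod}\,A$, we have $\operatorname{Supp}^{\mathbb{Z}}_{\mathsf{dgMod}\,A}(M)=\operatorname{Supp}_{\mathsf{Mod}\,A^0}M$, where on the right-hand side $M$ is regarded as an $A^0$-module by forgetting the differential and the grading. (2) The bijection $\operatorname{Spec}^{\mathbb{Z}}(\mathsf{dgMod}\,A)=\operatorname{Spec}(\mathsf{Mod}\,A^0)$ is a homeomorphism.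
   Context: Dg rings (not necessarily commutative) and dg modules are cohomologically graded. A dg ring $A$ is non-positive if $A^i=0$ for $i>0$, bounded if $A^n=0$ for $|n|\gg0$, and right dg noetherian if every ascending chain of right dg ideals is stationary. $\mathsf{dgMod}\,A$ is the abelian category of right dg $A$-modules with degree-$0$ $A$-linear chain maps; $\mathsf{Mod}\,A^0$ is the category of right $A^0$-modules. For a right $A^0$-module $M$, $D(M)$ is the dg $A$-module whose underlying complex is $M\xrightarrow{\mathrm{id}}M$ in degrees $-1$ and $0$, with action of $a\in A^i$ on $x\in D(M)^j$: $x\cdot a=xa$ if $i=0$; $x\cdot a=x\,d_A(a)$ if $i=-1$ and $j=0$; $x\cdot a=0$ otherwise. For an abelian category $\mathcal{A}$: an object $H\neq0$ is monoform if for every nonzero subobject $L$ of $H$, the objects $H$ and $H/L$ have no common nonzero subobject (up to isomorphism); two monoform objects are atom-equivalent if they have a common nonzero subobject; $\operatorname{Spec}\mathcal{A}$ is the set of atom-equivalence classes $\overline{H}$ of monoform objects. $\operatorname{Supp}_{\mathcal{A}}M:=\{\overline{H}\mid H\text{ a monoform subquotient of }M\}$, and the sets $\operatorname{Supp}_{\mathcal{A}}M$ ($M\in\mathcal{A}$) form an open basis of the topology of $\operatorname{Spec}\mathcal{A}$. $\mathbb{Z}$ acts on $\operatorname{Spec}(\mathsf{dgMod}\,A)$ by $n\cdot\overline{X}=\overline{X[n]}$; $\operatorname{Spec}^{\mathbb{Z}}(\mathsf{dgMod}\,A)$ is the quotient space, with quotient map $\pi$, and $\operatorname{Supp}^{\mathbb{Z}}M:=\pi(\operatorname{Supp}M)$.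 It is a known result (which may be assumed for the meaning of the statement) that $\overline{H}\mapsto\pi(\overline{D(H)})$ is a well-defined bijection $\operatorname{Spec}(\mathsf{Mod}\,A^0)\to\operatorname{Spec}^{\mathbb{Z}}(\mathsf{dgMod}\,A)$. *)

theory Defs
  imports
    "HOL-Algebra.QuotRing"
    "HOL-Analysis.Abstract_Topology"
    "HOL-Library.Equipollence"
begin

section \<open>Internal gradings\<close>

definition homog_decomp :: "('b, 'z) ring_scheme \<Rightarrow> (int \<Rightarrow> 'b set) \<Rightarrow> (int \<Rightarrow> 'b) \<Rightarrow> 'b \<Rightarrow> bool" where
  "homog_decomp G g c x \<longleftrightarrow>
     (\<forall>i. c i \<in> g i) \<and> finite {i. c i \<noteq> \<zero>\<^bsub>G\<^esub>} \<and> x = finsum G c {i. c i \<noteq> \<zero>\<^bsub>G\<^esub>}"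

text \<open>The abelian group \<open>G\<close> is the internal direct sum of the subgroups \<open>g i\<close>.\<close>
definition is_grading :: "('b, 'z) ring_scheme \<Rightarrow> (int \<Rightarrow> 'b set) \<Rightarrow> bool" where
  "is_grading G g \<longleftrightarrow>
     (\<forall>i. additive_subgroup (g i) G) \<and> (\<forall>x\<in>carrier G. \<exists>!c. homog_decomp G g c x)"

definition hcomp :: "('b, 'z) ring_scheme \<Rightarrow> (int \<Rightarrow> 'b set) \<Rightarrow> int \<Rightarrow> 'b \<Rightarrow> 'b" where
  "hcomp G g i x = (THE c. homog_decomp G g c x) i"

text \<open>The element \<open>(-1)\<^sup>i x\<close>.\<close>
definition signed :: "('b, 'z) ring_scheme \<Rightarrow> int \<Rightarrow> 'b \<Rightarrow> 'b" where
  "signed G i x = (if even i then x else \<ominus>\<^bsub>G\<^esub> x)"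


section \<open>Right modules\<close>

text \<open>As for the record \<open>module\<close> of HOL-Algebra, the multiplicative fields inherited from
  \<^typ>\<open>'m ring\<close> carry no meaning for a module; only the additive group is used.\<close>
record ('a, 'm) rmodule = "'m ring" +
  ract :: "'m \<Rightarrow> 'a \<Rightarrow> 'm" (infixl \<open>\<triangleleft>\<index>\<close> 70)

locale right_module = R?: ring R + M?: abelian_group M
  for R :: "('a, 'r) ring_scheme" (structure) and M :: "('a, 'm, 'z) rmodule_scheme" (structure) +
  assumes ract_closed: "\<lbrakk>x \<in> carrier M; a \<in> carrier R\<rbrakk> \<Longrightarrow> x \<triangleleft>\<^bsub>M\<^esub> a \<in> carrier M"
    and ract_add_left: "\<lbrakk>x \<in> carrier M; y \<in> carrier M; a \<in> carrier R\<rbrakk> \<Longrightarrow>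
      (x \<oplus>\<^bsub>M\<^esub> y) \<triangleleft>\<^bsub>M\<^esub> a = (x \<triangleleft>\<^bsub>M\<^esub> a) \<oplus>\<^bsub>M\<^esub> (y \<triangleleft>\<^bsub>M\<^esub> a)"
    and ract_add_right: "\<lbrakk>x \<in> carrier M; a \<in> carrier R; b \<in> carrier R\<rbrakk> \<Longrightarrow>
      x \<triangleleft>\<^bsub>M\<^esub> (a \<oplus>\<^bsub>R\<^esub> b) = (x \<triangleleft>\<^bsub>M\<^esub> a) \<oplus>\<^bsub>M\<^esub> (x \<triangleleft>\<^bsub>M\<^esub> b)"
    and ract_assoc: "\<lbrakk>x \<in> carrier M; a \<in> carrier R; b \<in> carrier R\<rbrakk> \<Longrightarrow>
      x \<triangleleft>\<^bsub>M\<^esub> (a \<otimes>\<^bsub>R\<^esub> b) = (x \<triangleleft>\<^bsub>M\<^esub> a) \<triangleleft>\<^bsub>M\<^esub> b"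
    and ract_one: "x \<in> carrier M \<Longrightarrow> x \<triangleleft>\<^bsub>M\<^esub> \<one>\<^bsub>R\<^esub> = x"

definition rsubmodule :: "('a, 'r) ring_scheme \<Rightarrow> 'm set \<Rightarrow> ('a, 'm, 'z) rmodule_scheme \<Rightarrow> bool" where
  "rsubmodule R N M \<longleftrightarrow>
     additive_subgroup N M \<and> (\<forall>x\<in>N. \<forall>a\<in>carrier R. x \<triangleleft>\<^bsub>M\<^esub> a \<in> N)"

definition rmod_sub :: "('a, 'm) rmodule \<Rightarrow> 'm set \<Rightarrow> ('a, 'm) rmodule" where
  "rmod_sub M N = M\<lparr>carrier := N\<rparr>"

definition quot_ract :: "('a, 'm, 'z) rmodule_scheme \<Rightarrow> 'm set \<Rightarrow> 'm set \<Rightarrow> 'a \<Rightarrow> 'm set" where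
  "quot_ract M L X a = (\<Union>x\<in>X. L +>\<^bsub>M\<^esub> (x \<triangleleft>\<^bsub>M\<^esub> a))"

definition rmod_quot :: "('a, 'm) rmodule \<Rightarrow> 'm set \<Rightarrow> ('a, 'm set) rmodule" where
  "rmod_quot M L =
     \<lparr>carrier = a_rcosets\<^bsub>M\<^esub> L, mult = undefined, one = undefined, zero = L, add = set_add M,
      ract = quot_ract M L\<rparr>"

definition rmod_hom ::
  "('a, 'r) ring_scheme \<Rightarrow> ('a, 'm, 'y) rmodule_scheme \<Rightarrow> ('a, 'n, 'z) rmodule_scheme \<Rightarrow> ('m \<Rightarrow> 'n) set"
where
  "rmod_hom R M N =
     {f \<in> hom (add_monoid M) (add_monoid N).
        \<forall>x\<in>carrier M. \<forall>a\<in>carrier R. f (x \<triangleleft>\<^bsub>M\<^esub> a) = f x \<triangleleft>\<^bsub>N\<^esub> a}"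

definition rmod_isomorphic ::
  "('a, 'r) ring_scheme \<Rightarrow> ('a, 'm) rmodule \<Rightarrow> ('a, 'n) rmodule \<Rightarrow> bool" where
  "rmod_isomorphic R M N \<longleftrightarrow> (\<exists>f\<in>rmod_hom R M N. bij_betw f (carrier M) (carrier N))"


section \<open>The atom spectrum of a category of right modules\<close>

text \<open>The underlying sets of the two modules may live in different types.\<close>
definition rmod_common_sub ::
  "('a, 'r) ring_scheme \<Rightarrow> ('a, 'm) rmodule \<Rightarrow> ('a, 'n) rmodule \<Rightarrow> bool" where
  "rmod_common_sub R M N \<longleftrightarrow>
     (\<exists>K L. rsubmodule R K M \<and> K \<noteq> {\<zero>\<^bsub>M\<^esub>} \<and> rsubmodule R L N \<and> L \<noteq> {\<zero>\<^bsub>N\<^esub>} \<and>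
            rmod_isomorphic R (rmod_sub M K) (rmod_sub N L))"

definition rmod_monoform :: "('a, 'r) ring_scheme \<Rightarrow> ('a, 'm) rmodule \<Rightarrow> bool" where
  "rmod_monoform R H \<longleftrightarrow>
     right_module R H \<and> carrier H \<noteq> {\<zero>\<^bsub>H\<^esub>} \<and>
     (\<forall>L. rsubmodule R L H \<and> L \<noteq> {\<zero>\<^bsub>H\<^esub>} \<longrightarrow> \<not> rmod_common_sub R H (rmod_quot H L))"

text \<open>The type \<open>'u\<close> plays the role of a universe: the category consists of the modules whose
  underlying set is a subset of \<open>'u\<close>, and an atom is a class of such modules.  The atom of a
  monoform module over another type is the class of those modules in the universe that are
  atom-equivalent to it; this is needed because quotients and \<open>D(H)\<close> change the type.
  If \<open>'u\<close> is infinite and the base ring embeds into it, then every finitely generated module has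
  a copy in the universe, which therefore sees every atom.\<close>
definition rmod_atom :: "('a, 'r) ring_scheme \<Rightarrow> ('a, 'm) rmodule \<Rightarrow> ('a, 'u) rmodule set" where
  "rmod_atom R H = {H'. rmod_monoform R H' \<and> rmod_common_sub R H' H}"

definition rmod_Spec :: "('a, 'r) ring_scheme \<Rightarrow> ('a, 'u) rmodule set set" where
  "rmod_Spec R = {rmod_atom R H | H :: ('a, 'u) rmodule. rmod_monoform R H}"

definition rmod_Supp :: "('a, 'r) ring_scheme \<Rightarrow> ('a, 'u) rmodule \<Rightarrow> ('a, 'u) rmodule set set" where
  "rmod_Supp R M =
     {rmod_atom R (rmod_quot (rmod_sub M K) L) | K L.
        rsubmodule R K M \<and> rsubmodule R L M \<and> L \<subseteq> K \<and>
        rmod_monoform R (rmod_quot (rmod_sub M K) L)}"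

text \<open>The intersection of two supports is a union of supports, so the topology generated by the
  supports is the one having them as an open basis.\<close>
definition rmod_Spec_topology :: "('a, 'r) ring_scheme \<Rightarrow> ('a, 'u) rmodule set topology" where
  "rmod_Spec_topology R =
     topology_generated_by {rmod_Supp R M | M :: ('a, 'u) rmodule. right_module R M}"


section \<open>Dg rings and right dg modules\<close>

record 'a dgring = "'a ring" +
  rcomp :: "int \<Rightarrow> 'a set"
  rdiff :: "'a \<Rightarrow> 'a"

locale dg_ring = ring A for A :: "('a, 'z) dgring_scheme" (structure) +
  assumes grading: "is_grading A (rcomp A)"
    and one_comp: "\<one> \<in> rcomp A 0"
    and mult_comp: "\<lbrakk>a \<in> rcomp A i; b \<in> rcomp A j\<rbrakk> \<Longrightarrow> a \<otimes> b \<in> rcomp A (i + j)"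
    and diff_hom: "rdiff A \<in> hom (add_monoid A) (add_monoid A)"
    and diff_comp: "a \<in> rcomp A i \<Longrightarrow> rdiff A a \<in> rcomp A (i + 1)"
    and diff_diff: "a \<in> carrier A \<Longrightarrow> rdiff A (rdiff A a) = \<zero>"
    and leibniz: "\<lbrakk>a \<in> rcomp A i; b \<in> carrier A\<rbrakk> \<Longrightarrow>
      rdiff A (a \<otimes> b) = rdiff A a \<otimes> b \<oplus> signed A i (a \<otimes> rdiff A b)"

definition nonpositive_dg :: "'a dgring \<Rightarrow> bool" where
  "nonpositive_dg A \<longleftrightarrow> (\<forall>i>0. rcomp A i = {\<zero>\<^bsub>A\<^esub>})"

definition bounded_dg :: "'a dgring \<Rightarrow> bool" where
  "bounded_dg A \<longleftrightarrow> (\<exists>N. \<forall>n. \<bar>n\<bar> > N \<longrightarrow> rcomp A n = {\<zero>\<^bsub>A\<^esub>})"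

definition degree_zero_ring :: "'a dgring \<Rightarrow> 'a ring" where
  "degree_zero_ring A =
     \<lparr>carrier = rcomp A 0, mult = mult A, one = one A, zero = zero A, add = add A\<rparr>"

record ('a, 'm) dgmodule = "('a, 'm) rmodule" +
  mcomp :: "int \<Rightarrow> 'm set"
  mdiff :: "'m \<Rightarrow> 'm"

locale dg_module = A?: dg_ring A + right_module A M
  for A :: "('a, 'y) dgring_scheme" (structure) and M :: "('a, 'm, 'z) dgmodule_scheme" (structure) +
  assumes mgrading: "is_grading M (mcomp M)"
    and ract_comp: "\<lbrakk>x \<in> mcomp M i; a \<in> rcomp A j\<rbrakk> \<Longrightarrow> x \<triangleleft>\<^bsub>M\<^esub> a \<in> mcomp M (i + j)"
    and mdiff_hom: "mdiff M \<in> hom (add_monoid M) (add_monoid M)"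
    and mdiff_comp: "x \<in> mcomp M i \<Longrightarrow> mdiff M x \<in> mcomp M (i + 1)"
    and mdiff_mdiff: "x \<in> carrier M \<Longrightarrow> mdiff M (mdiff M x) = \<zero>\<^bsub>M\<^esub>"
    and mleibniz: "\<lbrakk>x \<in> mcomp M i; a \<in> carrier A\<rbrakk> \<Longrightarrow>
      mdiff M (x \<triangleleft>\<^bsub>M\<^esub> a) = (mdiff M x \<triangleleft>\<^bsub>M\<^esub> a) \<oplus>\<^bsub>M\<^esub> signed M i (x \<triangleleft>\<^bsub>M\<^esub> rdiff A a)"

definition dg_submodule :: "'a dgring \<Rightarrow> 'm set \<Rightarrow> ('a, 'm) dgmodule \<Rightarrow> bool" where
  "dg_submodule A N M \<longleftrightarrow>
     rsubmodule A N M \<and> (\<forall>x\<in>N. \<forall>i. hcomp M (mcomp M) i x \<in> N) \<and> (\<forall>x\<in>N. mdiff M x \<in> N)"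

definition dg_sub :: "('a, 'm) dgmodule \<Rightarrow> 'm set \<Rightarrow> ('a, 'm) dgmodule" where
  "dg_sub M N = M\<lparr>carrier := N, mcomp := \<lambda>i. mcomp M i \<inter> N\<rparr>"

definition dg_quot :: "('a, 'm) dgmodule \<Rightarrow> 'm set \<Rightarrow> ('a, 'm set) dgmodule" where
  "dg_quot M L =
     \<lparr>carrier = a_rcosets\<^bsub>M\<^esub> L, mult = undefined, one = undefined, zero = L, add = set_add M,
      ract = quot_ract M L,
      mcomp = \<lambda>i. (\<lambda>x. L +>\<^bsub>M\<^esub> x) ` mcomp M i,
      mdiff = \<lambda>X. \<Union>x\<in>X. L +>\<^bsub>M\<^esub> mdiff M x\<rparr>"

definition dg_hom :: "'a dgring \<Rightarrow> ('a, 'm) dgmodule \<Rightarrow> ('a, 'n) dgmodule \<Rightarrow> ('m \<Rightarrow> 'n) set" where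
  "dg_hom A M N =
     {f \<in> rmod_hom A M N.
        (\<forall>i. \<forall>x\<in>mcomp M i. f x \<in> mcomp N i) \<and> (\<forall>x\<in>carrier M. f (mdiff M x) = mdiff N (f x))}"

definition dg_isomorphic :: "'a dgring \<Rightarrow> ('a, 'm) dgmodule \<Rightarrow> ('a, 'n) dgmodule \<Rightarrow> bool" where
  "dg_isomorphic A M N \<longleftrightarrow> (\<exists>f\<in>dg_hom A M N. bij_betw f (carrier M) (carrier N))"

definition regular_dgmodule :: "'a dgring \<Rightarrow> ('a, 'a) dgmodule" where
  "regular_dgmodule A =
     \<lparr>carrier = carrier A, mult = mult A, one = one A, zero = zero A, add = add A,
      ract = mult A, mcomp = rcomp A, mdiff = rdiff A\<rparr>"

definition right_dg_ideal :: "'a dgring \<Rightarrow> 'a set \<Rightarrow> bool" where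
  "right_dg_ideal A I \<longleftrightarrow> dg_submodule A I (regular_dgmodule A)"

definition right_dg_noetherian :: "'a dgring \<Rightarrow> bool" where
  "right_dg_noetherian A \<longleftrightarrow>
     (\<forall>I :: nat \<Rightarrow> 'a set. (\<forall>n. right_dg_ideal A (I n)) \<and> (\<forall>n. I n \<subseteq> I (Suc n)) \<longrightarrow>
        (\<exists>N. \<forall>n\<ge>N. I n = I N))"

text \<open>\<open>M[n]\<^sup>i = M\<^bsup>n+i\<^esup>\<close> with differential \<open>(-1)\<^sup>n d\<close>; for right modules the action is unchanged.\<close>
definition dg_shift :: "int \<Rightarrow> ('a, 'm) dgmodule \<Rightarrow> ('a, 'm) dgmodule" where
  "dg_shift n M = M\<lparr>mcomp := \<lambda>i. mcomp M (i + n), mdiff := \<lambda>x. signed M n (mdiff M x)\<rparr>"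

text \<open>The \<open>A\<^sup>0\<close>-module obtained from a dg module by forgetting the differential and the grading;
  the elements of \<open>A\<close> outside \<open>A\<^sup>0\<close> become irrelevant because the notions for right modules only
  look at the action of the carrier of the base ring.\<close>
definition forget :: "('a, 'm) dgmodule \<Rightarrow> ('a, 'm) rmodule" where
  "forget M = rmodule.truncate M"

text \<open>The dg module \<open>D(M)\<close>: in a pair \<open>(x, y)\<close> the entry \<open>x\<close> sits in degree \<open>-1\<close> and \<open>y\<close> in
  degree \<open>0\<close>.  Only the components \<open>a\<^sub>0\<close> and \<open>a\<^sub>-\<^sub>1\<close> of \<open>a\<close> act, the latter by
  \<open>(x, y) a\<^sub>-\<^sub>1 = (y d(a\<^sub>-\<^sub>1), 0)\<close>.\<close>
definition Dmod :: "'a dgring \<Rightarrow> ('a, 'm) rmodule \<Rightarrow> ('a, 'm \<times> 'm) dgmodule" where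
  "Dmod A M =
     \<lparr>carrier = carrier M \<times> carrier M, mult = undefined, one = undefined,
      zero = (\<zero>\<^bsub>M\<^esub>, \<zero>\<^bsub>M\<^esub>),
      add = (\<lambda>(x, y) (x', y'). (x \<oplus>\<^bsub>M\<^esub> x', y \<oplus>\<^bsub>M\<^esub> y')),
      ract = (\<lambda>(x, y) a.
        ((x \<triangleleft>\<^bsub>M\<^esub> hcomp A (rcomp A) 0 a) \<oplus>\<^bsub>M\<^esub> (y \<triangleleft>\<^bsub>M\<^esub> rdiff A (hcomp A (rcomp A) (-1) a)),
         y \<triangleleft>\<^bsub>M\<^esub> hcomp A (rcomp A) 0 a)),
      mcomp = (\<lambda>i. if i = -1 then carrier M \<times> {\<zero>\<^bsub>M\<^esub>}
                   else if i = 0 then {\<zero>\<^bsub>M\<^esub>} \<times> carrier M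
                   else {(\<zero>\<^bsub>M\<^esub>, \<zero>\<^bsub>M\<^esub>)}),
      mdiff = (\<lambda>(x, y). (\<zero>\<^bsub>M\<^esub>, x))\<rparr>"


section \<open>The atom spectrum of the category of right dg modules\<close>

definition dg_common_sub :: "'a dgring \<Rightarrow> ('a, 'm) dgmodule \<Rightarrow> ('a, 'n) dgmodule \<Rightarrow> bool" where
  "dg_common_sub A M N \<longleftrightarrow>
     (\<exists>K L. dg_submodule A K M \<and> K \<noteq> {\<zero>\<^bsub>M\<^esub>} \<and> dg_submodule A L N \<and> L \<noteq> {\<zero>\<^bsub>N\<^esub>} \<and>
            dg_isomorphic A (dg_sub M K) (dg_sub N L))"

definition dg_monoform :: "'a dgring \<Rightarrow> ('a, 'm) dgmodule \<Rightarrow> bool" where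
  "dg_monoform A H \<longleftrightarrow>
     dg_module A H \<and> carrier H \<noteq> {\<zero>\<^bsub>H\<^esub>} \<and>
     (\<forall>L. dg_submodule A L H \<and> L \<noteq> {\<zero>\<^bsub>H\<^esub>} \<longrightarrow> \<not> dg_common_sub A H (dg_quot H L))"

definition dg_atom :: "'a dgring \<Rightarrow> ('a, 'm) dgmodule \<Rightarrow> ('a, 'u) dgmodule set" where
  "dg_atom A H = {H'. dg_monoform A H' \<and> dg_common_sub A H' H}"

definition dg_Spec :: "'a dgring \<Rightarrow> ('a, 'u) dgmodule set set" where
  "dg_Spec A = {dg_atom A H | H :: ('a, 'u) dgmodule. dg_monoform A H}"

definition dg_Supp :: "'a dgring \<Rightarrow> ('a, 'u) dgmodule \<Rightarrow> ('a, 'u) dgmodule set set" where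
  "dg_Supp A M =
     {dg_atom A (dg_quot (dg_sub M K) L) | K L.
        dg_submodule A K M \<and> dg_submodule A L M \<and> L \<subseteq> K \<and>
        dg_monoform A (dg_quot (dg_sub M K) L)}"

definition dg_Spec_topology :: "'a dgring \<Rightarrow> ('a, 'u) dgmodule set topology" where
  "dg_Spec_topology A =
     topology_generated_by {dg_Supp A M | M :: ('a, 'u) dgmodule. dg_module A M}"

text \<open>The action \<open>n \<cdot> \<alpha>\<close> on atoms.  An atom is itself the set of its representatives and the
  classes of their shifts all coincide, so the union is the class of \<open>X[n]\<close> for any
  representative \<open>X\<close> of \<open>\<alpha>\<close>.\<close>
definition atom_shift :: "'a dgring \<Rightarrow> int \<Rightarrow> ('a, 'u) dgmodule set \<Rightarrow> ('a, 'u) dgmodule set" where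
  "atom_shift A n \<alpha> = (\<Union>X\<in>\<alpha>. dg_atom A (dg_shift n X))"

text \<open>The quotient map \<open>\<pi>\<close>; the points of the quotient space are the \<open>\<int>\<close>-orbits.\<close>
definition atom_orbit :: "'a dgring \<Rightarrow> ('a, 'u) dgmodule set \<Rightarrow> ('a, 'u) dgmodule set set" where
  "atom_orbit A \<alpha> = {atom_shift A n \<alpha> | n. True}"

definition dg_SpecZ :: "'a dgring \<Rightarrow> ('a, 'u) dgmodule set set set" where
  "dg_SpecZ A = atom_orbit A ` dg_Spec A"

definition dg_SpecZ_topology :: "'a dgring \<Rightarrow> ('a, 'u) dgmodule set set topology" where
  "dg_SpecZ_topology A =
     topology (\<lambda>U. U \<subseteq> dg_SpecZ A \<and>
       openin (dg_Spec_topology A) {\<alpha> \<in> dg_Spec A. atom_orbit A \<alpha> \<in> U})"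

lemma istopology_SpecZ:
  "istopology (\<lambda>U. U \<subseteq> dg_SpecZ A \<and> openin (dg_Spec_topology A) {\<alpha> \<in> dg_Spec A. atom_orbit A \<alpha> \<in> U})"
  unfolding istopology_def
proof (intro conjI allI impI, goal_cases)
  case (1 S T) then show ?case by blast
next
  case (2 S T)
  have "{\<alpha> \<in> dg_Spec A. atom_orbit A \<alpha> \<in> S \<inter> T} = {\<alpha> \<in> dg_Spec A. atom_orbit A \<alpha> \<in> S} \<inter> {\<alpha> \<in> dg_Spec A. atom_orbit A \<alpha> \<in> T}" by auto
  then show ?case using 2 by (simp add: openin_Int)
next
  case (3 K) then show ?case by blast
next
  case (4 K)
  have "{\<alpha> \<in> dg_Spec A. atom_orbit A \<alpha> \<in> \<Union>K} = (\<Union>U\<in>K. {\<alpha> \<in> dg_Spec A. atom_orbit A \<alpha> \<in> U})" by auto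
  then show ?case using 4 by auto
qed

definition dg_SuppZ :: "'a dgring \<Rightarrow> ('a, 'u) dgmodule \<Rightarrow> ('a, 'u) dgmodule set set set" where
  "dg_SuppZ A M = atom_orbit A ` dg_Supp A M"

text \<open>The map sending the class of \<open>H\<close> to the orbit of the class of \<open>D(H)\<close>.  That orbit, itself a
  set, does not depend on the representative \<open>H\<close>, so the union over all representatives is
  that orbit.\<close>
definition spec_bij :: "'a dgring \<Rightarrow> ('a, 'u) rmodule set \<Rightarrow> ('a, 'u) dgmodule set set" where
  "spec_bij A \<alpha> = (\<Union>H\<in>\<alpha>. atom_orbit A (dg_atom A (Dmod A H)))"

end

theory Submission
  imports Defs
begin

text \<open>Call \<open>x \<mapsto> (d x\<^sub>-\<^sub>1, x\<^sub>0)\<close> the canonical partial morphism from a dg module \<open>M\<close> to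
  \<open>D(M)\<close>; it is defined on the dg submodule \<open>M\<^bsup><0\<^esup> \<oplus> Z\<^sup>0(M)\<close>. Composed with \<open>D\<close> of a partial morphism from
  \<open>Z\<^sup>0(M)\<close> to a monoform \<open>H\<close> it exhibits the atom of \<open>D(H)\<close> in \<open>Supp M\<close>. If \<open>M\<close> is monoform
  and, after a shift, its lowest nonzero cycles have degree \<open>0\<close>, the canonical morphism is injective,
  so that \<open>M\<close> is atom-equivalent to \<open>D(Z\<^sup>0(M))\<close>; boundedness of \<open>A\<close> provides lowest cycles in a
  submodule generated by a homogeneous cycle. Over \<open>A\<^sup>0\<close> the differential is linear, hence the support of
  \<open>M\<close> over \<open>A\<^sup>0\<close> is already the union of the supports of the \<open>Z\<^sup>n(M)\<close>.\<close>

section \<open>Abelian groups with operators\<close>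

text \<open>Nonpositivity enters through one fact: \<open>A\<^sup>1 = 0\<close>, so \<open>d\<close>
  kills \<open>A\<^sup>0\<close>. Hence \<open>d\<close> and the projections to components are
  linear over \<open>A\<^sup>0\<close>, and partial morphisms of \<open>A\<^sup>0\<close>-modules
  can be moved along them. The shape of the canonical morphism is forced: the differential of
  \<open>D\<close> is the identity, so a chain map into \<open>D(M)\<close> is determined in degree
  \<open>-1\<close> by its values on boundaries; and for a cycle \<open>x\<close> of degree
  \<open>0\<close> and \<open>a\<close> of degree \<open>-1\<close> Leibniz gives
  \<open>d (x a) = x (d a)\<close>, which is the action on \<open>D(M)\<close>. An obstacle is that
  an atom is a class of modules over one fixed type, whereas subquotients live on cosets and
  \<open>D(H)\<close> on pairs. Relations between different types carry the arguments, and copies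
  over the universe type are made only where an atom needs a representative. For the homeomorphism,
  continuity is tested on the spectrum before orbits are formed. In the inverse direction the
  equality of supports is applied to \<open>D(N)\<close>, which over \<open>A\<^sup>0\<close>
  consists of two copies of \<open>N\<close>, so that every basic open set of
  \<open>Spec (Mod A\<^sup>0)\<close> comes from a dg module.\<close>

locale op_group = abelian_group M for \<Omega> :: "'o set" and M :: "('o, 'm) rmodule" (structure) +
  assumes op_closed: "\<lbrakk>x \<in> carrier M; a \<in> \<Omega>\<rbrakk> \<Longrightarrow> x \<triangleleft>\<^bsub>M\<^esub> a \<in> carrier M"
    and op_add: "\<lbrakk>x \<in> carrier M; y \<in> carrier M; a \<in> \<Omega>\<rbrakk> \<Longrightarrow> (x \<oplus> y) \<triangleleft>\<^bsub>M\<^esub> a = (x \<triangleleft>\<^bsub>M\<^esub> a) \<oplus> (y \<triangleleft>\<^bsub>M\<^esub> a)"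
begin

lemma op_zero [simp]: "a \<in> \<Omega> \<Longrightarrow> \<zero> \<triangleleft>\<^bsub>M\<^esub> a = \<zero>"
  using op_add[of \<zero> \<zero> a] op_closed[of \<zero> a] by (metis a_transpose_inv l_neg r_zero zero_closed)

end

lemma (in abelian_group) minus_zero_zero [simp]: "\<ominus> \<zero> = \<zero>"
  by (metis l_neg r_zero zero_closed a_inv_closed)

lemma (in abelian_group) minus_eq_zeroD: "\<lbrakk>x \<ominus> y = \<zero>; x \<in> carrier G; y \<in> carrier G\<rbrakk> \<Longrightarrow> x = y"
  by (metis a_inv_closed a_minus_def minus_equality minus_minus)

section \<open>Additive relations as partial morphisms\<close>

definition op_sub :: "'o set \<Rightarrow> 'm set \<Rightarrow> ('o, 'm) rmodule \<Rightarrow> bool" where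
  "op_sub \<Omega> N M \<longleftrightarrow> additive_subgroup N M \<and> (\<forall>x\<in>N. \<forall>a\<in>\<Omega>. x \<triangleleft>\<^bsub>M\<^esub> a \<in> N)"

text \<open>Homomorphisms between subquotients are encoded as additive relations stable under the
  operators, i.e. as subobjects of a product. This avoids forming quotients altogether.\<close>

definition op_rel :: "'o set \<Rightarrow> ('o, 'm) rmodule \<Rightarrow> ('o, 'n) rmodule \<Rightarrow> ('m \<times> 'n) set \<Rightarrow> bool" where
  "op_rel \<Omega> M N G \<longleftrightarrow> op_group \<Omega> M \<and> op_group \<Omega> N \<and> G \<subseteq> carrier M \<times> carrier N \<and> G \<noteq> {} \<and>
     (\<forall>x y x' y'. (x, y) \<in> G \<longrightarrow> (x', y') \<in> G \<longrightarrow> (x \<ominus>\<^bsub>M\<^esub> x', y \<ominus>\<^bsub>N\<^esub> y') \<in> G) \<and>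
     (\<forall>x y a. (x, y) \<in> G \<longrightarrow> a \<in> \<Omega> \<longrightarrow> (x \<triangleleft>\<^bsub>M\<^esub> a, y \<triangleleft>\<^bsub>N\<^esub> a) \<in> G)"

text \<open>For an additive relation the fibre over zero decides: if it is trivial, \<open>G\<close>
  is the graph of a partial homomorphism. The same condition on \<open>G\<inverse>\<close> then says
  that this homomorphism is injective.\<close>

definition single_val :: "('o, 'm) rmodule \<Rightarrow> ('o, 'n) rmodule \<Rightarrow> ('m \<times> 'n) set \<Rightarrow> bool" where
  "single_val M N G \<longleftrightarrow> (\<forall>y. (\<zero>\<^bsub>M\<^esub>, y) \<in> G \<longrightarrow> y = \<zero>\<^bsub>N\<^esub>)"

definition nonzero_rel :: "('o, 'n) rmodule \<Rightarrow> ('m \<times> 'n) set \<Rightarrow> bool" where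
  "nonzero_rel N G \<longleftrightarrow> (\<exists>x y. (x, y) \<in> G \<and> y \<noteq> \<zero>\<^bsub>N\<^esub>)"

text \<open>The domain and the range of an injective partial homomorphism are isomorphic subobjects;
  a nonzero value makes both of them nonzero.\<close>

definition op_common :: "'o set \<Rightarrow> ('o, 'm) rmodule \<Rightarrow> ('o, 'n) rmodule \<Rightarrow> bool" where
  "op_common \<Omega> M N \<longleftrightarrow>
     (\<exists>G. op_rel \<Omega> M N G \<and> single_val M N G \<and> single_val N M (G\<inverse>) \<and> nonzero_rel N G)"

text \<open>Every nonzero morphism from a subobject of \<open>H\<close> to \<open>H\<close> is a monomorphism.\<close>
definition op_monoform :: "'o set \<Rightarrow> ('o, 'm) rmodule \<Rightarrow> bool" where
  "op_monoform \<Omega> H \<longleftrightarrow> op_group \<Omega> H \<and> carrier H \<noteq> {\<zero>\<^bsub>H\<^esub>} \<and>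
     (\<forall>G. op_rel \<Omega> H H G \<longrightarrow> single_val H H G \<longrightarrow> nonzero_rel H G \<longrightarrow> single_val H H (G\<inverse>))"

lemma op_relD:
  assumes "op_rel \<Omega> M N G"
  shows "op_group \<Omega> M" "op_group \<Omega> N" "(x, y) \<in> G \<Longrightarrow> x \<in> carrier M" "(x, y) \<in> G \<Longrightarrow> y \<in> carrier N"
    "(\<zero>\<^bsub>M\<^esub>, \<zero>\<^bsub>N\<^esub>) \<in> G"
    "\<lbrakk>(x, y) \<in> G; (x', y') \<in> G\<rbrakk> \<Longrightarrow> (x \<ominus>\<^bsub>M\<^esub> x', y \<ominus>\<^bsub>N\<^esub> y') \<in> G"
    "\<lbrakk>(x, y) \<in> G; (x', y') \<in> G\<rbrakk> \<Longrightarrow> (x \<oplus>\<^bsub>M\<^esub> x', y \<oplus>\<^bsub>N\<^esub> y') \<in> G"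
    "(x, y) \<in> G \<Longrightarrow> (\<ominus>\<^bsub>M\<^esub> x, \<ominus>\<^bsub>N\<^esub> y) \<in> G"
    "\<lbrakk>(x, y) \<in> G; a \<in> \<Omega>\<rbrakk> \<Longrightarrow> (x \<triangleleft>\<^bsub>M\<^esub> a, y \<triangleleft>\<^bsub>N\<^esub> a) \<in> G"
proof -
  show M: "op_group \<Omega> M" and N: "op_group \<Omega> N" using assms unfolding op_rel_def by auto
  interpret M: op_group \<Omega> M by fact
  interpret N: op_group \<Omega> N by fact
  have c: "x \<in> carrier M" "y \<in> carrier N" if "(x, y) \<in> G" for x y
    using assms that unfolding op_rel_def by auto
  then show "(x, y) \<in> G \<Longrightarrow> x \<in> carrier M" "(x, y) \<in> G \<Longrightarrow> y \<in> carrier N" by auto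
  have m: "(x \<ominus>\<^bsub>M\<^esub> x', y \<ominus>\<^bsub>N\<^esub> y') \<in> G" if "(x, y) \<in> G" "(x', y') \<in> G" for x y x' y'
    using assms that unfolding op_rel_def by auto
  then show "\<lbrakk>(x, y) \<in> G; (x', y') \<in> G\<rbrakk> \<Longrightarrow> (x \<ominus>\<^bsub>M\<^esub> x', y \<ominus>\<^bsub>N\<^esub> y') \<in> G" .
  obtain u v where "(u, v) \<in> G" using assms unfolding op_rel_def by fast
  from m[OF this this] c[OF this] show z: "(\<zero>\<^bsub>M\<^esub>, \<zero>\<^bsub>N\<^esub>) \<in> G"
    by (simp add: M.r_neg N.r_neg a_minus_def)
  have i: "(\<ominus>\<^bsub>M\<^esub> x, \<ominus>\<^bsub>N\<^esub> y) \<in> G" if "(x, y) \<in> G" for x y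
    using m[OF z that] c[OF that] by (simp add: a_minus_def)
  then show "(x, y) \<in> G \<Longrightarrow> (\<ominus>\<^bsub>M\<^esub> x, \<ominus>\<^bsub>N\<^esub> y) \<in> G" .
  show "(x \<oplus>\<^bsub>M\<^esub> x', y \<oplus>\<^bsub>N\<^esub> y') \<in> G" if "(x, y) \<in> G" "(x', y') \<in> G"
    using m[OF that(1) i[OF that(2)]] c[OF that(1)] c[OF that(2)] by (simp add: a_minus_def)
  show "\<lbrakk>(x, y) \<in> G; a \<in> \<Omega>\<rbrakk> \<Longrightarrow> (x \<triangleleft>\<^bsub>M\<^esub> a, y \<triangleleft>\<^bsub>N\<^esub> a) \<in> G"
    using assms unfolding op_rel_def by auto
qed

lemma op_relI:
  assumes "op_group \<Omega> M" "op_group \<Omega> N"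
    and "\<And>x y. (x, y) \<in> G \<Longrightarrow> x \<in> carrier M \<and> y \<in> carrier N" "(\<zero>\<^bsub>M\<^esub>, \<zero>\<^bsub>N\<^esub>) \<in> G"
    and "\<And>x y x' y'. \<lbrakk>(x, y) \<in> G; (x', y') \<in> G\<rbrakk> \<Longrightarrow> (x \<ominus>\<^bsub>M\<^esub> x', y \<ominus>\<^bsub>N\<^esub> y') \<in> G"
    and "\<And>x y a. \<lbrakk>(x, y) \<in> G; a \<in> \<Omega>\<rbrakk> \<Longrightarrow> (x \<triangleleft>\<^bsub>M\<^esub> a, y \<triangleleft>\<^bsub>N\<^esub> a) \<in> G"
  shows "op_rel \<Omega> M N G"
  unfolding op_rel_def using assms by auto

lemma op_rel_converse: "op_rel \<Omega> M N G \<Longrightarrow> op_rel \<Omega> N M (G\<inverse>)"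
  unfolding op_rel_def by (auto simp: converse_def)

text \<open>Since converses are allowed as factors, this one operation covers composition of partial
  morphisms, factorization through a quotient and transport along an embedding.\<close>

lemma op_rel_comp:
  assumes G: "op_rel \<Omega> M N G" and H: "op_rel \<Omega> N P H"
  shows "op_rel \<Omega> M P (G O H)"
proof (rule op_relI)
  fix x y x' y' assume "(x, y) \<in> G O H" "(x', y') \<in> G O H"
  then obtain u u' where "(x, u) \<in> G" "(u, y) \<in> H" "(x', u') \<in> G" "(u', y') \<in> H" by blast
  then show "(x \<ominus>\<^bsub>M\<^esub> x', y \<ominus>\<^bsub>P\<^esub> y') \<in> G O H"
    using op_relD(6)[OF G] op_relD(6)[OF H] by blast
next
  fix x y a assume "(x, y) \<in> G O H" "a \<in> \<Omega>"
  then show "(x \<triangleleft>\<^bsub>M\<^esub> a, y \<triangleleft>\<^bsub>P\<^esub> a) \<in> G O H"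
    using op_relD(9)[OF G] op_relD(9)[OF H] by blast
next
  show "x \<in> carrier M \<and> y \<in> carrier P" if "(x, y) \<in> G O H" for x y
    using that op_relD(3)[OF G] op_relD(4)[OF H] by blast
  show "(\<zero>\<^bsub>M\<^esub>, \<zero>\<^bsub>P\<^esub>) \<in> G O H" using op_relD(5)[OF G] op_relD(5)[OF H] by blast
qed (use op_relD(1)[OF G] op_relD(2)[OF H] in auto)

lemma op_rel_Id:
  assumes "op_group \<Omega> M" shows "op_rel \<Omega> M M (Id_on (carrier M))"
proof -
  interpret op_group \<Omega> M by fact
  show ?thesis by (rule op_relI) (auto simp: assms op_closed Id_on_def)
qed

lemma (in abelian_group) additive_subgroup_minusI:
  assumes "H \<subseteq> carrier G" "\<zero> \<in> H" "\<And>x y. \<lbrakk>x \<in> H; y \<in> H\<rbrakk> \<Longrightarrow> x \<ominus> y \<in> H"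
  shows "additive_subgroup H G"
proof -
  have i: "\<ominus> x \<in> H" if "x \<in> H" for x
    using assms(1) assms(3)[OF assms(2) that] that by (auto simp: a_minus_def)
  have "x \<oplus> y \<in> H" if "x \<in> H" "y \<in> H" for x y
    using assms(1) assms(3)[OF that(1) i[OF that(2)]] that by (auto simp: a_minus_def)
  then have "subgroup H (add_monoid G)"
    using assms(1,2) i by (intro group.subgroupI) (auto simp: a_group simp flip: a_inv_def)
  then show ?thesis by (simp add: additive_subgroup_def)
qed

lemma op_subI:
  assumes "op_group \<Omega> M" "N \<subseteq> carrier M" "N \<noteq> {}"
    "\<And>x y. \<lbrakk>x \<in> N; y \<in> N\<rbrakk> \<Longrightarrow> x \<ominus>\<^bsub>M\<^esub> y \<in> N" "\<And>x a. \<lbrakk>x \<in> N; a \<in> \<Omega>\<rbrakk> \<Longrightarrow> x \<triangleleft>\<^bsub>M\<^esub> a \<in> N"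
  shows "op_sub \<Omega> N M"
proof -
  interpret op_group \<Omega> M by fact
  obtain u where "u \<in> N" using assms(3) by blast
  then have "\<zero>\<^bsub>M\<^esub> \<in> N" using assms(4)[of u u] assms(2) by (auto simp: a_minus_def r_neg)
  then have "additive_subgroup N M" by (rule additive_subgroup_minusI[OF assms(2) _ assms(4)])
  then show ?thesis using assms(5) by (auto simp: op_sub_def)
qed

lemma op_subD:
  assumes "op_group \<Omega> M" "op_sub \<Omega> N M"
  shows "x \<in> N \<Longrightarrow> x \<in> carrier M" "\<zero>\<^bsub>M\<^esub> \<in> N" "\<lbrakk>x \<in> N; y \<in> N\<rbrakk> \<Longrightarrow> x \<oplus>\<^bsub>M\<^esub> y \<in> N"
    "\<lbrakk>x \<in> N; y \<in> N\<rbrakk> \<Longrightarrow> x \<ominus>\<^bsub>M\<^esub> y \<in> N" "\<lbrakk>x \<in> N; a \<in> \<Omega>\<rbrakk> \<Longrightarrow> x \<triangleleft>\<^bsub>M\<^esub> a \<in> N" "x \<in> N \<Longrightarrow> \<ominus>\<^bsub>M\<^esub> x \<in> N"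
proof -
  interpret op_group \<Omega> M by fact
  interpret additive_subgroup N M using assms(2) op_sub_def by blast
  show "x \<in> N \<Longrightarrow> x \<in> carrier M" "\<zero>\<^bsub>M\<^esub> \<in> N" "\<lbrakk>x \<in> N; y \<in> N\<rbrakk> \<Longrightarrow> x \<oplus>\<^bsub>M\<^esub> y \<in> N"
    "\<lbrakk>x \<in> N; y \<in> N\<rbrakk> \<Longrightarrow> x \<ominus>\<^bsub>M\<^esub> y \<in> N" "x \<in> N \<Longrightarrow> \<ominus>\<^bsub>M\<^esub> x \<in> N" by (auto simp: a_minus_def)
  show "\<lbrakk>x \<in> N; a \<in> \<Omega>\<rbrakk> \<Longrightarrow> x \<triangleleft>\<^bsub>M\<^esub> a \<in> N" using assms(2) op_sub_def by metis
qed

lemma op_sub_carrier: "op_group \<Omega> M \<Longrightarrow> op_sub \<Omega> (carrier M) M"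
proof (rule op_subI)
  assume "op_group \<Omega> M"
  then interpret op_group \<Omega> M .
  show "carrier M \<noteq> {}" using zero_closed by blast
qed (auto simp: op_group.op_closed op_group_def abelian_group.minus_closed)

lemma op_rel_restrict:
  assumes G: "op_rel \<Omega> M N G" and K: "op_sub \<Omega> K M" and L: "op_sub \<Omega> L N"
  shows "op_rel \<Omega> M N (G \<inter> K \<times> L)"
proof -
  note M = op_relD(1)[OF G] and N = op_relD(2)[OF G]
  show ?thesis
    by (rule op_relI) (use op_subD[OF M K] op_subD[OF N L] M N in \<open>auto intro: op_relD(5,6,9)[OF G]\<close>)
qed

lemma op_sub_Domain:
  assumes "op_rel \<Omega> M N G" shows "op_sub \<Omega> (Domain G) M"
proof (rule op_subI)
  show "x \<ominus>\<^bsub>M\<^esub> y \<in> Domain G" if "x \<in> Domain G" "y \<in> Domain G" for x y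
    using that op_relD(6)[OF assms] by blast
  show "x \<triangleleft>\<^bsub>M\<^esub> a \<in> Domain G" if "x \<in> Domain G" "a \<in> \<Omega>" for x a
    using that op_relD(9)[OF assms] by blast
  show "Domain G \<subseteq> carrier M" "Domain G \<noteq> {}" "op_group \<Omega> M"
    using op_relD(1,3,5)[OF assms] by blast+
qed

lemma op_sub_kernel:
  assumes "op_rel \<Omega> M N G" shows "op_sub \<Omega> {x. (x, \<zero>\<^bsub>N\<^esub>) \<in> G} M"
proof -
  interpret N: op_group \<Omega> N using op_relD(2) assms by blast
  show ?thesis
  proof (rule op_subI)
    fix x y assume "x \<in> {x. (x, \<zero>\<^bsub>N\<^esub>) \<in> G}" "y \<in> {x. (x, \<zero>\<^bsub>N\<^esub>) \<in> G}"
    then show "x \<ominus>\<^bsub>M\<^esub> y \<in> {x. (x, \<zero>\<^bsub>N\<^esub>) \<in> G}"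
      using op_relD(6)[OF assms, of x "\<zero>\<^bsub>N\<^esub>" y "\<zero>\<^bsub>N\<^esub>"] by (simp add: a_minus_def[of N])
  next
    fix x a assume "x \<in> {x. (x, \<zero>\<^bsub>N\<^esub>) \<in> G}" "a \<in> \<Omega>"
    then show "x \<triangleleft>\<^bsub>M\<^esub> a \<in> {x. (x, \<zero>\<^bsub>N\<^esub>) \<in> G}"
      using op_relD(9)[OF assms, of x "\<zero>\<^bsub>N\<^esub>" a] by simp
  qed (use op_relD[OF assms] in auto)
qed

lemma single_valD:
  assumes "op_rel \<Omega> M N G" "single_val M N G" "(x, y) \<in> G" "(x, y') \<in> G"
  shows "y = y'"
proof -
  interpret M: op_group \<Omega> M using op_relD(1) assms by blast
  interpret N: op_group \<Omega> N using op_relD(2) assms by blast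
  have "(x \<ominus>\<^bsub>M\<^esub> x, y \<ominus>\<^bsub>N\<^esub> y') \<in> G" using op_relD(6)[OF assms(1)] assms(3,4) by blast
  then have "y \<ominus>\<^bsub>N\<^esub> y' = \<zero>\<^bsub>N\<^esub>"
    using assms(2) op_relD(3)[OF assms(1,3)] by (simp add: single_val_def M.r_neg a_minus_def[of M])
  then show ?thesis using op_relD(4)[OF assms(1,3)] op_relD(4)[OF assms(1,4)] N.minus_eq_zeroD by blast
qed

lemma single_val_comp:
  "\<lbrakk>single_val M N G; single_val N P H\<rbrakk> \<Longrightarrow> single_val M P (G O H)"
  by (auto simp: single_val_def)

lemma nonzero_rel_converse:
  "\<lbrakk>single_val N M (G\<inverse>); nonzero_rel N G; op_rel \<Omega> M N G; single_val M N G\<rbrakk> \<Longrightarrow> nonzero_rel M (G\<inverse>)"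
  unfolding single_val_def nonzero_rel_def by blast

lemma op_common_sym: "op_common \<Omega> M N \<Longrightarrow> op_common \<Omega> N M"
  unfolding op_common_def
proof (elim exE conjE)
  fix G assume G: "op_rel \<Omega> M N G" "single_val M N G" "single_val N M (G\<inverse>)" "nonzero_rel N G"
  then show "\<exists>G. op_rel \<Omega> N M G \<and> single_val N M G \<and> single_val M N (G\<inverse>) \<and> nonzero_rel M G"
    by (intro exI[of _ "G\<inverse>"]) (simp add: op_rel_converse nonzero_rel_converse)
qed

section \<open>Monoform objects\<close>

text \<open>If \<open>K\<close> and \<open>L\<close> met only in zero, the projection of
  \<open>K + L\<close> to \<open>K\<close> along \<open>L\<close> would be a nonzero partial
  endomorphism of \<open>H\<close> with kernel \<open>L\<close>, against monoformity.\<close>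

lemma op_monoform_uniform:
  assumes H: "op_monoform \<Omega> H" and "op_sub \<Omega> K H" "op_sub \<Omega> L H" "K \<noteq> {\<zero>\<^bsub>H\<^esub>}" "L \<noteq> {\<zero>\<^bsub>H\<^esub>}"
  shows "\<exists>x\<in>K \<inter> L. x \<noteq> \<zero>\<^bsub>H\<^esub>"
proof (rule ccontr)
  assume KL: "\<not> ?thesis"
  have oH: "op_group \<Omega> H" using H op_monoform_def by blast
  interpret op_group \<Omega> H by fact
  note K = op_subD[OF oH assms(2)] and L = op_subD[OF oH assms(3)]
  let ?G = "{(k \<oplus>\<^bsub>H\<^esub> l, k) | k l. k \<in> K \<and> l \<in> L}"
  have r: "op_rel \<Omega> H H ?G"
  proof (rule op_relI)
    fix x y x' y' assume "(x, y) \<in> ?G" "(x', y') \<in> ?G"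
    then obtain l l' where a: "x = y \<oplus>\<^bsub>H\<^esub> l" "x' = y' \<oplus>\<^bsub>H\<^esub> l'" "y \<in> K" "y' \<in> K" "l \<in> L" "l' \<in> L" by blast
    have c: "y \<in> carrier H" "y' \<in> carrier H" "l \<in> carrier H" "l' \<in> carrier H"
      using a K(1) L(1) by blast+
    have "x \<ominus>\<^bsub>H\<^esub> x' = (y \<ominus>\<^bsub>H\<^esub> y') \<oplus>\<^bsub>H\<^esub> (l \<ominus>\<^bsub>H\<^esub> l')"
      unfolding a(1,2) using c by (simp add: a_minus_def minus_add a_assoc a_lcomm)
    then show "(x \<ominus>\<^bsub>H\<^esub> x', y \<ominus>\<^bsub>H\<^esub> y') \<in> ?G"
      using K(4)[OF a(3,4)] L(4)[OF a(5,6)] by blast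
  next
    fix x y a assume "(x, y) \<in> ?G" "a \<in> \<Omega>"
    then obtain l where "x = y \<oplus>\<^bsub>H\<^esub> l" "y \<in> K" "l \<in> L" by blast
    then have "x \<triangleleft>\<^bsub>H\<^esub> a = (y \<triangleleft>\<^bsub>H\<^esub> a) \<oplus>\<^bsub>H\<^esub> (l \<triangleleft>\<^bsub>H\<^esub> a)" "y \<triangleleft>\<^bsub>H\<^esub> a \<in> K" "l \<triangleleft>\<^bsub>H\<^esub> a \<in> L"
      using K(1,5) L(1,5) op_add \<open>a \<in> \<Omega>\<close> by simp_all
    then show "(x \<triangleleft>\<^bsub>H\<^esub> a, y \<triangleleft>\<^bsub>H\<^esub> a) \<in> ?G" by blast
  next
    show "(\<zero>\<^bsub>H\<^esub>, \<zero>\<^bsub>H\<^esub>) \<in> ?G" using K(2) L(2) by force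
  qed (use oH K L in auto)
  obtain k where k: "k \<in> K" "k \<noteq> \<zero>\<^bsub>H\<^esub>" using assms(4) K(2) by blast
  obtain l where l: "l \<in> L" "l \<noteq> \<zero>\<^bsub>H\<^esub>" using assms(5) L(2) by blast
  have "(k \<oplus>\<^bsub>H\<^esub> \<zero>\<^bsub>H\<^esub>, k) \<in> ?G" using k L(2) by blast
  then have nz: "nonzero_rel H ?G" using k(2) unfolding nonzero_rel_def by blast
  have sv: "single_val H H ?G" unfolding single_val_def
  proof (intro allI impI)
    fix y assume "(\<zero>\<^bsub>H\<^esub>, y) \<in> ?G"
    then obtain l where a: "y \<in> K" "l \<in> L" "y \<oplus>\<^bsub>H\<^esub> l = \<zero>\<^bsub>H\<^esub>" by force
    then have "y = \<ominus>\<^bsub>H\<^esub> l" using K L by (metis minus_equality)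
    then have "y \<in> L" using L a by auto
    then show "y = \<zero>\<^bsub>H\<^esub>" using KL a by blast
  qed
  have "(\<zero>\<^bsub>H\<^esub> \<oplus>\<^bsub>H\<^esub> l, \<zero>\<^bsub>H\<^esub>) \<in> ?G" using K(2) l by blast
  then have "(l, \<zero>\<^bsub>H\<^esub>) \<in> ?G" using l L by simp
  moreover have "single_val H H (?G\<inverse>)" using H r sv nz unfolding op_monoform_def by blast
  ultimately have "l = \<zero>\<^bsub>H\<^esub>" unfolding single_val_def by blast
  then show False using l by blast
qed

text \<open>The subobjects of \<open>H\<close> shared with \<open>M\<close> and with
  \<open>N\<close> intersect nontrivially because a monoform object is uniform, and composing
  through the intersection gives a common subobject of \<open>M\<close> and
  \<open>N\<close>.\<close>

lemma op_common_trans: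
  assumes "op_common \<Omega> M H" "op_common \<Omega> H N" "op_monoform \<Omega> H"
  shows "op_common \<Omega> M N"
proof -
  obtain G where G: "op_rel \<Omega> M H G" "single_val M H G" "single_val H M (G\<inverse>)" "nonzero_rel H G"
    using assms(1) op_common_def by blast
  obtain G' where G': "op_rel \<Omega> H N G'" "single_val H N G'" "single_val N H (G'\<inverse>)" "nonzero_rel N G'"
    using assms(2) op_common_def by blast
  have "op_sub \<Omega> (Domain (G\<inverse>)) H" "op_sub \<Omega> (Domain G') H"
    using op_sub_Domain op_rel_converse G(1) G'(1) by blast+
  moreover obtain x y where "(x, y) \<in> G" "y \<noteq> \<zero>\<^bsub>H\<^esub>" using G(4) nonzero_rel_def by metis
  then have "Domain (G\<inverse>) \<noteq> {\<zero>\<^bsub>H\<^esub>}" by blast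
  moreover obtain u v where uv: "(u, v) \<in> G'" "v \<noteq> \<zero>\<^bsub>N\<^esub>" using G'(4) nonzero_rel_def by metis
  then have "u \<noteq> \<zero>\<^bsub>H\<^esub>" using G'(2) by (auto simp: single_val_def)
  then have "Domain G' \<noteq> {\<zero>\<^bsub>H\<^esub>}" using uv(1) by blast
  ultimately obtain h where h: "h \<in> Domain (G\<inverse>)" "h \<in> Domain G'" "h \<noteq> \<zero>\<^bsub>H\<^esub>"
    using op_monoform_uniform[OF assms(3)] by blast
  then obtain x y where "(x, h) \<in> G" "(h, y) \<in> G'" by blast
  moreover from this h have "y \<noteq> \<zero>\<^bsub>N\<^esub>" using G'(3) by (auto simp: single_val_def)
  ultimately have "nonzero_rel N (G O G')" by (auto simp: nonzero_rel_def)
  moreover have "single_val N M ((G O G')\<inverse>)"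
    using single_val_comp[OF G'(3) G(3)] by (simp add: converse_relcomp)
  ultimately show ?thesis unfolding op_common_def
    using op_rel_comp[OF G(1) G'(1)] single_val_comp[OF G(2) G'(2)] by blast
qed

text \<open>The embedding \<open>G\<close>, defined on all of \<open>M\<close>, turns a partial
  endomorphism \<open>P\<close> of \<open>M\<close> into one of \<open>H\<close> by conjugation, and
  injectivity is read back along \<open>G\<close>.\<close>

lemma op_monoform_pullback:
  assumes H: "op_monoform \<Omega> H" and G: "op_rel \<Omega> M H G" "single_val M H G" "single_val H M (G\<inverse>)"
    and tot: "\<And>x. x \<in> carrier M \<Longrightarrow> x \<in> Domain G" and nz: "carrier M \<noteq> {\<zero>\<^bsub>M\<^esub>}"
  shows "op_monoform \<Omega> M"
  unfolding op_monoform_def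
proof (intro conjI allI impI)
  show "op_group \<Omega> M" using op_relD(1)[OF G(1)] .
next
  fix P assume P: "op_rel \<Omega> M M P" "single_val M M P" "nonzero_rel M P"
  let ?Q = "G\<inverse> O P O G"
  have Q: "op_rel \<Omega> H H ?Q"
    by (rule op_rel_comp[OF op_rel_converse[OF G(1)] op_rel_comp[OF P(1) G(1)]])
  have Q': "single_val H H ?Q"
    by (rule single_val_comp[OF G(3) single_val_comp[OF P(2) G(2)]])
  obtain x y where xy: "(x, y) \<in> P" "y \<noteq> \<zero>\<^bsub>M\<^esub>" using P(3) nonzero_rel_def by metis
  then obtain u v where uv: "(x, u) \<in> G" "(y, v) \<in> G"
    using tot op_relD(3,4)[OF P(1) xy(1)] by blast
  then have "v \<noteq> \<zero>\<^bsub>H\<^esub>" using G(3) xy by (auto simp: single_val_def)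
  then have "nonzero_rel H ?Q" using uv xy unfolding nonzero_rel_def by blast
  then have inj: "single_val H H (?Q\<inverse>)" using H Q Q' unfolding op_monoform_def by simp
  show "single_val M M (P\<inverse>)" unfolding single_val_def
  proof (intro allI impI)
    fix x assume "(\<zero>\<^bsub>M\<^esub>, x) \<in> P\<inverse>"
    then have x: "(x, \<zero>\<^bsub>M\<^esub>) \<in> P" by simp
    then obtain u where u: "(x, u) \<in> G" using tot op_relD(3)[OF P(1)] by blast
    then have "(u, \<zero>\<^bsub>H\<^esub>) \<in> ?Q" using x op_relD(5)[OF G(1)] by blast
    then have "u = \<zero>\<^bsub>H\<^esub>" using inj by (auto simp: single_val_def)
    then show "x = \<zero>\<^bsub>M\<^esub>" using u G(3) by (auto simp: single_val_def)
  qed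
qed (use nz in auto)

section \<open>Transport of structure, isomorphisms and quotients\<close>

text \<open>\<open>Q\<close> is only a record here; its laws are inherited from \<open>K\<close>
  along the surjection \<open>f\<close>. The uses are subobjects with \<open>f\<close> the identity,
  quotients with \<open>f\<close> the coset map, and copies over another type with \<open>f\<close>
  an injection.\<close>

lemma op_group_image:
  fixes Q :: "('o, 'n) rmodule"
  assumes M: "op_group \<Omega> M" and K: "op_sub \<Omega> K M" and im: "f ` K = carrier Q"
    and z: "f \<zero>\<^bsub>M\<^esub> = \<zero>\<^bsub>Q\<^esub>"
    and add: "\<And>x y. \<lbrakk>x \<in> K; y \<in> K\<rbrakk> \<Longrightarrow> f (x \<oplus>\<^bsub>M\<^esub> y) = f x \<oplus>\<^bsub>Q\<^esub> f y"
    and op: "\<And>x a. \<lbrakk>x \<in> K; a \<in> \<Omega>\<rbrakk> \<Longrightarrow> f (x \<triangleleft>\<^bsub>M\<^esub> a) = f x \<triangleleft>\<^bsub>Q\<^esub> a"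
  shows "op_group \<Omega> Q" "op_rel \<Omega> M Q {(x, f x) | x. x \<in> K}" "single_val M Q {(x, f x) | x. x \<in> K}"
    "Domain {(x, f x) | x. x \<in> K} = K" "Range {(x, f x) | x. x \<in> K} = carrier Q"
    "\<And>x y. \<lbrakk>x \<in> K; y \<in> K\<rbrakk> \<Longrightarrow> f (x \<ominus>\<^bsub>M\<^esub> y) = f x \<ominus>\<^bsub>Q\<^esub> f y"
proof -
  interpret M: op_group \<Omega> M by fact
  note Kd = op_subD[OF M K]
  have "abelian_group Q"
  proof (rule abelian_groupI)
    fix x y assume "x \<in> carrier Q" "y \<in> carrier Q"
    then obtain u v where "x = f u" "y = f v" "u \<in> K" "v \<in> K" using im by blast
    then show "x \<oplus>\<^bsub>Q\<^esub> y \<in> carrier Q" "x \<oplus>\<^bsub>Q\<^esub> y = y \<oplus>\<^bsub>Q\<^esub> x"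
      using im Kd add by (auto simp flip: add simp: M.a_comm)
  next
    fix x y z assume "x \<in> carrier Q" "y \<in> carrier Q" "z \<in> carrier Q"
    then obtain u v w where "x = f u" "y = f v" "z = f w" "u \<in> K" "v \<in> K" "w \<in> K" using im by blast
    then show "x \<oplus>\<^bsub>Q\<^esub> y \<oplus>\<^bsub>Q\<^esub> z = x \<oplus>\<^bsub>Q\<^esub> (y \<oplus>\<^bsub>Q\<^esub> z)"
      using Kd by (simp flip: add add: M.a_assoc)
  next
    show "\<zero>\<^bsub>Q\<^esub> \<in> carrier Q" using im Kd(2) by (simp flip: z im)
  next
    fix x assume "x \<in> carrier Q"
    then obtain u where u: "x = f u" "u \<in> K" using im by blast
    then show "\<zero>\<^bsub>Q\<^esub> \<oplus>\<^bsub>Q\<^esub> x = x" using Kd by (simp flip: add z)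
    have "f (\<ominus>\<^bsub>M\<^esub> u) \<oplus>\<^bsub>Q\<^esub> x = \<zero>\<^bsub>Q\<^esub>" using Kd u by (simp flip: add z add: M.l_neg)
    moreover have "f (\<ominus>\<^bsub>M\<^esub> u) \<in> carrier Q" using im Kd(6)[OF u(2)] by blast
    ultimately show "\<exists>y\<in>carrier Q. y \<oplus>\<^bsub>Q\<^esub> x = \<zero>\<^bsub>Q\<^esub>" by blast
  qed
  then interpret Q: abelian_group Q .
  show oQ: "op_group \<Omega> Q"
  proof unfold_locales
    fix x a assume "x \<in> carrier Q" "a \<in> \<Omega>"
    then obtain u where "x = f u" "u \<in> K" using im by blast
    then show "x \<triangleleft>\<^bsub>Q\<^esub> a \<in> carrier Q" using op[of u a] Kd(5)[of u a] \<open>a \<in> \<Omega>\<close> im by (metis imageI)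
  next
    fix x y a assume "x \<in> carrier Q" "y \<in> carrier Q" and a: "a \<in> \<Omega>"
    then obtain u v where "x = f u" "y = f v" "u \<in> K" "v \<in> K" using im by blast
    then show "(x \<oplus>\<^bsub>Q\<^esub> y) \<triangleleft>\<^bsub>Q\<^esub> a = (x \<triangleleft>\<^bsub>Q\<^esub> a) \<oplus>\<^bsub>Q\<^esub> (y \<triangleleft>\<^bsub>Q\<^esub> a)"
      using Kd a by (simp flip: op add add: M.op_add)
  qed
  show mn: "f (x \<ominus>\<^bsub>M\<^esub> y) = f x \<ominus>\<^bsub>Q\<^esub> f y" if "x \<in> K" "y \<in> K" for x y
  proof -
    have "f (x \<ominus>\<^bsub>M\<^esub> y) \<oplus>\<^bsub>Q\<^esub> f y = f x"
      using that Kd(1,4) by (simp flip: add add: a_minus_def M.a_assoc M.l_neg)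
    moreover have "f (x \<ominus>\<^bsub>M\<^esub> y) \<in> carrier Q" "f x \<in> carrier Q" "f y \<in> carrier Q"
      using that Kd(4)[OF that] by (auto simp flip: im)
    ultimately show ?thesis by (metis Q.add.inv_solve_right a_minus_def)
  qed
  show "op_rel \<Omega> M Q {(x, f x) | x. x \<in> K}"
  proof (rule op_relI)
    show "(\<zero>\<^bsub>M\<^esub>, \<zero>\<^bsub>Q\<^esub>) \<in> {(x, f x) | x. x \<in> K}" using z Kd(2) by force
  next
    fix x y x' y' assume "(x, y) \<in> {(x, f x) | x. x \<in> K}" "(x', y') \<in> {(x, f x) | x. x \<in> K}"
    then show "(x \<ominus>\<^bsub>M\<^esub> x', y \<ominus>\<^bsub>Q\<^esub> y') \<in> {(x, f x) | x. x \<in> K}" using mn Kd(4) by force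
  next
    fix x y a assume "(x, y) \<in> {(x, f x) | x. x \<in> K}" "a \<in> \<Omega>"
    then show "(x \<triangleleft>\<^bsub>M\<^esub> a, y \<triangleleft>\<^bsub>Q\<^esub> a) \<in> {(x, f x) | x. x \<in> K}" using op Kd(5) by force
  qed (use M oQ Kd(1) im in auto)
  show "single_val M Q {(x, f x) | x. x \<in> K}" using z by (auto simp: single_val_def)
  show "Domain {(x, f x) | x. x \<in> K} = K" by auto
  show "Range {(x, f x) | x. x \<in> K} = carrier Q" unfolding im[symmetric] by blast
qed

definition op_iso :: "'o set \<Rightarrow> ('o, 'm) rmodule \<Rightarrow> ('o, 'n) rmodule \<Rightarrow> bool" where
  "op_iso \<Omega> M N \<longleftrightarrow> (\<exists>G. op_rel \<Omega> M N G \<and> single_val M N G \<and> single_val N M (G\<inverse>) \<and>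
     Domain G = carrier M \<and> Range G = carrier N)"

lemma op_iso_sym: "op_iso \<Omega> M N \<Longrightarrow> op_iso \<Omega> N M"
  unfolding op_iso_def
  by (metis converse_converse op_rel_converse Domain_converse Range_converse)

lemma op_iso_common:
  assumes "op_iso \<Omega> M N" "carrier N \<noteq> {\<zero>\<^bsub>N\<^esub>}" shows "op_common \<Omega> M N"
proof -
  obtain G where G: "op_rel \<Omega> M N G" "single_val M N G" "single_val N M (G\<inverse>)" "Range G = carrier N"
    using assms(1) op_iso_def by metis
  have "nonzero_rel N G" using G(4) op_relD(5)[OF G(1)] assms(2) unfolding nonzero_rel_def by blast
  then show ?thesis using G op_common_def by blast
qed

lemma op_iso_nonzero:
  assumes "op_iso \<Omega> M N" "carrier M \<noteq> {\<zero>\<^bsub>M\<^esub>}" shows "carrier N \<noteq> {\<zero>\<^bsub>N\<^esub>}"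
proof
  assume N: "carrier N = {\<zero>\<^bsub>N\<^esub>}"
  obtain G where G: "op_rel \<Omega> M N G" "single_val N M (G\<inverse>)" "Domain G = carrier M" "Range G = carrier N"
    using assms(1) op_iso_def by metis
  have "x = \<zero>\<^bsub>M\<^esub>" if "x \<in> carrier M" for x
  proof -
    obtain y where y: "(x, y) \<in> G" using \<open>x \<in> carrier M\<close> G(3) by blast
    then have "y = \<zero>\<^bsub>N\<^esub>" using G(4) N by blast
    then show ?thesis using y G(2) by (auto simp: single_val_def)
  qed
  then show False using assms(2) op_relD(3,5)[OF G(1)] by blast
qed

lemma op_iso_monoform:
  assumes "op_iso \<Omega> M N" "op_monoform \<Omega> N" shows "op_monoform \<Omega> M"
proof -
  obtain G where G: "op_rel \<Omega> M N G" "single_val M N G" "single_val N M (G\<inverse>)" "Domain G = carrier M"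
    using assms(1) op_iso_def by metis
  have "carrier M \<noteq> {\<zero>\<^bsub>M\<^esub>}"
    using op_iso_nonzero[OF op_iso_sym[OF assms(1)]] assms(2) by (auto simp: op_monoform_def)
  then show ?thesis using op_monoform_pullback[OF assms(2) G(1-3)] G(4) by blast
qed

text \<open>If a partial endomorphism \<open>G\<close> has a nonzero kernel \<open>L\<close>, its
  image embeds both in \<open>H\<close> and, through the domain of \<open>G\<close>, in
  \<open>H/L\<close>. Conversely a common subobject of \<open>H\<close> and \<open>H/L\<close>,
  pulled back along the projection, is a nonzero partial endomorphism of \<open>H\<close> killing
  \<open>L\<close>. The projections \<open>P L\<close> stay abstract so that the equivalence applies
  to right modules and to dg modules alike.\<close>

lemma op_monoform_iff_quotients:
  assumes H: "op_group \<Omega> H"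
    and P: "\<And>L. op_sub \<Omega> L H \<Longrightarrow> op_rel \<Omega> H (Q L) (P L)"
      "\<And>L. op_sub \<Omega> L H \<Longrightarrow> single_val H (Q L) (P L)"
      "\<And>L. op_sub \<Omega> L H \<Longrightarrow> Domain (P L) = carrier H" "\<And>L. op_sub \<Omega> L H \<Longrightarrow> Range (P L) = carrier (Q L)"
      "\<And>L x. op_sub \<Omega> L H \<Longrightarrow> (x, \<zero>\<^bsub>Q L\<^esub>) \<in> P L \<longleftrightarrow> x \<in> L"
  shows "op_monoform \<Omega> H \<longleftrightarrow> carrier H \<noteq> {\<zero>\<^bsub>H\<^esub>} \<and>
    (\<forall>L. op_sub \<Omega> L H \<and> L \<noteq> {\<zero>\<^bsub>H\<^esub>} \<longrightarrow> \<not> op_common \<Omega> H (Q L))"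
proof (intro iffI conjI allI impI notI)
  fix L assume mono: "op_monoform \<Omega> H" and "op_sub \<Omega> L H \<and> L \<noteq> {\<zero>\<^bsub>H\<^esub>}" and "op_common \<Omega> H (Q L)"
  then have L: "op_sub \<Omega> L H" "L \<noteq> {\<zero>\<^bsub>H\<^esub>}" by auto
  obtain G where G: "op_rel \<Omega> H (Q L) G" "single_val H (Q L) G" "single_val (Q L) H (G\<inverse>)" "nonzero_rel (Q L) G"
    using \<open>op_common \<Omega> H (Q L)\<close> op_common_def by metis
  let ?F = "P L O G\<inverse>"
  have r: "op_rel \<Omega> H H ?F" using op_rel_comp[OF P(1)[OF L(1)] op_rel_converse[OF G(1)]] .
  have s: "single_val H H ?F" using single_val_comp[OF P(2)[OF L(1)] G(3)] .
  obtain x q where "(x, q) \<in> G" "q \<noteq> \<zero>\<^bsub>Q L\<^esub>" using G(4) nonzero_rel_def by metis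
  moreover from this have "x \<noteq> \<zero>\<^bsub>H\<^esub>" using G(2) by (auto simp: single_val_def)
  moreover have "q \<in> Range (P L)" using P(4)[OF L(1)] op_relD(4)[OF G(1)] \<open>(x, q) \<in> G\<close> by blast
  ultimately have "nonzero_rel H ?F" unfolding nonzero_rel_def by blast
  then have inj: "single_val H H (?F\<inverse>)" using mono r s unfolding op_monoform_def by simp
  obtain l where l: "l \<in> L" "l \<noteq> \<zero>\<^bsub>H\<^esub>" using L op_subD(2)[OF H L(1)] by blast
  then have "(l, \<zero>\<^bsub>H\<^esub>) \<in> ?F" using P(5)[OF L(1)] op_relD(5)[OF G(1)] by blast
  then show False using inj l by (auto simp: single_val_def)
next
  assume a: "carrier H \<noteq> {\<zero>\<^bsub>H\<^esub>} \<and> (\<forall>L. op_sub \<Omega> L H \<and> L \<noteq> {\<zero>\<^bsub>H\<^esub>} \<longrightarrow> \<not> op_common \<Omega> H (Q L))"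
  have "single_val H H (G\<inverse>)" if G: "op_rel \<Omega> H H G" "single_val H H G" "nonzero_rel H G" for G
  proof (rule ccontr)
    assume n: "\<not> single_val H H (G\<inverse>)"
    let ?L = "{x. (x, \<zero>\<^bsub>H\<^esub>) \<in> G}"
    have L: "op_sub \<Omega> ?L H" using op_sub_kernel[OF G(1)] .
    have "?L \<noteq> {\<zero>\<^bsub>H\<^esub>}" using n unfolding single_val_def by blast
    then have "\<not> op_common \<Omega> H (Q ?L)" using a L by blast
    moreover have "op_common \<Omega> H (Q ?L)" unfolding op_common_def
    proof (intro exI conjI)
      let ?F = "G\<inverse> O P ?L"
      show "op_rel \<Omega> H (Q ?L) ?F" using op_rel_comp[OF op_rel_converse[OF G(1)] P(1)[OF L]] .
      show "single_val H (Q ?L) ?F" unfolding single_val_def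
      proof (intro allI impI)
        fix q assume "(\<zero>\<^bsub>H\<^esub>, q) \<in> ?F"
        then obtain x where x: "(x, \<zero>\<^bsub>H\<^esub>) \<in> G" "(x, q) \<in> P ?L" by blast
        then have "(x, \<zero>\<^bsub>Q ?L\<^esub>) \<in> P ?L" using P(5)[OF L] by blast
        then show "q = \<zero>\<^bsub>Q ?L\<^esub>" using single_valD[OF P(1)[OF L] P(2)[OF L]] x by blast
      qed
      show "single_val (Q ?L) H (?F\<inverse>)" unfolding single_val_def
      proof (intro allI impI)
        fix y assume "(\<zero>\<^bsub>Q ?L\<^esub>, y) \<in> ?F\<inverse>"
        then obtain x where x: "(x, y) \<in> G" "(x, \<zero>\<^bsub>Q ?L\<^esub>) \<in> P ?L" by blast
        then have "(x, \<zero>\<^bsub>H\<^esub>) \<in> G" using P(5)[OF L] by blast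
        then show "y = \<zero>\<^bsub>H\<^esub>" using single_valD[OF G(1,2)] x by blast
      qed
      obtain x y where x: "(x, y) \<in> G" "y \<noteq> \<zero>\<^bsub>H\<^esub>" using G(3) nonzero_rel_def by metis
      then obtain q where q: "(x, q) \<in> P ?L" using P(3)[OF L] op_relD(3)[OF G(1)] by blast
      have "q \<noteq> \<zero>\<^bsub>Q ?L\<^esub>"
      proof
        assume "q = \<zero>\<^bsub>Q ?L\<^esub>"
        then have "(x, \<zero>\<^bsub>H\<^esub>) \<in> G" using q P(5)[OF L] by blast
        then show False using single_valD[OF G(1,2)] x by blast
      qed
      then show "nonzero_rel (Q ?L) ?F" using x q unfolding nonzero_rel_def by blast
    qed
    ultimately show False by blast
  qed
  then show "op_monoform \<Omega> H" using a H op_monoform_def by blast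
qed (auto simp: op_monoform_def)

text \<open>\<open>P\<close> and \<open>G\<close> have the same domain and the same kernel, so
  \<open>P\<inverse> O G\<close> embeds \<open>Q\<close> in \<open>H\<close>: up to isomorphism
  \<open>Q\<close> is the image of \<open>G\<close>.\<close>

lemma op_monoform_subquotient:
  assumes H: "op_monoform \<Omega> H" and G: "op_rel \<Omega> M H G" "single_val M H G" "nonzero_rel H G"
    and P: "op_rel \<Omega> M Q P" "single_val M Q P" "Domain P = Domain G" "Range P = carrier Q"
    and ker: "\<And>x. (x, \<zero>\<^bsub>Q\<^esub>) \<in> P \<longleftrightarrow> (x, \<zero>\<^bsub>H\<^esub>) \<in> G"
  shows "op_monoform \<Omega> Q" "op_common \<Omega> Q H"
proof -
  let ?F = "P\<inverse> O G"
  have r: "op_rel \<Omega> Q H ?F" using op_rel_comp[OF op_rel_converse[OF P(1)] G(1)] .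
  have s: "single_val Q H ?F" unfolding single_val_def
  proof (intro allI impI)
    fix y assume "(\<zero>\<^bsub>Q\<^esub>, y) \<in> ?F"
    then obtain x where "(x, \<zero>\<^bsub>H\<^esub>) \<in> G" "(x, y) \<in> G" using ker by blast
    then show "y = \<zero>\<^bsub>H\<^esub>" using single_valD[OF G(1,2)] by blast
  qed
  have s': "single_val H Q (?F\<inverse>)" unfolding single_val_def
  proof (intro allI impI)
    fix y assume "(\<zero>\<^bsub>H\<^esub>, y) \<in> ?F\<inverse>"
    then obtain x where "(x, \<zero>\<^bsub>Q\<^esub>) \<in> P" "(x, y) \<in> P" using ker by blast
    then show "y = \<zero>\<^bsub>Q\<^esub>" using single_valD[OF P(1,2)] by blast
  qed
  obtain x y where "(x, y) \<in> G" "y \<noteq> \<zero>\<^bsub>H\<^esub>" using G(3) nonzero_rel_def by metis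
  moreover from this obtain q where "(x, q) \<in> P" using P(3) by blast
  ultimately have qy: "(q, y) \<in> ?F" "y \<noteq> \<zero>\<^bsub>H\<^esub>" by blast+
  then have "nonzero_rel H ?F" unfolding nonzero_rel_def by blast
  then show "op_common \<Omega> Q H" using r s s' op_common_def by blast
  have "q \<noteq> \<zero>\<^bsub>Q\<^esub>" using s qy unfolding single_val_def by blast
  then have "carrier Q \<noteq> {\<zero>\<^bsub>Q\<^esub>}" using op_relD(3)[OF r qy(1)] by blast
  moreover have "Domain ?F = carrier Q" using P(3,4) by blast
  ultimately show "op_monoform \<Omega> Q" using op_monoform_pullback[OF H r s s'] by blast
qed

section \<open>From relations back to maps, cosets and subobjects\<close>

lemma additive_on_sub:
  assumes M: "op_group \<Omega> M" and N: "op_group \<Omega> N" and K: "op_sub \<Omega> K M" and f: "f \<in> K \<rightarrow> carrier N"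
    and add: "\<And>x y. \<lbrakk>x \<in> K; y \<in> K\<rbrakk> \<Longrightarrow> f (x \<oplus>\<^bsub>M\<^esub> y) = f x \<oplus>\<^bsub>N\<^esub> f y"
  shows "f \<zero>\<^bsub>M\<^esub> = \<zero>\<^bsub>N\<^esub>" "\<lbrakk>x \<in> K; y \<in> K\<rbrakk> \<Longrightarrow> f (x \<ominus>\<^bsub>M\<^esub> y) = f x \<ominus>\<^bsub>N\<^esub> f y"
proof -
  interpret M: op_group \<Omega> M by fact
  interpret N: op_group \<Omega> N by fact
  note Kd = op_subD[OF M K]
  have fc: "f x \<in> carrier N" if "x \<in> K" for x using f that by auto
  have "f \<zero>\<^bsub>M\<^esub> \<oplus>\<^bsub>N\<^esub> f \<zero>\<^bsub>M\<^esub> = f \<zero>\<^bsub>M\<^esub>" using add[of "\<zero>\<^bsub>M\<^esub>" "\<zero>\<^bsub>M\<^esub>"] Kd by simp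
  then show "f \<zero>\<^bsub>M\<^esub> = \<zero>\<^bsub>N\<^esub>" using fc[OF Kd(2)] N.add.l_cancel_one by blast
  assume x: "x \<in> K" "y \<in> K"
  have "f (x \<ominus>\<^bsub>M\<^esub> y) \<oplus>\<^bsub>N\<^esub> f y = f x"
    using x Kd(1,4) by (simp flip: add add: a_minus_def M.a_assoc M.l_neg)
  then show "f (x \<ominus>\<^bsub>M\<^esub> y) = f x \<ominus>\<^bsub>N\<^esub> f y"
    using fc Kd x by (metis N.add.inv_solve_right a_minus_def)
qed

text \<open>Passage between the graph of an isomorphism of subobjects and the isomorphism itself;
  the latter is the form in which common subobjects of modules are defined.\<close>

lemma op_common_iff:
  assumes M: "op_group \<Omega> M" and N: "op_group \<Omega> N"
  shows "op_common \<Omega> M N \<longleftrightarrow> (\<exists>K L f. op_sub \<Omega> K M \<and> K \<noteq> {\<zero>\<^bsub>M\<^esub>} \<and> op_sub \<Omega> L N \<and> L \<noteq> {\<zero>\<^bsub>N\<^esub>} \<and>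
    bij_betw f K L \<and> (\<forall>x\<in>K. \<forall>y\<in>K. f (x \<oplus>\<^bsub>M\<^esub> y) = f x \<oplus>\<^bsub>N\<^esub> f y) \<and>
    (\<forall>x\<in>K. \<forall>a\<in>\<Omega>. f (x \<triangleleft>\<^bsub>M\<^esub> a) = f x \<triangleleft>\<^bsub>N\<^esub> a))" (is "_ \<longleftrightarrow> ?R")
proof
  interpret M: op_group \<Omega> M by fact
  interpret N: op_group \<Omega> N by fact
  assume "op_common \<Omega> M N"
  then obtain G where G: "op_rel \<Omega> M N G" "single_val M N G" "single_val N M (G\<inverse>)" "nonzero_rel N G"
    using op_common_def by metis
  define f where "f x = (THE y. (x, y) \<in> G)" for x
  have f: "(x, f x) \<in> G" if "x \<in> Domain G" for x
    unfolding f_def using that single_valD[OF G(1,2)] by (auto intro: theI)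
  have fe: "f x = y" if "(x, y) \<in> G" for x y using single_valD[OF G(1,2)] f that by blast
  have inj: "x = x'" if "(x, y) \<in> G" "(x', y) \<in> G" for x x' y
    using single_valD[OF op_rel_converse[OF G(1)] G(3)] that by blast
  show ?R
  proof (intro exI conjI ballI)
    show "op_sub \<Omega> (Domain G) M" using op_sub_Domain[OF G(1)] .
    show "op_sub \<Omega> (Domain (G\<inverse>)) N" using op_sub_Domain[OF op_rel_converse[OF G(1)]] .
    show "bij_betw f (Domain G) (Domain (G\<inverse>))" unfolding bij_betw_def inj_on_def
      using f fe inj by (auto simp: image_iff)
    show "Domain (G\<inverse>) \<noteq> {\<zero>\<^bsub>N\<^esub>}" using G(4) unfolding nonzero_rel_def by blast
    obtain u v where uv: "(u, v) \<in> G" "v \<noteq> \<zero>\<^bsub>N\<^esub>" using G(4) nonzero_rel_def by metis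
    then have "u \<noteq> \<zero>\<^bsub>M\<^esub>" using G(2) by (auto simp: single_val_def)
    then show "Domain G \<noteq> {\<zero>\<^bsub>M\<^esub>}" using uv(1) by blast
    show "f (x \<oplus>\<^bsub>M\<^esub> y) = f x \<oplus>\<^bsub>N\<^esub> f y" if "x \<in> Domain G" "y \<in> Domain G" for x y
      using fe op_relD(7)[OF G(1)] f that by blast
    show "f (x \<triangleleft>\<^bsub>M\<^esub> a) = f x \<triangleleft>\<^bsub>N\<^esub> a" if "x \<in> Domain G" "a \<in> \<Omega>" for x a
      using fe op_relD(9)[OF G(1)] f that by blast
  qed
next
  assume ?R
  then obtain K L f where K: "op_sub \<Omega> K M" "K \<noteq> {\<zero>\<^bsub>M\<^esub>}" and L: "op_sub \<Omega> L N" "L \<noteq> {\<zero>\<^bsub>N\<^esub>}"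
    and f: "bij_betw f K L" "\<And>x y. \<lbrakk>x \<in> K; y \<in> K\<rbrakk> \<Longrightarrow> f (x \<oplus>\<^bsub>M\<^esub> y) = f x \<oplus>\<^bsub>N\<^esub> f y"
      "\<And>x a. \<lbrakk>x \<in> K; a \<in> \<Omega>\<rbrakk> \<Longrightarrow> f (x \<triangleleft>\<^bsub>M\<^esub> a) = f x \<triangleleft>\<^bsub>N\<^esub> a" by blast
  note Kd = op_subD[OF M K(1)] and Ld = op_subD[OF N L(1)]
  have fK: "f x \<in> L" if "x \<in> K" for x using bij_betwE[OF f(1)] that by simp
  then have "f \<in> K \<rightarrow> carrier N" using Ld(1) by simp
  note f0 = additive_on_sub[OF M N K(1) this, of, OF f(2)]
  let ?G = "{(x, f x) | x. x \<in> K}"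
  have "op_rel \<Omega> M N ?G"
  proof (rule op_relI)
    have "(\<zero>\<^bsub>M\<^esub>, f \<zero>\<^bsub>M\<^esub>) \<in> ?G" using Kd(2) by blast
    then show "(\<zero>\<^bsub>M\<^esub>, \<zero>\<^bsub>N\<^esub>) \<in> ?G" using f0(1) by simp
    show "x \<in> carrier M \<and> y \<in> carrier N" if "(x, y) \<in> ?G" for x y
      using that Kd(1) fK Ld(1) by blast
    show "(x \<ominus>\<^bsub>M\<^esub> x', y \<ominus>\<^bsub>N\<^esub> y') \<in> ?G" if "(x, y) \<in> ?G" "(x', y') \<in> ?G" for x y x' y'
      using that f0(2) Kd(4) by fastforce
    show "(x \<triangleleft>\<^bsub>M\<^esub> a, y \<triangleleft>\<^bsub>N\<^esub> a) \<in> ?G" if "(x, y) \<in> ?G" "a \<in> \<Omega>" for x y a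
      using that f(3) Kd(5) by force
  qed fact+
  moreover have "single_val M N ?G" using f0(1) by (auto simp: single_val_def)
  moreover have "single_val N M (?G\<inverse>)"
    using f0(1) Kd(2) f(1) unfolding single_val_def bij_betw_def inj_on_def by auto
  moreover obtain y where "y \<in> L" "y \<noteq> \<zero>\<^bsub>N\<^esub>" using L Ld(2) by blast
  then have "nonzero_rel N ?G" using f(1) unfolding nonzero_rel_def bij_betw_def by blast
  ultimately show "op_common \<Omega> M N" using op_common_def by blast
qed

text \<open>Operations on a quotient are defined as unions over a coset. Since \<open>L\<close> is
  stable under the operators, all members of such a union coincide, and the union is a single
  coset.\<close>

lemma op_coset:
  assumes M: "op_group \<Omega> M" and L: "op_sub \<Omega> L M"
  shows "(\<lambda>x. L +>\<^bsub>M\<^esub> x) ` carrier M = a_rcosets\<^bsub>M\<^esub> L"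
    "L +>\<^bsub>M\<^esub> \<zero>\<^bsub>M\<^esub> = L"
    "\<lbrakk>x \<in> carrier M; y \<in> carrier M\<rbrakk> \<Longrightarrow> L +>\<^bsub>M\<^esub> (x \<oplus>\<^bsub>M\<^esub> y) = (L +>\<^bsub>M\<^esub> x) <+>\<^bsub>M\<^esub> (L +>\<^bsub>M\<^esub> y)"
    "\<lbrakk>x \<in> carrier M; a \<in> \<Omega>\<rbrakk> \<Longrightarrow> (\<Union>y\<in>L +>\<^bsub>M\<^esub> x. L +>\<^bsub>M\<^esub> (y \<triangleleft>\<^bsub>M\<^esub> a)) = L +>\<^bsub>M\<^esub> (x \<triangleleft>\<^bsub>M\<^esub> a)"
    "x \<in> carrier M \<Longrightarrow> L +>\<^bsub>M\<^esub> x = L \<longleftrightarrow> x \<in> L"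
    "x \<in> carrier M \<Longrightarrow> x \<in> L +>\<^bsub>M\<^esub> x"
proof -
  interpret op_group \<Omega> M by fact
  note Ld = op_subD[OF M L]
  interpret L: additive_subgroup L M using L op_sub_def by blast
  interpret L: abelian_subgroup L M
    by (rule abelian_subgroupI3) (unfold_locales)
  show "(\<lambda>x. L +>\<^bsub>M\<^esub> x) ` carrier M = a_rcosets\<^bsub>M\<^esub> L" unfolding A_RCOSETS_def' by auto
  show "L +>\<^bsub>M\<^esub> \<zero>\<^bsub>M\<^esub> = L" using Ld(1) by (simp add: subsetI)
  show "\<lbrakk>x \<in> carrier M; y \<in> carrier M\<rbrakk> \<Longrightarrow> L +>\<^bsub>M\<^esub> (x \<oplus>\<^bsub>M\<^esub> y) = (L +>\<^bsub>M\<^esub> x) <+>\<^bsub>M\<^esub> (L +>\<^bsub>M\<^esub> y)"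
    using L.a_rcos_sum by simp
  show s: "x \<in> L +>\<^bsub>M\<^esub> x" if "x \<in> carrier M" for x using L.a_rcos_self that .
  show "x \<in> carrier M \<Longrightarrow> L +>\<^bsub>M\<^esub> x = L \<longleftrightarrow> x \<in> L"
    using a_coset_join1 a_coset_join2 L.a_subgroup by blast
  assume x: "x \<in> carrier M" "a \<in> \<Omega>"
  have "L +>\<^bsub>M\<^esub> (y \<triangleleft>\<^bsub>M\<^esub> a) = L +>\<^bsub>M\<^esub> (x \<triangleleft>\<^bsub>M\<^esub> a)" if y: "y \<in> L +>\<^bsub>M\<^esub> x" for y
  proof -
    obtain l where l: "l \<in> L" "y = l \<oplus>\<^bsub>M\<^esub> x" using y unfolding a_r_coset_def' by blast
    then have "y \<triangleleft>\<^bsub>M\<^esub> a = (l \<triangleleft>\<^bsub>M\<^esub> a) \<oplus>\<^bsub>M\<^esub> (x \<triangleleft>\<^bsub>M\<^esub> a)" using op_add Ld(1) x by simp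
    then have "y \<triangleleft>\<^bsub>M\<^esub> a \<in> L +>\<^bsub>M\<^esub> (x \<triangleleft>\<^bsub>M\<^esub> a)" using Ld(5) l x unfolding a_r_coset_def' by blast
    then show ?thesis using L.a_repr_independence' op_closed x by blast
  qed
  then show "(\<Union>y\<in>L +>\<^bsub>M\<^esub> x. L +>\<^bsub>M\<^esub> (y \<triangleleft>\<^bsub>M\<^esub> a)) = L +>\<^bsub>M\<^esub> (x \<triangleleft>\<^bsub>M\<^esub> a)" using s[OF x(1)] by blast
qed

text \<open>Cosets live in a set type. A chosen element determines its coset, so choosing
  representatives brings a quotient back to the type of \<open>M\<close>, hence into the universe
  when \<open>M\<close> lies there.\<close>

lemma inj_on_some_rcosets:
  assumes M: "op_group \<Omega> M" and L: "op_sub \<Omega> L M"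
  shows "inj_on (\<lambda>X. SOME x. x \<in> X) (a_rcosets\<^bsub>M\<^esub> L)"
proof (rule inj_onI)
  interpret op_group \<Omega> M by fact
  have sl: "subgroup L (add_monoid M)"
    using L unfolding op_sub_def additive_subgroup_def by blast
  have rep: "X = L +>\<^bsub>M\<^esub> (SOME x. x \<in> X)" if X: "X \<in> a_rcosets\<^bsub>M\<^esub> L" for X
  proof -
    obtain x where x: "x \<in> carrier M" "X = L +>\<^bsub>M\<^esub> x" using X unfolding A_RCOSETS_def' by blast
    then have "x \<in> X" using op_coset(6)[OF M L] by simp
    then have "(SOME x. x \<in> X) \<in> X" by (rule someI)
    then show ?thesis using a_repr_independence[OF _ _ sl] x by metis
  qed
  show "X = Y" if "X \<in> a_rcosets\<^bsub>M\<^esub> L" "Y \<in> a_rcosets\<^bsub>M\<^esub> L" "(SOME x. x \<in> X) = (SOME x. x \<in> Y)" for X Y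
    using rep[OF that(1)] rep[OF that(2)] that(3) by metis
qed

text \<open>That \<open>Id_on K\<close> is a relation from \<open>M\<close> to \<open>N\<close>
  expresses that \<open>N\<close> carries the restricted operations, so stability may be tested in
  either group.\<close>

lemma op_sub_in_sub:
  assumes rel: "op_rel \<Omega> M N (Id_on K)" and c: "carrier N = K"
  shows "op_sub \<Omega> L N \<longleftrightarrow> op_sub \<Omega> L M \<and> L \<subseteq> K"
proof -
  note M = op_relD(1)[OF rel] and N = op_relD(2)[OF rel]
  have mn: "x \<ominus>\<^bsub>N\<^esub> y = x \<ominus>\<^bsub>M\<^esub> y" if "x \<in> K" "y \<in> K" for x y
    using op_relD(6)[OF rel, of x x y y] that by auto
  have op: "x \<triangleleft>\<^bsub>N\<^esub> a = x \<triangleleft>\<^bsub>M\<^esub> a" if "x \<in> K" "a \<in> \<Omega>" for x a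
    using op_relD(9)[OF rel, of x x a] that by auto
  show ?thesis
  proof (intro iffI conjI)
    assume L: "op_sub \<Omega> L N"
    note Ld = op_subD[OF N L]
    show LK: "L \<subseteq> K" using Ld(1) c by auto
    show "op_sub \<Omega> L M"
    proof (rule op_subI[OF M])
      show "x \<ominus>\<^bsub>M\<^esub> y \<in> L" if "x \<in> L" "y \<in> L" for x y
        using Ld(4)[OF that] mn[of x y] that LK by (metis subsetD)
      show "x \<triangleleft>\<^bsub>M\<^esub> a \<in> L" if "x \<in> L" "a \<in> \<Omega>" for x a
        using Ld(5)[OF that] op[of x a] that LK by (metis subsetD)
      show "L \<subseteq> carrier M" using LK op_relD(3)[OF rel] by blast
      show "L \<noteq> {}" using Ld(2) by blast
    qed
  next
    assume "op_sub \<Omega> L M \<and> L \<subseteq> K"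
    then have L: "op_sub \<Omega> L M" "L \<subseteq> K" by auto
    note Ld = op_subD[OF M L(1)]
    show "op_sub \<Omega> L N"
    proof (rule op_subI[OF N])
      show "x \<ominus>\<^bsub>N\<^esub> y \<in> L" if "x \<in> L" "y \<in> L" for x y
        using Ld(4)[OF that] mn[of x y] that L(2) by (metis subsetD)
      show "x \<triangleleft>\<^bsub>N\<^esub> a \<in> L" if "x \<in> L" "a \<in> \<Omega>" for x a
        using Ld(5)[OF that] op[of x a] that L(2) by (metis subsetD)
      show "L \<subseteq> carrier N" using L(2) c by simp
      show "L \<noteq> {}" using Ld(2) by blast
    qed
  qed
qed

lemma op_common_refl: "op_monoform \<Omega> H \<Longrightarrow> op_common \<Omega> H H"
  unfolding op_common_def
proof (intro exI conjI)
  assume H: "op_monoform \<Omega> H"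
  then show r: "op_rel \<Omega> H H (Id_on (carrier H))" using op_rel_Id op_monoform_def by blast
  obtain x where "x \<in> carrier H" "x \<noteq> \<zero>\<^bsub>H\<^esub>" using H op_relD(3,5)[OF r] unfolding op_monoform_def by blast
  then show "nonzero_rel H (Id_on (carrier H))" unfolding nonzero_rel_def by blast
qed (auto simp: single_val_def)

lemma op_monoform_Range:
  assumes H: "op_monoform \<Omega> H" and r: "op_group \<Omega> H" "Range G = carrier H"
  shows "nonzero_rel H G"
proof -
  interpret op_group \<Omega> H by fact
  have "carrier H \<noteq> {\<zero>\<^bsub>H\<^esub>}" using H unfolding op_monoform_def by simp
  then obtain y where "y \<in> carrier H" "y \<noteq> \<zero>\<^bsub>H\<^esub>" using zero_closed by blast
  then show ?thesis using r unfolding nonzero_rel_def by blast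
qed

section \<open>Right modules\<close>

lemma right_module_op_group:
  fixes M :: "('a, 'm) rmodule"
  shows "right_module R M \<Longrightarrow> op_group (carrier R) M"
  by (simp add: right_module_def op_group_def op_group_axioms_def right_module_axioms_def)

lemma rsubmodule_iff_op_sub: "rsubmodule R N M \<longleftrightarrow> op_sub (carrier R) N M"
  unfolding rsubmodule_def op_sub_def ..

lemma right_module_image:
  fixes Q :: "('a, 'n) rmodule" and M :: "('a, 'm) rmodule"
  assumes M: "right_module R M" and K: "op_sub (carrier R) K M" and im: "f ` K = carrier Q"
    and z: "f \<zero>\<^bsub>M\<^esub> = \<zero>\<^bsub>Q\<^esub>"
    and add: "\<And>x y. \<lbrakk>x \<in> K; y \<in> K\<rbrakk> \<Longrightarrow> f (x \<oplus>\<^bsub>M\<^esub> y) = f x \<oplus>\<^bsub>Q\<^esub> f y"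
    and op: "\<And>x a. \<lbrakk>x \<in> K; a \<in> carrier R\<rbrakk> \<Longrightarrow> f (x \<triangleleft>\<^bsub>M\<^esub> a) = f x \<triangleleft>\<^bsub>Q\<^esub> a"
  shows "right_module R Q"
proof -
  interpret M: right_module R M by fact
  note oM = right_module_op_group[OF M]
  note Kd = op_subD[OF oM K]
  interpret Q: op_group "carrier R" Q using op_group_image(1)[OF oM K im z add op] .
  show ?thesis
  proof unfold_locales
    fix x a b assume "x \<in> carrier Q" and ab: "a \<in> carrier R" "b \<in> carrier R"
    then obtain u where u: "x = f u" "u \<in> K" using im by blast
    show "x \<triangleleft>\<^bsub>Q\<^esub> (a \<otimes>\<^bsub>R\<^esub> b) = (x \<triangleleft>\<^bsub>Q\<^esub> a) \<triangleleft>\<^bsub>Q\<^esub> b"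
      using u ab Kd(1,5) M.ract_assoc by (simp flip: op)
    show "x \<triangleleft>\<^bsub>Q\<^esub> (a \<oplus>\<^bsub>R\<^esub> b) = (x \<triangleleft>\<^bsub>Q\<^esub> a) \<oplus>\<^bsub>Q\<^esub> (x \<triangleleft>\<^bsub>Q\<^esub> b)"
      using u ab Kd(1,5) M.ract_add_right by (simp flip: op add)
  next
    fix x assume "x \<in> carrier Q"
    then obtain u where u: "x = f u" "u \<in> K" using im by blast
    then show "x \<triangleleft>\<^bsub>Q\<^esub> \<one>\<^bsub>R\<^esub> = x" using Kd(1) M.ract_one by (simp flip: op)
  qed (use Q.op_closed Q.op_add in auto)
qed

lemma rmod_sub_props:
  fixes M :: "('a, 'm) rmodule"
  assumes M: "right_module R M" and K: "op_sub (carrier R) K M"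
  shows "right_module R (rmod_sub M K)" "op_rel (carrier R) M (rmod_sub M K) (Id_on K)"
    "op_sub (carrier R) L (rmod_sub M K) \<longleftrightarrow> op_sub (carrier R) L M \<and> L \<subseteq> K"
proof -
  note oM = right_module_op_group[OF M]
  note Kd = op_subD[OF oM K]
  show r: "right_module R (rmod_sub M K)"
    by (rule right_module_image[OF M K, of id]) (auto simp: rmod_sub_def)
  have "{(x, id x) | x. x \<in> K} = Id_on K" by auto
  moreover have "op_rel (carrier R) M (rmod_sub M K) {(x, id x) | x. x \<in> K}"
    by (rule op_group_image(2)[OF oM K]) (auto simp: rmod_sub_def)
  ultimately show rel: "op_rel (carrier R) M (rmod_sub M K) (Id_on K)" by simp
  show "op_sub (carrier R) L (rmod_sub M K) \<longleftrightarrow> op_sub (carrier R) L M \<and> L \<subseteq> K"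
    by (rule op_sub_in_sub[OF rel]) (simp add: rmod_sub_def)
qed

lemma rmod_quot_props:
  fixes M :: "('a, 'm) rmodule"
  assumes M: "right_module R M" and L: "op_sub (carrier R) L M"
  defines "P \<equiv> {(x, L +>\<^bsub>M\<^esub> x) | x. x \<in> carrier M}"
  shows "right_module R (rmod_quot M L)" "op_rel (carrier R) M (rmod_quot M L) P"
    "single_val M (rmod_quot M L) P" "Domain P = carrier M" "Range P = carrier (rmod_quot M L)"
    "(x, \<zero>\<^bsub>rmod_quot M L\<^esub>) \<in> P \<longleftrightarrow> x \<in> L"
proof -
  note oM = right_module_op_group[OF M]
  interpret op_group "carrier R" M by fact
  note c = op_coset[OF oM L]
  note im = oM op_sub_carrier[OF oM]
  have a: "(\<lambda>x. L +>\<^bsub>M\<^esub> x) ` carrier M = carrier (rmod_quot M L)"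
    "L +>\<^bsub>M\<^esub> \<zero>\<^bsub>M\<^esub> = \<zero>\<^bsub>rmod_quot M L\<^esub>"
    "\<And>x y. \<lbrakk>x \<in> carrier M; y \<in> carrier M\<rbrakk> \<Longrightarrow>
      L +>\<^bsub>M\<^esub> (x \<oplus>\<^bsub>M\<^esub> y) = (L +>\<^bsub>M\<^esub> x) \<oplus>\<^bsub>rmod_quot M L\<^esub> (L +>\<^bsub>M\<^esub> y)"
    "\<And>x a. \<lbrakk>x \<in> carrier M; a \<in> carrier R\<rbrakk> \<Longrightarrow>
      L +>\<^bsub>M\<^esub> (x \<triangleleft>\<^bsub>M\<^esub> a) = (L +>\<^bsub>M\<^esub> x) \<triangleleft>\<^bsub>rmod_quot M L\<^esub> a"
    using c by (simp_all add: rmod_quot_def quot_ract_def)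
  show "right_module R (rmod_quot M L)" by (rule right_module_image[OF M im(2) a])
  show "op_rel (carrier R) M (rmod_quot M L) P" unfolding P_def by (rule op_group_image(2)[OF im a])
  show "single_val M (rmod_quot M L) P" unfolding P_def by (rule op_group_image(3)[OF im a])
  show "Domain P = carrier M" unfolding P_def by blast
  show "Range P = carrier (rmod_quot M L)" unfolding P_def by (rule op_group_image(5)[OF im a])
  have "x \<in> L \<Longrightarrow> x \<in> carrier M" using op_subD(1)[OF oM L] .
  then show "(x, \<zero>\<^bsub>rmod_quot M L\<^esub>) \<in> P \<longleftrightarrow> x \<in> L" using c(5)[of x] by (auto simp: P_def rmod_quot_def)
qed

section \<open>Atoms and supports of right modules\<close>

lemma rmod_common_sub_iff:
  assumes M: "right_module R M" and N: "right_module R N"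
  shows "rmod_common_sub R M N \<longleftrightarrow> op_common (carrier R) M N"
proof -
  have sub: "rmod_isomorphic R (rmod_sub M K) (rmod_sub N L) \<longleftrightarrow> (\<exists>f. bij_betw f K L \<and>
      (\<forall>x\<in>K. \<forall>y\<in>K. f (x \<oplus>\<^bsub>M\<^esub> y) = f x \<oplus>\<^bsub>N\<^esub> f y) \<and> (\<forall>x\<in>K. \<forall>a\<in>carrier R. f (x \<triangleleft>\<^bsub>M\<^esub> a) = f x \<triangleleft>\<^bsub>N\<^esub> a))"
    for K L unfolding rmod_isomorphic_def rmod_hom_def hom_def rmod_sub_def
    by (auto simp: Pi_iff dest: bij_betwE)
  show ?thesis
    unfolding op_common_iff[OF right_module_op_group[OF M] right_module_op_group[OF N]]
      rmod_common_sub_def rsubmodule_iff_op_sub sub by blast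
qed

lemma rmod_monoform_iff: "rmod_monoform R H \<longleftrightarrow> right_module R H \<and> op_monoform (carrier R) H"
proof (cases "right_module R H")
  case True
  note q = rmod_quot_props[OF True]
  have "op_monoform (carrier R) H \<longleftrightarrow> carrier H \<noteq> {\<zero>\<^bsub>H\<^esub>} \<and>
    (\<forall>L. op_sub (carrier R) L H \<and> L \<noteq> {\<zero>\<^bsub>H\<^esub>} \<longrightarrow> \<not> op_common (carrier R) H (rmod_quot H L))"
    by (rule op_monoform_iff_quotients[OF right_module_op_group[OF True] q(2-6)])
  then show ?thesis
    unfolding rmod_monoform_def rsubmodule_iff_op_sub using rmod_common_sub_iff[OF True q(1)] True
    by auto
qed (simp add: rmod_monoform_def)

lemma rmod_monoformD:
  "rmod_monoform R H \<Longrightarrow> right_module R H" "rmod_monoform R H \<Longrightarrow> op_monoform (carrier R) H"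
  unfolding rmod_monoform_iff by simp_all

lemma rmod_atom_iff:
  "right_module R H \<Longrightarrow> X \<in> rmod_atom R H \<longleftrightarrow> rmod_monoform R X \<and> op_common (carrier R) X H"
  unfolding rmod_atom_def using rmod_common_sub_iff rmod_monoform_iff by blast

lemma rmod_atom_eqI:
  assumes "rmod_monoform R H" "rmod_monoform R H'" "op_common (carrier R) H H'"
  shows "rmod_atom R H = rmod_atom R H'"
proof (rule Set.set_eqI)
  have m: "op_monoform (carrier R) H" "op_monoform (carrier R) H'" "right_module R H" "right_module R H'"
    using assms unfolding rmod_monoform_iff by auto
  show "X \<in> rmod_atom R H \<longleftrightarrow> X \<in> rmod_atom R H'" for X
    unfolding rmod_atom_iff[OF m(3)] rmod_atom_iff[OF m(4)]
    using op_common_trans[OF _ assms(3) m(1)] op_common_trans[OF _ op_common_sym[OF assms(3)] m(2)]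
    by metis
qed

text \<open>Transport of structure along \<open>e\<close>. It is needed because an atom contains
  only modules over the universe type, while quotients are formed over a type of sets.\<close>

lemma rmod_copy:
  fixes M :: "('a, 'm) rmodule" and e :: "'m \<Rightarrow> 'u"
  assumes M: "right_module R M" and e: "inj_on e (carrier M)"
  shows "\<exists>N :: ('a, 'u) rmodule. right_module R N \<and> op_iso (carrier R) M N"
proof -
  note oM = right_module_op_group[OF M]
  interpret op_group "carrier R" M by fact
  let ?i = "inv_into (carrier M) e"
  define N :: "('a, 'u) rmodule" where
    "N = \<lparr>carrier = e ` carrier M, mult = undefined, one = undefined, zero = e \<zero>\<^bsub>M\<^esub>,
      add = (\<lambda>x y. e (?i x \<oplus>\<^bsub>M\<^esub> ?i y)), ract = (\<lambda>x a. e (?i x \<triangleleft>\<^bsub>M\<^esub> a))\<rparr>"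
  have a: "e ` carrier M = carrier N" "e \<zero>\<^bsub>M\<^esub> = \<zero>\<^bsub>N\<^esub>"
    "\<And>x y. \<lbrakk>x \<in> carrier M; y \<in> carrier M\<rbrakk> \<Longrightarrow> e (x \<oplus>\<^bsub>M\<^esub> y) = e x \<oplus>\<^bsub>N\<^esub> e y"
    "\<And>x a. \<lbrakk>x \<in> carrier M; a \<in> carrier R\<rbrakk> \<Longrightarrow> e (x \<triangleleft>\<^bsub>M\<^esub> a) = e x \<triangleleft>\<^bsub>N\<^esub> a"
    using e by (simp_all add: N_def)
  have "right_module R N" by (rule right_module_image[OF M op_sub_carrier[OF oM] a])
  moreover have "op_iso (carrier R) M N" unfolding op_iso_def
  proof (intro exI conjI)
    let ?G = "{(x, e x) | x. x \<in> carrier M}"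
    note im = op_group_image[OF oM op_sub_carrier[OF oM] a]
    show "op_rel (carrier R) M N ?G" "single_val M N ?G" "Domain ?G = carrier M" "Range ?G = carrier N"
      using im(2-5) by auto
    show "single_val N M (?G\<inverse>)" using e a(2) by (auto simp: single_val_def inj_on_def)
  qed
  ultimately show ?thesis by blast
qed

text \<open>A monoform subquotient of \<open>M\<close>, given up to isomorphism by a relation with source \<open>M\<close>; a nonzero
  target suffices since subobjects of monoform objects represent the same atom.\<close>
lemma rmod_SuppI:
  fixes M :: "('a, 'u) rmodule" and H :: "('a, 'm) rmodule"
  assumes M: "right_module R M" and H: "rmod_monoform R H"
    and G: "op_rel (carrier R) M H G" "single_val M H G" "nonzero_rel H G"
  shows "rmod_atom R H \<in> rmod_Supp R M"
proof -
  let ?K = "Domain G" and ?L = "{x. (x, \<zero>\<^bsub>H\<^esub>) \<in> G}"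
  have K: "op_sub (carrier R) ?K M" and L: "op_sub (carrier R) ?L M"
    using op_sub_Domain op_sub_kernel G(1) by blast+
  have LK: "?L \<subseteq> ?K" by auto
  note s = rmod_sub_props[OF M K]
  have L': "op_sub (carrier R) ?L (rmod_sub M ?K)" using s(3) L LK by blast
  note q = rmod_quot_props[OF s(1) L']
  let ?Q = "rmod_quot (rmod_sub M ?K) ?L"
  define P where "P = {(x, ?L +>\<^bsub>rmod_sub M ?K\<^esub> x) | x. x \<in> carrier (rmod_sub M ?K)}"
  note q = q[folded P_def]
  have Hm: "op_monoform (carrier R) H" using H unfolding rmod_monoform_iff by simp
  have c: "carrier (rmod_sub M ?K) = ?K" by (simp add: rmod_sub_def)
  have "Id_on ?K O P = P" unfolding P_def c by auto
  then have P: "op_rel (carrier R) M ?Q P" using op_rel_comp[OF s(2) q(2)] by simp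
  have sv: "single_val M ?Q P" using q(3) by (simp add: single_val_def rmod_sub_def)
  have D: "Domain P = Domain G" "Range P = carrier ?Q" using q(4,5) unfolding c by auto
  have k: "(x, \<zero>\<^bsub>?Q\<^esub>) \<in> P \<longleftrightarrow> (x, \<zero>\<^bsub>H\<^esub>) \<in> G" for x using q(6)[of x] by simp
  note m = op_monoform_subquotient[OF Hm G P sv D k]
  have "rmod_monoform R ?Q" using m(1) q(1) unfolding rmod_monoform_iff by simp
  moreover from this have "rmod_atom R ?Q = rmod_atom R H" using rmod_atom_eqI H m(2) by blast
  ultimately show ?thesis unfolding rmod_Supp_def rsubmodule_iff_op_sub using K L LK by blast
qed

text \<open>Coset representatives give a copy \<open>Q\<close> of the subquotient in the universe.
  That \<open>G\<close> is onto matters later: a nonzero partial morphism out of \<open>Q\<close>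
  stays nonzero after composition with \<open>G\<close>.\<close>

lemma rmod_SuppE:
  fixes M :: "('a, 'u) rmodule" and \<alpha> :: "('a, 'u) rmodule set"
  assumes M: "right_module R M" and \<alpha>: "\<alpha> \<in> rmod_Supp R M"
  obtains Q :: "('a, 'u) rmodule" and G where "rmod_monoform R Q" "op_rel (carrier R) M Q G"
    "single_val M Q G" "Range G = carrier Q" "nonzero_rel Q G" "\<alpha> = rmod_atom R Q"
proof -
  obtain K L where K: "op_sub (carrier R) K M" "op_sub (carrier R) L M" "L \<subseteq> K"
    and m: "rmod_monoform R (rmod_quot (rmod_sub M K) L)"
    and \<alpha>: "\<alpha> = rmod_atom R (rmod_quot (rmod_sub M K) L)"
    using \<alpha> unfolding rmod_Supp_def rsubmodule_iff_op_sub by blast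
  let ?Q = "rmod_quot (rmod_sub M K) L"
  note s = rmod_sub_props[OF M K(1)]
  have L: "op_sub (carrier R) L (rmod_sub M K)" using s(3) K by blast
  note q = rmod_quot_props[OF s(1) L]
  define P where "P = {(x, L +>\<^bsub>rmod_sub M K\<^esub> x) | x. x \<in> carrier (rmod_sub M K)}"
  note q = q[folded P_def]
  have c: "carrier (rmod_sub M K) = K" by (simp add: rmod_sub_def)
  have "Id_on K O P = P" unfolding P_def c by auto
  then have P: "op_rel (carrier R) M ?Q P" using op_rel_comp[OF s(2) q(2)] by simp
  have sv: "single_val M ?Q P" using q(3) by (simp add: single_val_def rmod_sub_def)
  note D = q(5)
  have "inj_on (\<lambda>X. SOME x. x \<in> X) (carrier ?Q)"
    using inj_on_some_rcosets[OF right_module_op_group[OF s(1)] L] by (simp add: rmod_quot_def)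
  from rmod_copy[OF q(1) this] obtain N :: "('a, 'u) rmodule"
    where N: "right_module R N" "op_iso (carrier R) ?Q N" by blast
  have mN: "rmod_monoform R N"
    using N(1) op_iso_monoform[OF op_iso_sym[OF N(2)]] m unfolding rmod_monoform_iff by simp
  obtain F where F: "op_rel (carrier R) ?Q N F" "single_val ?Q N F" "Domain F = carrier ?Q" "Range F = carrier N"
    using N(2) op_iso_def by metis
  have r: "Range (P O F) = carrier N" using D F(3,4) by blast
  moreover have "nonzero_rel N (P O F)"
    using op_monoform_Range[of "carrier R" N, OF _ _ r] mN right_module_op_group[OF N(1)]
    unfolding rmod_monoform_iff by simp
  moreover have "op_common (carrier R) ?Q N"
    using op_iso_common[OF N(2)] mN unfolding rmod_monoform_def by simp
  then have "\<alpha> = rmod_atom R N" using \<alpha> rmod_atom_eqI[OF m mN] by blast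
  ultimately show ?thesis
    using that mN op_rel_comp[OF P F(1)] single_val_comp[OF sv F(2)] by blast
qed

section \<open>Graded groups\<close>

locale graded_group = abelian_group G for G :: "('b, 'z) ring_scheme" (structure) +
  fixes g :: "int \<Rightarrow> 'b set"
  assumes grading: "is_grading G g"
begin

abbreviation pr :: "int \<Rightarrow> 'b \<Rightarrow> 'b" where "pr i x \<equiv> hcomp G g i x"

lemma comp_subgroup: "additive_subgroup (g i) G"
  using grading is_grading_def by metis

lemma comp_carrier: "x \<in> g i \<Longrightarrow> x \<in> carrier G"
  using additive_subgroup.a_subset[OF comp_subgroup] by blast

lemma zero_in_comp [simp]: "\<zero> \<in> g i"
  using additive_subgroup.zero_closed[OF comp_subgroup] .

lemma hcomp_decomp:
  assumes "x \<in> carrier G" shows "homog_decomp G g (\<lambda>i. pr i x) x"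
proof -
  have "\<exists>!c. homog_decomp G g c x" using grading assms is_grading_def by metis
  from theI'[OF this] show ?thesis by (simp add: hcomp_def)
qed

lemma hcomp_unique: "\<lbrakk>x \<in> carrier G; homog_decomp G g c x\<rbrakk> \<Longrightarrow> pr i x = c i"
  using hcomp_decomp[of x] grading unfolding is_grading_def by metis

lemma hcomp_mem [simp]: "x \<in> carrier G \<Longrightarrow> pr i x \<in> g i"
  using hcomp_decomp homog_decomp_def by metis

lemma hcomp_carrier [simp]: "x \<in> carrier G \<Longrightarrow> pr i x \<in> carrier G"
  using comp_carrier hcomp_mem by blast

lemma hcomp_finite: "x \<in> carrier G \<Longrightarrow> finite {i. pr i x \<noteq> \<zero>}"
  using hcomp_decomp homog_decomp_def by metis

lemma homog_decompI:
  assumes "\<And>i. c i \<in> g i" "finite F" "\<And>i. i \<notin> F \<Longrightarrow> c i = \<zero>"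
  shows "homog_decomp G g c (finsum G c F)"
proof -
  have s: "{i. c i \<noteq> \<zero>} \<subseteq> F" using assms(3) by auto
  have "finsum G c {i. c i \<noteq> \<zero>} = finsum G c F"
    by (rule add.finprod_mono_neutral_cong_left)
      (use assms s comp_carrier[OF assms(1)] in \<open>auto simp: Pi_iff\<close>)
  then show ?thesis using assms s finite_subset unfolding homog_decomp_def by metis
qed

lemma hcomp_homog: "x \<in> g j \<Longrightarrow> pr i x = (if i = j then x else \<zero>)"
proof -
  assume x: "x \<in> g j"
  have "homog_decomp G g (\<lambda>i. if i = j then x else \<zero>) (finsum G (\<lambda>i. if i = j then x else \<zero>) {j})"
    using x by (intro homog_decompI) auto
  moreover have "finsum G (\<lambda>i. if i = j then x else \<zero>) {j} = x"
    using x comp_carrier by (simp add: finsum_insert)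
  ultimately show ?thesis using hcomp_unique x comp_carrier by simp
qed

lemma hcomp_hcomp: "x \<in> carrier G \<Longrightarrow> pr i (pr j x) = (if i = j then pr j x else \<zero>)"
  by (simp add: hcomp_homog)

lemma hcomp_zero [simp]: "pr i \<zero> = \<zero>"
  using hcomp_homog[OF zero_in_comp, of i i] by simp

text \<open>An element is the finite sum of its components, so a property closed under sums need
  only be checked on homogeneous elements.\<close>

lemma graded_induct [consumes 1, case_names zero homog add]:
  assumes "x \<in> carrier G" "P \<zero>" "\<And>i y. y \<in> g i \<Longrightarrow> P y"
    "\<And>y z. \<lbrakk>y \<in> carrier G; z \<in> carrier G; P y; P z\<rbrakk> \<Longrightarrow> P (y \<oplus> z)"
  shows "P x"
proof -
  have "P (finsum G (\<lambda>i. pr i x) F)" if "finite F" for F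
    using that
  proof (induction F)
    case (insert i F)
    have "P (pr i x \<oplus> finsum G (\<lambda>i. pr i x) F)"
      using assms(1,4) insert assms(3)[OF hcomp_mem[OF assms(1)]] by (simp add: finsum_closed Pi_iff)
    then show ?case using insert assms(1) by (simp add: finsum_insert)
  qed (simp add: assms(2))
  then show ?thesis using hcomp_decomp[OF assms(1)] unfolding homog_decomp_def by metis
qed

lemma hcomp_add [simp]:
  assumes "x \<in> carrier G" "y \<in> carrier G" shows "pr i (x \<oplus> y) = pr i x \<oplus> pr i y"
proof -
  let ?F = "{i. pr i x \<noteq> \<zero>} \<union> {i. pr i y \<noteq> \<zero>}"
  have f: "finite ?F" using hcomp_finite assms by simp
  have e: "finsum G (\<lambda>i. pr i z) ?F = z" if z: "z = x \<or> z = y" for z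
  proof -
    have zc: "z \<in> carrier G" using z assms by auto
    have "finsum G (\<lambda>i. pr i z) {i. pr i z \<noteq> \<zero>} = finsum G (\<lambda>i. pr i z) ?F"
      by (rule add.finprod_mono_neutral_cong_left) (use f z zc in auto)
    then show ?thesis using hcomp_decomp[OF zc] unfolding homog_decomp_def by simp
  qed
  have "homog_decomp G g (\<lambda>i. pr i x \<oplus> pr i y) (finsum G (\<lambda>i. pr i x \<oplus> pr i y) ?F)"
    using f assms hcomp_mem additive_subgroup.a_closed[OF comp_subgroup] by (intro homog_decompI) auto
  moreover have "finsum G (\<lambda>i. pr i x \<oplus> pr i y) ?F = x \<oplus> y"
    using e assms by (subst finsum_addf) auto
  ultimately show ?thesis using hcomp_unique assms by simp
qed

lemma hcomp_neg [simp]: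
  assumes "x \<in> carrier G" shows "pr i (\<ominus> x) = \<ominus> pr i x"
  using hcomp_add[of "\<ominus> x" x i] assms by (simp add: l_neg minus_equality)

lemma hcomp_minus [simp]: "\<lbrakk>x \<in> carrier G; y \<in> carrier G\<rbrakk> \<Longrightarrow> pr i (x \<ominus> y) = pr i x \<ominus> pr i y"
  by (simp add: a_minus_def)

lemma mem_of_hcomp:
  assumes "x \<in> carrier G" "additive_subgroup K G" "\<And>i. pr i x \<in> K" shows "x \<in> K"
proof -
  interpret K: additive_subgroup K G by fact
  have "finsum G (\<lambda>i. pr i x) F \<in> K" if "finite F" for F
    using that
  proof (induction F)
    case (insert i F)
    then show ?case using assms by (simp add: finsum_insert)
  qed simp
  then show ?thesis using hcomp_decomp[OF assms(1)] unfolding homog_decomp_def by metis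
qed

lemma zero_subgroup: "additive_subgroup {\<zero>} G"
  by unfold_locales (auto simp: a_inv_def[symmetric])

lemma zero_of_hcomp: "\<lbrakk>x \<in> carrier G; \<And>i. pr i x = \<zero>\<rbrakk> \<Longrightarrow> x = \<zero>"
  using mem_of_hcomp[OF _ zero_subgroup] by blast

end

text \<open>Both sides are additive in \<open>x\<close>, which reduces the claim to a homogeneous
  \<open>x\<close>. The main instances are differentials, right multiplication by a homogeneous
  element, and the map sending \<open>a\<close> to \<open>z a\<close> for a homogeneous
  \<open>z\<close>.\<close>

lemma graded_group_map:
  fixes G :: "('b, 'z) ring_scheme" and H :: "('c, 'y) ring_scheme"
  assumes G: "graded_group G g" and H: "graded_group H h"
    and f: "\<And>x. x \<in> carrier G \<Longrightarrow> f x \<in> carrier H"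
    and add: "\<And>x y. \<lbrakk>x \<in> carrier G; y \<in> carrier G\<rbrakk> \<Longrightarrow> f (x \<oplus>\<^bsub>G\<^esub> y) = f x \<oplus>\<^bsub>H\<^esub> f y"
    and deg: "\<And>i x. x \<in> g i \<Longrightarrow> f x \<in> h (i + k)"
    and x: "x \<in> carrier G"
  shows "hcomp H h i (f x) = f (hcomp G g (i - k) x)"
proof -
  interpret G: graded_group G g by fact
  interpret H: graded_group H h by fact
  have f0: "f \<zero>\<^bsub>G\<^esub> = \<zero>\<^bsub>H\<^esub>"
    using add[of "\<zero>\<^bsub>G\<^esub>" "\<zero>\<^bsub>G\<^esub>"] f[of "\<zero>\<^bsub>G\<^esub>"] H.add.l_cancel_one by simp
  show ?thesis using x
  proof (induction rule: G.graded_induct)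
    case (homog j y)
    then show ?case using H.hcomp_homog[OF deg[OF homog]] G.hcomp_homog[OF homog] f0 by auto
  qed (use f add f0 in auto)
qed

text \<open>Gradings are defined by unique decompositions, but in the examples it is the projections
  \<open>q\<close> that are at hand. Subtracting from \<open>x\<close> the sum of its
  \<open>q\<close>-components leaves an element all of whose components vanish, and
  \<open>sep\<close> makes it zero.\<close>

lemma (in abelian_group) is_gradingI:
  assumes sub: "\<And>i. additive_subgroup (g i) G"
    and q: "\<And>i x. x \<in> carrier G \<Longrightarrow> q i x \<in> g i"
    and add: "\<And>i x y. \<lbrakk>x \<in> carrier G; y \<in> carrier G\<rbrakk> \<Longrightarrow> q i (x \<oplus> y) = q i x \<oplus> q i y"
    and hom: "\<And>i j x. x \<in> g i \<Longrightarrow> q j x = (if j = i then x else \<zero>)"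
    and fin: "\<And>x. x \<in> carrier G \<Longrightarrow> finite {i. q i x \<noteq> \<zero>}"
    and sep: "\<And>x. \<lbrakk>x \<in> carrier G; \<And>i. q i x = \<zero>\<rbrakk> \<Longrightarrow> x = \<zero>"
  shows "is_grading G g" "x \<in> carrier G \<Longrightarrow> hcomp G g i x = q i x"
proof -
  have gc: "x \<in> carrier G" if "x \<in> g i" for x i
    using additive_subgroup.a_subset[OF sub] that by blast
  have q0: "q i \<zero> = \<zero>" for i
    using hom[OF additive_subgroup.zero_closed[OF sub], of i i] by simp
  have qc: "q i x \<in> carrier G" if "x \<in> carrier G" for i x using gc q that by blast
  have qs: "q j (finsum G c F) = (if j \<in> F then c j else \<zero>)"
    if "finite F" and c: "\<And>i. c i \<in> g i" for F c j
    using that(1)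
  proof (induction F)
    case (insert i F)
    have cc: "c i \<in> carrier G" for i using gc[OF c] .
    then have "q j (finsum G c (insert i F)) = q j (c i) \<oplus> q j (finsum G c F)"
      using insert by (simp add: finsum_insert finsum_closed Pi_iff add)
    then show ?case using insert hom[OF c] cc by auto
  qed (simp add: q0)
  have ex: "homog_decomp G g (\<lambda>i. q i x) x" if x: "x \<in> carrier G" for x
  proof -
    let ?s = "finsum G (\<lambda>i. q i x) {i. q i x \<noteq> \<zero>}"
    have s: "?s \<in> carrier G" using qc x by (simp add: finsum_closed)
    have "q i (x \<ominus> ?s) = \<zero>" for i
    proof -
      have "q i x = q i ((x \<ominus> ?s) \<oplus> ?s)" using x s by (simp add: a_minus_def a_assoc l_neg)
      also have "\<dots> = q i (x \<ominus> ?s) \<oplus> q i ?s" using x s add by simp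
      also have "q i ?s = q i x" using qs[OF fin[OF x] q[OF x]] by simp
      finally show ?thesis using qc x s by (metis add.l_cancel_one minus_closed a_comm)
    qed
    then have "x \<ominus> ?s = \<zero>" using sep x s by simp
    then have "x = ?s" using x s minus_eq_zeroD by simp
    then show ?thesis using q fin x unfolding homog_decomp_def by simp
  qed
  have un: "c = (\<lambda>i. q i x)" if "homog_decomp G g c x" for c x
  proof
    fix i
    have "x = finsum G c {i. c i \<noteq> \<zero>}" "finite {i. c i \<noteq> \<zero>}" "\<And>i. c i \<in> g i"
      using that unfolding homog_decomp_def by auto
    then show "c i = q i x" using qs[of "{i. c i \<noteq> \<zero>}" c i] by auto
  qed
  show gr: "is_grading G g" unfolding is_grading_def using sub ex un by metis
  then interpret graded_group G g by unfold_locales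
  show "x \<in> carrier G \<Longrightarrow> hcomp G g i x = q i x" using hcomp_unique ex by metis
qed

section \<open>Dg modules as groups with operators\<close>

text \<open>With the projections \<open>Comp i\<close> among the operators, dg submodules become
  exactly the stable subgroups, and chain maps of degree \<open>0\<close> the additive maps
  commuting with all operators. The theory of groups with operators then covers dg modules.\<close>

datatype 'a dgop = Act 'a | Comp int | Diff

definition dg_ops :: "'a dgring \<Rightarrow> 'a dgop set" where
  "dg_ops A = Act ` carrier A \<union> range Comp \<union> {Diff}"

definition dgr :: "('a, 'm) dgmodule \<Rightarrow> ('a dgop, 'm) rmodule" where
  "dgr M = \<lparr>carrier = carrier M, mult = undefined, one = undefined, zero = zero M, add = add M,
     ract = (\<lambda>x t. case t of Act a \<Rightarrow> x \<triangleleft>\<^bsub>M\<^esub> a | Comp i \<Rightarrow> hcomp M (mcomp M) i x | Diff \<Rightarrow> mdiff M x)\<rparr>"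

abbreviation dg_rel :: "'a dgring \<Rightarrow> ('a, 'm) dgmodule \<Rightarrow> ('a, 'n) dgmodule \<Rightarrow> ('m \<times> 'n) set \<Rightarrow> bool" where
  "dg_rel A M N \<equiv> op_rel (dg_ops A) (dgr M) (dgr N)"

abbreviation dg_common :: "'a dgring \<Rightarrow> ('a, 'm) dgmodule \<Rightarrow> ('a, 'n) dgmodule \<Rightarrow> bool" where
  "dg_common A M N \<equiv> op_common (dg_ops A) (dgr M) (dgr N)"

abbreviation dcomp :: "('a, 'm, 'z) dgmodule_scheme \<Rightarrow> int \<Rightarrow> 'm \<Rightarrow> 'm" where
  "dcomp M \<equiv> hcomp M (mcomp M)"

lemma dgr_simps [simp]:
  "carrier (dgr M) = carrier M" "\<zero>\<^bsub>dgr M\<^esub> = \<zero>\<^bsub>M\<^esub>" "x \<oplus>\<^bsub>dgr M\<^esub> y = x \<oplus>\<^bsub>M\<^esub> y"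
  "x \<triangleleft>\<^bsub>dgr M\<^esub> Act a = x \<triangleleft>\<^bsub>M\<^esub> a" "x \<triangleleft>\<^bsub>dgr M\<^esub> Comp i = dcomp M i x"
  "x \<triangleleft>\<^bsub>dgr M\<^esub> Diff = mdiff M x"
  by (simp_all add: dgr_def)

text \<open>Derived notions of an additive group depend only on carrier, zero and addition; this
  carries facts between a dg module and its variants \<open>dgr\<close>, \<open>forget\<close> and
  \<open>dg_shift\<close>.\<close>

lemma same_group:
  assumes "carrier M = carrier N" "\<zero>\<^bsub>M\<^esub> = \<zero>\<^bsub>N\<^esub>" "add M = add N"
  shows "\<ominus>\<^bsub>M\<^esub> x = \<ominus>\<^bsub>N\<^esub> x" "x \<ominus>\<^bsub>M\<^esub> y = x \<ominus>\<^bsub>N\<^esub> y" "L +>\<^bsub>M\<^esub> x = L +>\<^bsub>N\<^esub> x"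
    "a_rcosets\<^bsub>M\<^esub> L = a_rcosets\<^bsub>N\<^esub> L" "set_add M = set_add N"
    "additive_subgroup L M \<longleftrightarrow> additive_subgroup L N" "abelian_group M \<longleftrightarrow> abelian_group N"
proof -
  show inv: "\<ominus>\<^bsub>M\<^esub> x = \<ominus>\<^bsub>N\<^esub> x" for x using assms by (simp add: a_inv_def m_inv_def)
  then show "x \<ominus>\<^bsub>M\<^esub> y = x \<ominus>\<^bsub>N\<^esub> y" using assms by (simp add: a_minus_def)
  show "L +>\<^bsub>M\<^esub> x = L +>\<^bsub>N\<^esub> x" for x using assms by (simp add: a_r_coset_def r_coset_def)
  show "a_rcosets\<^bsub>M\<^esub> L = a_rcosets\<^bsub>N\<^esub> L" using assms by (simp add: A_RCOSETS_def RCOSETS_def r_coset_def)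
  show "set_add M = set_add N" using assms by (simp add: set_add_def set_mult_def fun_eq_iff)
  show "additive_subgroup L M \<longleftrightarrow> additive_subgroup L N"
    using assms inv by (simp add: additive_subgroup_def subgroup_def m_inv_def)
  have "abelian_group H" if "abelian_group G" "carrier G = carrier H" "\<zero>\<^bsub>G\<^esub> = \<zero>\<^bsub>H\<^esub>" "add G = add H"
    for G :: "('g, 'y) ring_scheme" and H :: "('g, 'z) ring_scheme"
  proof -
    interpret abelian_group G by fact
    show ?thesis
    proof (rule abelian_groupI, unfold that(2-4)[symmetric])
      fix x assume "x \<in> carrier G"
      then show "\<exists>y\<in>carrier G. y \<oplus>\<^bsub>G\<^esub> x = \<zero>\<^bsub>G\<^esub>" by (intro bexI[of _ "\<ominus>\<^bsub>G\<^esub> x"]) (simp_all add: l_neg)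
    qed (simp_all add: a_ac)
  qed
  then show "abelian_group M \<longleftrightarrow> abelian_group N" using assms by metis
qed

lemma dgr_derived [simp]:
  "\<ominus>\<^bsub>dgr M\<^esub> x = \<ominus>\<^bsub>M\<^esub> x" "x \<ominus>\<^bsub>dgr M\<^esub> y = x \<ominus>\<^bsub>M\<^esub> y" "L +>\<^bsub>dgr M\<^esub> x = L +>\<^bsub>M\<^esub> x"
  "a_rcosets\<^bsub>dgr M\<^esub> L = a_rcosets\<^bsub>M\<^esub> L" "set_add (dgr M) = set_add M"
  "additive_subgroup L (dgr M) \<longleftrightarrow> additive_subgroup L M" "abelian_group (dgr M) \<longleftrightarrow> abelian_group M"
  by (intro same_group; simp add: dgr_def)+

lemma dg_submodule_iff_op_sub: "dg_submodule A N M \<longleftrightarrow> op_sub (dg_ops A) N (dgr M)"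
  unfolding dg_submodule_def rsubmodule_def op_sub_def dg_ops_def by (auto simp: ball_Un)

lemma forget_simps [simp]:
  "carrier (forget M) = carrier M" "\<zero>\<^bsub>forget M\<^esub> = \<zero>\<^bsub>M\<^esub>"
  "x \<oplus>\<^bsub>forget M\<^esub> y = x \<oplus>\<^bsub>M\<^esub> y" "x \<triangleleft>\<^bsub>forget M\<^esub> a = x \<triangleleft>\<^bsub>M\<^esub> a"
  by (simp_all add: forget_def rmodule.truncate_def)

lemma forget_derived [simp]:
  "x \<ominus>\<^bsub>forget M\<^esub> y = x \<ominus>\<^bsub>M\<^esub> y" "additive_subgroup L (forget M) \<longleftrightarrow> additive_subgroup L M"
  "abelian_group (forget M) \<longleftrightarrow> abelian_group M"
  by (intro same_group; simp add: forget_def rmodule.truncate_def)+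

lemma right_module_forget: "right_module R (forget M) \<longleftrightarrow> right_module R M"
  unfolding right_module_def right_module_axioms_def
  by simp

lemma dg_module_graded: "dg_module A M \<Longrightarrow> graded_group M (mcomp M)"
  unfolding dg_module_def dg_module_axioms_def graded_group_def graded_group_axioms_def right_module_def
  by simp

lemma dg_ring_graded: "dg_ring A \<Longrightarrow> graded_group A (rcomp A)"
  unfolding dg_ring_def dg_ring_axioms_def graded_group_def graded_group_axioms_def
  by (simp add: ring.is_abelian_group)

context dg_module
begin

sublocale gm: graded_group M "mcomp M"
  using dg_module_graded dg_module_axioms by blast

lemma mdiff_closed [simp]: "x \<in> carrier M \<Longrightarrow> mdiff M x \<in> carrier M"
  using mdiff_hom unfolding hom_def by auto

lemma mdiff_add [simp]:
  "\<lbrakk>x \<in> carrier M; y \<in> carrier M\<rbrakk> \<Longrightarrow> mdiff M (x \<oplus>\<^bsub>M\<^esub> y) = mdiff M x \<oplus>\<^bsub>M\<^esub> mdiff M y"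
  using mdiff_hom unfolding hom_def by auto

lemma mdiff_zero [simp]: "mdiff M \<zero>\<^bsub>M\<^esub> = \<zero>\<^bsub>M\<^esub>"
  using mdiff_add[of "\<zero>\<^bsub>M\<^esub>" "\<zero>\<^bsub>M\<^esub>"] M.add.l_cancel_one by simp

lemma mdiff_neg [simp]: "x \<in> carrier M \<Longrightarrow> mdiff M (\<ominus>\<^bsub>M\<^esub> x) = \<ominus>\<^bsub>M\<^esub> mdiff M x"
  using mdiff_add[of "\<ominus>\<^bsub>M\<^esub> x" x] by (simp add: M.l_neg M.minus_equality del: mdiff_add)

lemma ract_zero_left [simp]: "a \<in> carrier A \<Longrightarrow> \<zero>\<^bsub>M\<^esub> \<triangleleft>\<^bsub>M\<^esub> a = \<zero>\<^bsub>M\<^esub>"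
  using ract_add_left[of "\<zero>\<^bsub>M\<^esub>" "\<zero>\<^bsub>M\<^esub>" a] ract_closed M.add.l_cancel_one by simp

lemma ract_zero_right [simp]: "x \<in> carrier M \<Longrightarrow> x \<triangleleft>\<^bsub>M\<^esub> \<zero> = \<zero>\<^bsub>M\<^esub>"
  using ract_add_right[of x \<zero> \<zero>] ract_closed M.add.l_cancel_one by simp

lemma ract_neg_right: "\<lbrakk>x \<in> carrier M; a \<in> carrier A\<rbrakk> \<Longrightarrow> x \<triangleleft>\<^bsub>M\<^esub> (\<ominus> a) = \<ominus>\<^bsub>M\<^esub> (x \<triangleleft>\<^bsub>M\<^esub> a)"
  using ract_add_right[of x "\<ominus> a" a] ract_closed by (simp add: A.l_neg M.minus_equality)

lemma hcomp_mdiff: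
  assumes "x \<in> carrier M"
  shows "dcomp M i (mdiff M x) = mdiff M (dcomp M (i - 1) x)"
  using graded_group_map[OF gm.graded_group_axioms gm.graded_group_axioms, of "mdiff M" 1 x i]
    mdiff_comp assms by simp

lemma hcomp_ract:
  assumes "x \<in> carrier M" "a \<in> rcomp A j"
  shows "dcomp M i (x \<triangleleft>\<^bsub>M\<^esub> a) = dcomp M (i - j) x \<triangleleft>\<^bsub>M\<^esub> a"
proof -
  have "a \<in> carrier A" using assms(2) graded_group.comp_carrier[OF dg_ring_graded[OF dg_ring_axioms]] by simp
  then show ?thesis
    using graded_group_map[OF gm.graded_group_axioms gm.graded_group_axioms, of "\<lambda>x. x \<triangleleft>\<^bsub>M\<^esub> a" j x i]
    assms ract_comp ract_closed ract_add_left by simp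
qed

end

lemma dg_module_op_group:
  fixes M :: "('a, 'm) dgmodule" and A :: "'a dgring"
  assumes "dg_module A M" shows "op_group (dg_ops A) (dgr M)"
proof -
  interpret dg_module A M by fact
  have "abelian_group (dgr M)" using M.abelian_group_axioms by simp
  moreover have "op_group_axioms (dg_ops A) (dgr M)"
    unfolding op_group_axioms_def dg_ops_def
    by (auto simp: ract_closed ract_add_left)
  ultimately show ?thesis by (simp add: op_group_def)
qed

lemma dg_relI:
  fixes M :: "('a, 'm) dgmodule" and N :: "('a, 'n) dgmodule" and A :: "'a dgring"
  assumes M: "dg_module A M" and N: "dg_module A N"
    and c: "\<And>x y. (x, y) \<in> G \<Longrightarrow> x \<in> carrier M \<and> y \<in> carrier N" and z: "(\<zero>\<^bsub>M\<^esub>, \<zero>\<^bsub>N\<^esub>) \<in> G"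
    and add: "\<And>x y x' y'. \<lbrakk>(x, y) \<in> G; (x', y') \<in> G\<rbrakk> \<Longrightarrow> (x \<oplus>\<^bsub>M\<^esub> x', y \<oplus>\<^bsub>N\<^esub> y') \<in> G"
    and act: "\<And>x y a. \<lbrakk>(x, y) \<in> G; a \<in> carrier A\<rbrakk> \<Longrightarrow> (x \<triangleleft>\<^bsub>M\<^esub> a, y \<triangleleft>\<^bsub>N\<^esub> a) \<in> G"
    and comp: "\<And>x y i. (x, y) \<in> G \<Longrightarrow> (dcomp M i x, dcomp N i y) \<in> G"
    and diff: "\<And>x y. (x, y) \<in> G \<Longrightarrow> (mdiff M x, mdiff N y) \<in> G"
  shows "dg_rel A M N G"
proof (rule op_relI)
  interpret M: dg_module A M by fact
  interpret N: dg_module A N by fact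
  fix x y x' y' assume "(x, y) \<in> G" and xy': "(x', y') \<in> G"
  \<comment> \<open>Negatives are obtained by acting with \<open>\<ominus> \<one>\<close>, so
    closure under sums is enough.\<close>
  have "x' \<triangleleft>\<^bsub>M\<^esub> (\<ominus>\<^bsub>A\<^esub> \<one>\<^bsub>A\<^esub>) = \<ominus>\<^bsub>M\<^esub> x'" "y' \<triangleleft>\<^bsub>N\<^esub> (\<ominus>\<^bsub>A\<^esub> \<one>\<^bsub>A\<^esub>) = \<ominus>\<^bsub>N\<^esub> y'"
    using c[OF xy'] by (simp_all add: M.ract_neg_right N.ract_neg_right M.ract_one N.ract_one)
  then have "(\<ominus>\<^bsub>M\<^esub> x', \<ominus>\<^bsub>N\<^esub> y') \<in> G" using act[OF xy', of "\<ominus>\<^bsub>A\<^esub> \<one>\<^bsub>A\<^esub>"] by simp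
  then show "(x \<ominus>\<^bsub>dgr M\<^esub> x', y \<ominus>\<^bsub>dgr N\<^esub> y') \<in> G"
    using add[OF \<open>(x, y) \<in> G\<close>] by (simp add: a_minus_def)
next
  fix x y t assume "(x, y) \<in> G" "t \<in> dg_ops A"
  then show "(x \<triangleleft>\<^bsub>dgr M\<^esub> t, y \<triangleleft>\<^bsub>dgr N\<^esub> t) \<in> G"
    using act comp diff unfolding dg_ops_def by auto
qed (use c z dg_module_op_group[OF M] dg_module_op_group[OF N] in auto)

lemma dg_relD:
  assumes "dg_rel A M N G" "(x, y) \<in> G"
  shows "x \<in> carrier M" "y \<in> carrier N" "a \<in> carrier A \<Longrightarrow> (x \<triangleleft>\<^bsub>M\<^esub> a, y \<triangleleft>\<^bsub>N\<^esub> a) \<in> G"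
    "(dcomp M i x, dcomp N i y) \<in> G" "(mdiff M x, mdiff N y) \<in> G"
    "(\<zero>\<^bsub>M\<^esub>, \<zero>\<^bsub>N\<^esub>) \<in> G"
  using op_relD(3-5)[OF assms(1)] op_relD(9)[OF assms(1) assms(2), of "Act a"]
    op_relD(9)[OF assms(1) assms(2), of "Comp i"] op_relD(9)[OF assms(1) assms(2), of Diff] assms(2)
  by (auto simp: dg_ops_def)

text \<open>Again \<open>Q\<close> is a bare record whose laws are inherited along \<open>f\<close>.
  The condition \<open>ker\<close> says that the kernel of \<open>f\<close> is graded; it makes the
  projections of \<open>M\<close> descend to \<open>Q\<close>, where they yield a grading by the
  images of the graded pieces of \<open>K\<close>.\<close>

lemma dg_module_image:
  fixes M :: "('a, 'm) dgmodule" and Q :: "('a, 'n) dgmodule" and A :: "'a dgring"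
  assumes M: "dg_module A M" and K: "op_sub (dg_ops A) K (dgr M)" and im: "f ` K = carrier Q"
    and z: "f \<zero>\<^bsub>M\<^esub> = \<zero>\<^bsub>Q\<^esub>"
    and add: "\<And>x y. \<lbrakk>x \<in> K; y \<in> K\<rbrakk> \<Longrightarrow> f (x \<oplus>\<^bsub>M\<^esub> y) = f x \<oplus>\<^bsub>Q\<^esub> f y"
    and act: "\<And>x a. \<lbrakk>x \<in> K; a \<in> carrier A\<rbrakk> \<Longrightarrow> f (x \<triangleleft>\<^bsub>M\<^esub> a) = f x \<triangleleft>\<^bsub>Q\<^esub> a"
    and diff: "\<And>x. x \<in> K \<Longrightarrow> f (mdiff M x) = mdiff Q (f x)"
    and comp: "\<And>i. mcomp Q i = f ` (mcomp M i \<inter> K)"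
    and ker: "\<And>x i. \<lbrakk>x \<in> K; f x = \<zero>\<^bsub>Q\<^esub>\<rbrakk> \<Longrightarrow> f (dcomp M i x) = \<zero>\<^bsub>Q\<^esub>"
  shows "dg_module A Q" "\<And>x i. x \<in> K \<Longrightarrow> dcomp Q i (f x) = f (dcomp M i x)"
    "dg_rel A M Q {(x, f x) | x. x \<in> K}"
proof -
  interpret M: dg_module A M by fact
  note Kd = op_subD[OF dg_module_op_group[OF M] K]
  have Kc: "x \<in> carrier M" "dcomp M i x \<in> K" "mdiff M x \<in> K" "a \<in> carrier A \<Longrightarrow> x \<triangleleft>\<^bsub>M\<^esub> a \<in> K"
    "\<ominus>\<^bsub>M\<^esub> x \<in> K" if "x \<in> K" for x i a
    using that Kd(1,6) Kd(5)[of x "Comp i"] Kd(5)[of x Diff] Kd(5)[of x "Act a"] by (auto simp: dg_ops_def)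
  have Ka: "x \<oplus>\<^bsub>M\<^esub> y \<in> K" "x \<ominus>\<^bsub>M\<^esub> y \<in> K" if "x \<in> K" "y \<in> K" for x y using Kd(3,4) that by auto
  have K0: "\<zero>\<^bsub>M\<^esub> \<in> K" using Kd(2) by simp
  have KA: "op_sub (carrier A) K (forget M)"
    using K Kc unfolding op_sub_def by simp
  have fM: "right_module A (forget M)" using right_module_forget M.right_module_axioms by blast
  have "right_module A (forget Q)"
    by (rule right_module_image[OF fM KA, of f]) (simp_all add: im z add act)
  then interpret Q: right_module A Q using right_module_forget by blast
  have neg: "f (\<ominus>\<^bsub>M\<^esub> x) = \<ominus>\<^bsub>Q\<^esub> f x" if "x \<in> K" for x
  proof -
    have "f (\<ominus>\<^bsub>M\<^esub> x) \<oplus>\<^bsub>Q\<^esub> f x = \<zero>\<^bsub>Q\<^esub>" using Kc that by (simp flip: add z add: M.M.l_neg)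
    moreover have "f (\<ominus>\<^bsub>M\<^esub> x) \<in> carrier Q" "f x \<in> carrier Q" using Kc(5) that im by blast+
    ultimately show ?thesis using Q.M.minus_equality by simp
  qed
  have mn: "f (x \<ominus>\<^bsub>M\<^esub> y) = f x \<ominus>\<^bsub>Q\<^esub> f y" if "x \<in> K" "y \<in> K" for x y
    using add[of x "\<ominus>\<^bsub>M\<^esub> y"] neg[OF that(2)] Kc(5) that by (simp add: a_minus_def)
  have fc: "f x \<in> carrier Q" if "x \<in> K" for x using that unfolding im[symmetric] by simp
  have fE: "\<exists>u\<in>K. x = f u" if "x \<in> carrier Q" for x using that unfolding im[symmetric] by auto
  let ?p = "dcomp M"
  \<comment> \<open>The projection on \<open>Q\<close> computed from an arbitrary preimage; that the
    choice is irrelevant is where \<open>ker\<close> enters.\<close>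
  define q where "q i y = f (?p i (inv_into K f y))" for i y
  have q: "q i (f x) = f (?p i x)" if x: "x \<in> K" for i x
  proof -
    let ?y = "inv_into K f (f x)"
    have y: "?y \<in> K" "f ?y = f x" using x by (simp_all add: inv_into_into f_inv_into_f)
    then have "f (?y \<ominus>\<^bsub>M\<^esub> x) = \<zero>\<^bsub>Q\<^esub>" using mn x fc by (simp add: a_minus_def Q.M.r_neg)
    then have "f (?p i (?y \<ominus>\<^bsub>M\<^esub> x)) = \<zero>\<^bsub>Q\<^esub>" using ker Ka y x by blast
    then have "f (?p i ?y) \<ominus>\<^bsub>Q\<^esub> f (?p i x) = \<zero>\<^bsub>Q\<^esub>" using mn Kc x y by simp
    then show ?thesis unfolding q_def using Q.M.minus_eq_zeroD fc Kc x y by blast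
  qed
  have cK: "mcomp Q i \<subseteq> carrier Q" for i unfolding comp im[symmetric] by blast
  have pm: "?p i x \<in> mcomp M i" if "x \<in> K" for i x using Kc(1)[OF that] by simp
  have sub: "additive_subgroup (mcomp Q i) Q" for i
  proof -
    interpret S: additive_subgroup "mcomp M i" M by (rule M.gm.comp_subgroup)
    have "subgroup (mcomp Q i) (add_monoid Q)"
    proof (rule group.subgroupI)
      show "Group.group (add_monoid Q)" by (rule Q.M.a_group)
      show "mcomp Q i \<subseteq> carrier (add_monoid Q)" using cK by simp
      show "mcomp Q i \<noteq> {}" unfolding comp using K0 S.zero_closed by blast
      show "inv\<^bsub>add_monoid Q\<^esub> a \<in> mcomp Q i" if a: "a \<in> mcomp Q i" for a
      proof -
        obtain x where x: "x \<in> mcomp M i" "x \<in> K" "a = f x" using a unfolding comp by blast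
        then have "\<ominus>\<^bsub>Q\<^esub> a = f (\<ominus>\<^bsub>M\<^esub> x)" using neg by simp
        moreover have "\<ominus>\<^bsub>M\<^esub> x \<in> mcomp M i \<inter> K" using x Kc(5) S.a_inv_closed by simp
        ultimately show ?thesis unfolding comp a_inv_def[symmetric] by blast
      qed
      show "a \<otimes>\<^bsub>add_monoid Q\<^esub> b \<in> mcomp Q i" if a: "a \<in> mcomp Q i" "b \<in> mcomp Q i" for a b
      proof -
        obtain x where x: "x \<in> mcomp M i" "x \<in> K" "a = f x" using a unfolding comp by blast
        obtain y where y: "y \<in> mcomp M i" "y \<in> K" "b = f y" using a unfolding comp by blast
        have "a \<oplus>\<^bsub>Q\<^esub> b = f (x \<oplus>\<^bsub>M\<^esub> y)" using add x y by simp
        moreover have "x \<oplus>\<^bsub>M\<^esub> y \<in> mcomp M i \<inter> K" using x y Ka(1) by simp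
        ultimately show ?thesis unfolding comp by simp
      qed
    qed
    then show ?thesis by (simp add: additive_subgroup_def)
  qed
  have gr: "is_grading Q (mcomp Q)" and hc: "\<And>i x. x \<in> carrier Q \<Longrightarrow> dcomp Q i x = q i x"
  proof -
    have 1: "q i x \<in> mcomp Q i" if x: "x \<in> carrier Q" for i x
    proof -
      obtain u where u: "u \<in> K" "x = f u" using fE[OF x] by blast
      then show ?thesis using q[OF u(1)] pm[OF u(1)] Kc(2)[OF u(1)] unfolding comp by blast
    qed
    have 2: "q i (x \<oplus>\<^bsub>Q\<^esub> y) = q i x \<oplus>\<^bsub>Q\<^esub> q i y" if xy: "x \<in> carrier Q" "y \<in> carrier Q" for i x y
    proof -
      obtain u v where u: "u \<in> K" "x = f u" "v \<in> K" "y = f v"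
        using fE[OF xy(1)] fE[OF xy(2)] by blast
      have "q i (x \<oplus>\<^bsub>Q\<^esub> y) = q i (f (u \<oplus>\<^bsub>M\<^esub> v))" using u add by simp
      also have "\<dots> = f (?p i (u \<oplus>\<^bsub>M\<^esub> v))" using q Ka(1) u by blast
      also have "\<dots> = q i x \<oplus>\<^bsub>Q\<^esub> q i y" using u add Kc q by simp
      finally show ?thesis .
    qed
    have 3: "q j x = (if j = i then x else \<zero>\<^bsub>Q\<^esub>)" if x: "x \<in> mcomp Q i" for i j x
    proof -
      obtain u where u: "u \<in> K" "u \<in> mcomp M i" "x = f u" using x unfolding comp by blast
      then show ?thesis using q[OF u(1)] M.gm.hcomp_homog[OF u(2)] z by simp
    qed
    have 4: "finite {i. q i x \<noteq> \<zero>\<^bsub>Q\<^esub>}" if x: "x \<in> carrier Q" for x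
    proof -
      obtain u where u: "u \<in> K" "x = f u" using fE x by blast
      have "{i. q i x \<noteq> \<zero>\<^bsub>Q\<^esub>} \<subseteq> {i. ?p i u \<noteq> \<zero>\<^bsub>M\<^esub>}" using q[OF u(1)] u(2) z by auto
      then show ?thesis using M.gm.hcomp_finite[OF Kc(1)[OF u(1)]] finite_subset by blast
    qed
    have 5: "x = \<zero>\<^bsub>Q\<^esub>" if x: "x \<in> carrier Q" "\<And>i. q i x = \<zero>\<^bsub>Q\<^esub>" for x
    proof -
      obtain u where u: "u \<in> K" "x = f u" using fE x by blast
      \<comment> \<open>With no operators \<open>op_sub\<close> only means an additive subgroup. The
        kernel of \<open>f\<close> contains all components of \<open>u\<close>, hence
        \<open>u\<close> itself.\<close>
      have "op_sub {} {x \<in> K. f x = \<zero>\<^bsub>Q\<^esub>} (forget M)"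
      proof (rule op_subI)
        show "op_group {} (forget M)"
          using right_module_op_group[OF fM] by (simp add: op_group_def op_group_axioms_def)
        show "{x \<in> K. f x = \<zero>\<^bsub>Q\<^esub>} \<noteq> {}" using K0 z by blast
        show "x \<ominus>\<^bsub>forget M\<^esub> y \<in> {x \<in> K. f x = \<zero>\<^bsub>Q\<^esub>}"
          if "x \<in> {x \<in> K. f x = \<zero>\<^bsub>Q\<^esub>}" "y \<in> {x \<in> K. f x = \<zero>\<^bsub>Q\<^esub>}" for x y
          using that mn Ka(2) by (simp add: a_minus_def[of Q])
      qed (use Kc(1) in auto)
      then have "additive_subgroup {x \<in> K. f x = \<zero>\<^bsub>Q\<^esub>} M"
        unfolding op_sub_def by simp
      moreover have "f (?p i u) = \<zero>\<^bsub>Q\<^esub>" for i using q[OF u(1), of i] x(2)[of i] u(2) by simp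
      ultimately have "u \<in> {x \<in> K. f x = \<zero>\<^bsub>Q\<^esub>}"
        using M.gm.mem_of_hcomp[OF Kc(1)[OF u(1)], of "{x \<in> K. f x = \<zero>\<^bsub>Q\<^esub>}"] Kc(2)[OF u(1)] by simp
      then show ?thesis using u by simp
    qed
    show "is_grading Q (mcomp Q)" by (rule Q.M.is_gradingI(1)[OF sub 1 2 3 4 5])
    show "dcomp Q i x = q i x" if "x \<in> carrier Q" for i x
      by (rule Q.M.is_gradingI(2)[OF sub 1 2 3 4 5 that])
  qed
  then show hQ: "dcomp Q i (f x) = f (?p i x)" if "x \<in> K" for x i
    using q[OF that] fc[OF that] by simp
  show dQ: "dg_module A Q"
  proof (intro dg_module.intro dg_module_axioms.intro)
    show "dg_ring A" by (rule M.dg_ring_axioms)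
    show "right_module A Q" by (rule Q.right_module_axioms)
    show "is_grading Q (mcomp Q)" by fact
    show "x \<triangleleft>\<^bsub>Q\<^esub> a \<in> mcomp Q (i + j)" if xa: "x \<in> mcomp Q i" "a \<in> rcomp A j" for x a i j
    proof -
      obtain u where u: "u \<in> K" "u \<in> mcomp M i" "x = f u" using xa unfolding comp by blast
      have a: "a \<in> carrier A" using graded_group.comp_carrier[OF dg_ring_graded[OF M.dg_ring_axioms] xa(2)] .
      have "x \<triangleleft>\<^bsub>Q\<^esub> a = f (u \<triangleleft>\<^bsub>M\<^esub> a)" using act u a by simp
      then show ?thesis using M.ract_comp[OF u(2) xa(2)] Kc(4)[OF u(1) a] unfolding comp by blast
    qed
    show "mdiff Q \<in> hom (add_monoid Q) (add_monoid Q)"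
    proof (rule homI)
      fix x assume "x \<in> carrier (add_monoid Q)"
      then obtain u where u: "u \<in> K" "x = f u" using fE by auto
      then show "mdiff Q x \<in> carrier (add_monoid Q)" using diff[OF u(1)] Kc(3) fc by fastforce
    next
      fix x y assume "x \<in> carrier (add_monoid Q)" "y \<in> carrier (add_monoid Q)"
      then obtain u v where u: "u \<in> K" "x = f u" "v \<in> K" "y = f v" using fE by (metis partial_object.select_convs(1))
      have "mdiff Q (x \<oplus>\<^bsub>Q\<^esub> y) = f (mdiff M (u \<oplus>\<^bsub>M\<^esub> v))" using u add diff Ka(1) by simp
      also have "\<dots> = f (mdiff M u) \<oplus>\<^bsub>Q\<^esub> f (mdiff M v)" using u Kc add by simp
      finally show "mdiff Q (x \<otimes>\<^bsub>add_monoid Q\<^esub> y) = mdiff Q x \<otimes>\<^bsub>add_monoid Q\<^esub> mdiff Q y"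
        using u diff by simp
    qed
    show "mdiff Q x \<in> mcomp Q (i + 1)" if x: "x \<in> mcomp Q i" for x i
    proof -
      obtain u where u: "u \<in> K" "u \<in> mcomp M i" "x = f u" using x unfolding comp by blast
      then have "mdiff Q x = f (mdiff M u)" using diff by simp
      then show ?thesis using M.mdiff_comp[OF u(2)] Kc(3)[OF u(1)] unfolding comp by blast
    qed
    show "mdiff Q (mdiff Q x) = \<zero>\<^bsub>Q\<^esub>" if x: "x \<in> carrier Q" for x
    proof -
      obtain u where u: "u \<in> K" "x = f u" using fE[OF x] by blast
      then have "mdiff Q (mdiff Q x) = f (mdiff M (mdiff M u))" using diff Kc(3) by simp
      then show ?thesis using M.mdiff_mdiff Kc(1) u z by simp
    qed
    show "mdiff Q (x \<triangleleft>\<^bsub>Q\<^esub> a) = (mdiff Q x \<triangleleft>\<^bsub>Q\<^esub> a) \<oplus>\<^bsub>Q\<^esub> signed Q i (x \<triangleleft>\<^bsub>Q\<^esub> rdiff A a)"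
      if x: "x \<in> mcomp Q i" and a: "a \<in> carrier A" for x a i
    proof -
      obtain u where u: "u \<in> K" "u \<in> mcomp M i" "x = f u" using x unfolding comp by blast
      have da: "rdiff A a \<in> carrier A" using M.diff_hom a unfolding hom_def by auto
      have s: "signed Q i (f v) = f (signed M i v)" "signed M i v \<in> K" if "v \<in> K" for v
        using neg Kc(5) that by (simp_all add: signed_def)
      have "mdiff Q (x \<triangleleft>\<^bsub>Q\<^esub> a) = f (mdiff M (u \<triangleleft>\<^bsub>M\<^esub> a))"
        using u a act diff Kc(4) by simp
      also have "\<dots> = f (mdiff M u \<triangleleft>\<^bsub>M\<^esub> a \<oplus>\<^bsub>M\<^esub> signed M i (u \<triangleleft>\<^bsub>M\<^esub> rdiff A a))"
        using M.mleibniz[OF u(2) a] by simp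
      also have "\<dots> = f (mdiff M u \<triangleleft>\<^bsub>M\<^esub> a) \<oplus>\<^bsub>Q\<^esub> signed Q i (f (u \<triangleleft>\<^bsub>M\<^esub> rdiff A a))"
        using add s Kc u a da by simp
      finally show ?thesis using u a da act diff Kc by simp
    qed
  qed
  show "dg_rel A M Q {(x, f x) | x. x \<in> K}"
  proof (rule dg_relI[OF M dQ])
    show "(\<zero>\<^bsub>M\<^esub>, \<zero>\<^bsub>Q\<^esub>) \<in> {(x, f x) | x. x \<in> K}" using z K0 by auto
    show "(x \<oplus>\<^bsub>M\<^esub> x', y \<oplus>\<^bsub>Q\<^esub> y') \<in> {(x, f x) | x. x \<in> K}"
      if "(x, y) \<in> {(x, f x) | x. x \<in> K}" "(x', y') \<in> {(x, f x) | x. x \<in> K}" for x y x' y'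
      using that add Ka(1) by auto
  qed (use Kc fc act hQ diff in auto)
qed

lemma dg_sub_props:
  fixes M :: "('a, 'm) dgmodule" and A :: "'a dgring"
  assumes M: "dg_module A M" and K: "op_sub (dg_ops A) K (dgr M)"
  shows "dg_module A (dg_sub M K)"
    "\<And>x i. x \<in> K \<Longrightarrow> dcomp (dg_sub M K) i x = dcomp M i x"
    "dg_rel A M (dg_sub M K) (Id_on K)"
    "op_sub (dg_ops A) L (dgr (dg_sub M K)) \<longleftrightarrow> op_sub (dg_ops A) L (dgr M) \<and> L \<subseteq> K"
proof -
  interpret M: dg_module A M by fact
  note Kd = op_subD[OF dg_module_op_group[OF M] K]
  have a: "id ` K = carrier (dg_sub M K)" "id \<zero>\<^bsub>M\<^esub> = \<zero>\<^bsub>dg_sub M K\<^esub>"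
    "\<And>x y. \<lbrakk>x \<in> K; y \<in> K\<rbrakk> \<Longrightarrow> id (x \<oplus>\<^bsub>M\<^esub> y) = id x \<oplus>\<^bsub>dg_sub M K\<^esub> id y"
    "\<And>x a. \<lbrakk>x \<in> K; a \<in> carrier A\<rbrakk> \<Longrightarrow> id (x \<triangleleft>\<^bsub>M\<^esub> a) = id x \<triangleleft>\<^bsub>dg_sub M K\<^esub> a"
    "\<And>x. x \<in> K \<Longrightarrow> id (mdiff M x) = mdiff (dg_sub M K) (id x)"
    "\<And>i. mcomp (dg_sub M K) i = id ` (mcomp M i \<inter> K)"
    "\<And>x i. \<lbrakk>x \<in> K; id x = \<zero>\<^bsub>dg_sub M K\<^esub>\<rbrakk> \<Longrightarrow> id (dcomp M i x) = \<zero>\<^bsub>dg_sub M K\<^esub>"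
    by (simp_all add: dg_sub_def)
  note im = dg_module_image[OF M K a]
  show "dg_module A (dg_sub M K)" by (rule im(1))
  show "x \<in> K \<Longrightarrow> dcomp (dg_sub M K) i x = dcomp M i x" for x i
    using im(2)[of x i] by simp
  have "{(x, id x) | x. x \<in> K} = Id_on K" by auto
  then show rel: "dg_rel A M (dg_sub M K) (Id_on K)" using im(3) by simp
  show "op_sub (dg_ops A) L (dgr (dg_sub M K)) \<longleftrightarrow> op_sub (dg_ops A) L (dgr M) \<and> L \<subseteq> K"
    by (rule op_sub_in_sub[OF rel]) (simp add: dg_sub_def)
qed

lemma dg_quot_props:
  fixes M :: "('a, 'm) dgmodule" and A :: "'a dgring"
  assumes M: "dg_module A M" and L: "op_sub (dg_ops A) L (dgr M)"
  defines "P \<equiv> {(x, L +>\<^bsub>M\<^esub> x) | x. x \<in> carrier M}"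
  shows "dg_module A (dg_quot M L)" "dg_rel A M (dg_quot M L) P"
    "single_val (dgr M) (dgr (dg_quot M L)) P" "Domain P = carrier M" "Range P = carrier (dg_quot M L)"
    "(x, \<zero>\<^bsub>dg_quot M L\<^esub>) \<in> P \<longleftrightarrow> x \<in> L"
proof -
  interpret M: dg_module A M by fact
  note oM = dg_module_op_group[OF M]
  note Ld = op_subD[OF oM L]
  note c = op_coset[OF oM L]
  have sc: "op_sub (dg_ops A) (carrier M) (dgr M)" using op_sub_carrier[OF oM] by simp
  have a: "(\<lambda>x. L +>\<^bsub>M\<^esub> x) ` carrier M = carrier (dg_quot M L)"
    "L +>\<^bsub>M\<^esub> \<zero>\<^bsub>M\<^esub> = \<zero>\<^bsub>dg_quot M L\<^esub>"
    "\<And>x y. \<lbrakk>x \<in> carrier M; y \<in> carrier M\<rbrakk> \<Longrightarrow>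
      L +>\<^bsub>M\<^esub> (x \<oplus>\<^bsub>M\<^esub> y) = (L +>\<^bsub>M\<^esub> x) \<oplus>\<^bsub>dg_quot M L\<^esub> (L +>\<^bsub>M\<^esub> y)"
    using c(1-3) by (simp_all add: dg_quot_def)
  have b: "\<And>x a. \<lbrakk>x \<in> carrier M; a \<in> carrier A\<rbrakk> \<Longrightarrow>
      L +>\<^bsub>M\<^esub> (x \<triangleleft>\<^bsub>M\<^esub> a) = (L +>\<^bsub>M\<^esub> x) \<triangleleft>\<^bsub>dg_quot M L\<^esub> a"
    using c(4)[of _ "Act a" for a] by (simp add: dg_quot_def quot_ract_def dg_ops_def)
  have d: "\<And>x. x \<in> carrier M \<Longrightarrow> L +>\<^bsub>M\<^esub> mdiff M x = mdiff (dg_quot M L) (L +>\<^bsub>M\<^esub> x)"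
    using c(4)[of _ Diff] by (simp add: dg_quot_def dg_ops_def)
  have e: "\<And>i. mcomp (dg_quot M L) i = (\<lambda>x. L +>\<^bsub>M\<^esub> x) ` (mcomp M i \<inter> carrier M)"
    using M.gm.comp_carrier by (auto simp: dg_quot_def)
  have k: "L +>\<^bsub>M\<^esub> x = \<zero>\<^bsub>dg_quot M L\<^esub> \<longleftrightarrow> x \<in> L" if "x \<in> carrier M" for x
    using c(5)[of x] that by (simp add: dg_quot_def)
  have f: "\<And>x i. \<lbrakk>x \<in> carrier M; L +>\<^bsub>M\<^esub> x = \<zero>\<^bsub>dg_quot M L\<^esub>\<rbrakk> \<Longrightarrow>
      L +>\<^bsub>M\<^esub> dcomp M i x = \<zero>\<^bsub>dg_quot M L\<^esub>"
    using k Ld(5)[of _ "Comp i" for i] by (simp add: dg_ops_def)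
  note im = dg_module_image[OF M sc a b d e f]
  show "dg_module A (dg_quot M L)" by (rule im(1))
  show "dg_rel A M (dg_quot M L) P" unfolding P_def by (rule im(3))
  show "single_val (dgr M) (dgr (dg_quot M L)) P" using a(2) by (auto simp: P_def single_val_def)
  show "Domain P = carrier M" unfolding P_def by blast
  show "Range P = carrier (dg_quot M L)" unfolding P_def a(1)[symmetric] by blast
  have "x \<in> L \<Longrightarrow> x \<in> carrier M" using Ld(1) by simp
  then show "(x, \<zero>\<^bsub>dg_quot M L\<^esub>) \<in> P \<longleftrightarrow> x \<in> L" using k[of x] by (auto simp: P_def)
qed

section \<open>Common subobjects, atoms and supports of dg modules\<close>

text \<open>The definition asks \<open>f\<close> to preserve the graded pieces, the operator version
  asks it to commute with the projections. One direction holds since an additive map of degree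
  \<open>0\<close> commutes with projections, the other since a homogeneous element equals its own
  component.\<close>

lemma dg_common_sub_iff:
  fixes M :: "('a, 'm) dgmodule" and N :: "('a, 'n) dgmodule" and A :: "'a dgring"
  assumes M: "dg_module A M" and N: "dg_module A N"
  shows "dg_common_sub A M N \<longleftrightarrow> dg_common A M N"
proof -
  interpret M: dg_module A M by fact
  interpret N: dg_module A N by fact
  have sub: "dg_isomorphic A (dg_sub M K) (dg_sub N L) \<longleftrightarrow> (\<exists>f. bij_betw f K L \<and>
      (\<forall>x\<in>K. \<forall>y\<in>K. f (x \<oplus>\<^bsub>dgr M\<^esub> y) = f x \<oplus>\<^bsub>dgr N\<^esub> f y) \<and>
      (\<forall>x\<in>K. \<forall>t\<in>dg_ops A. f (x \<triangleleft>\<^bsub>dgr M\<^esub> t) = f x \<triangleleft>\<^bsub>dgr N\<^esub> t))" (is "?l \<longleftrightarrow> ?r")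
    if K: "op_sub (dg_ops A) K (dgr M)" and L: "op_sub (dg_ops A) L (dgr N)" for K L
  proof
    note sM = dg_sub_props[OF M K] and sN = dg_sub_props[OF N L]
    assume ?l
    then obtain f where f: "bij_betw f K L" "\<And>x y. \<lbrakk>x \<in> K; y \<in> K\<rbrakk> \<Longrightarrow> f (x \<oplus>\<^bsub>M\<^esub> y) = f x \<oplus>\<^bsub>N\<^esub> f y"
      "\<And>x a. \<lbrakk>x \<in> K; a \<in> carrier A\<rbrakk> \<Longrightarrow> f (x \<triangleleft>\<^bsub>M\<^esub> a) = f x \<triangleleft>\<^bsub>N\<^esub> a"
      "\<And>x i. \<lbrakk>x \<in> K; x \<in> mcomp M i\<rbrakk> \<Longrightarrow> f x \<in> mcomp N i"
      "\<And>x. x \<in> K \<Longrightarrow> f (mdiff M x) = mdiff N (f x)"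
      unfolding dg_isomorphic_def dg_hom_def rmod_hom_def hom_def by (auto simp: dg_sub_def)
    have fL: "f x \<in> L" if "x \<in> K" for x using bij_betwE[OF f(1)] that by simp
    have "f (dcomp M i x) = dcomp N i (f x)" if x: "x \<in> K" for x i
    proof -
      have "dcomp (dg_sub N L) i (f x) =
          f (dcomp (dg_sub M K) (i - 0) x)"
        by (rule graded_group_map[OF dg_module_graded[OF sM(1)] dg_module_graded[OF sN(1)]])
          (use x f fL in \<open>auto simp: dg_sub_def\<close>)
      then show ?thesis using sM(2)[OF x] sN(2)[OF fL[OF x]] by simp
    qed
    then show ?r using f by (intro exI[of _ f]) (auto simp: dg_ops_def)
  next
    assume ?r
    then obtain f where f: "bij_betw f K L" "\<And>x y. \<lbrakk>x \<in> K; y \<in> K\<rbrakk> \<Longrightarrow> f (x \<oplus>\<^bsub>M\<^esub> y) = f x \<oplus>\<^bsub>N\<^esub> f y"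
      and t: "\<And>x t. \<lbrakk>x \<in> K; t \<in> dg_ops A\<rbrakk> \<Longrightarrow> f (x \<triangleleft>\<^bsub>dgr M\<^esub> t) = f x \<triangleleft>\<^bsub>dgr N\<^esub> t" by auto
    have fL: "f x \<in> L" if "x \<in> K" for x using bij_betwE[OF f(1)] that by simp
    have Lc: "y \<in> L \<Longrightarrow> y \<in> carrier N" for y using op_subD(1)[OF dg_module_op_group[OF N] L] by simp
    have "f (x \<triangleleft>\<^bsub>M\<^esub> a) = f x \<triangleleft>\<^bsub>N\<^esub> a" if "x \<in> K" "a \<in> carrier A" for x a
      using t[of x "Act a"] that by (simp add: dg_ops_def)
    moreover have "f (mdiff M x) = mdiff N (f x)" if "x \<in> K" for x
      using t[of x Diff] that by (simp add: dg_ops_def)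
    moreover have "f x \<in> mcomp N i" if "x \<in> K" "x \<in> mcomp M i" for x i
    proof -
      have "f x = dcomp N i (f x)"
        using t[of x "Comp i"] M.gm.hcomp_homog[OF that(2), of i] that(1) by (simp add: dg_ops_def)
      then show ?thesis using N.gm.hcomp_mem[OF Lc[OF fL[OF that(1)]], of i] by simp
    qed
    ultimately show ?l unfolding dg_isomorphic_def dg_hom_def rmod_hom_def hom_def
      using f fL by (intro bexI[of _ f]) (auto simp: dg_sub_def)
  qed
  show ?thesis
    unfolding op_common_iff[OF dg_module_op_group[OF M] dg_module_op_group[OF N]]
      dg_common_sub_def dg_submodule_iff_op_sub
  proof ((intro iffI; elim exE conjE), goal_cases)
    case (1 K L)
    then obtain f where "bij_betw f K L" "\<forall>x\<in>K. \<forall>y\<in>K. f (x \<oplus>\<^bsub>dgr M\<^esub> y) = f x \<oplus>\<^bsub>dgr N\<^esub> f y"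
      "\<forall>x\<in>K. \<forall>t\<in>dg_ops A. f (x \<triangleleft>\<^bsub>dgr M\<^esub> t) = f x \<triangleleft>\<^bsub>dgr N\<^esub> t" using sub[OF 1(1,3)] by blast
    then show ?case using 1 by (intro exI[of _ K] exI[of _ L] exI[of _ f]) simp
  next
    case (2 K L f)
    then have "dg_isomorphic A (dg_sub M K) (dg_sub N L)" using sub[OF 2(1,3)] by blast
    then show ?case using 2 by (intro exI[of _ K] exI[of _ L]) simp
  qed
qed

lemma dg_monoform_iff:
  fixes H :: "('a, 'm) dgmodule" and A :: "'a dgring"
  shows "dg_monoform A H \<longleftrightarrow> dg_module A H \<and> op_monoform (dg_ops A) (dgr H)"
proof (cases "dg_module A H")
  case True
  note q = dg_quot_props[OF True]
  have "op_monoform (dg_ops A) (dgr H) \<longleftrightarrow> carrier (dgr H) \<noteq> {\<zero>\<^bsub>dgr H\<^esub>} \<and>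
    (\<forall>L. op_sub (dg_ops A) L (dgr H) \<and> L \<noteq> {\<zero>\<^bsub>dgr H\<^esub>} \<longrightarrow> \<not> dg_common A H (dg_quot H L))"
    by (rule op_monoform_iff_quotients[OF dg_module_op_group[OF True]], erule q(2), erule q(3),
      unfold dgr_simps(1,2), erule q(4), erule q(5), erule q(6))
  then show ?thesis
    unfolding dg_monoform_def dg_submodule_iff_op_sub using dg_common_sub_iff[OF True q(1)] True
    by auto
qed (simp add: dg_monoform_def)

lemma dg_monoformD:
  "dg_monoform A H \<Longrightarrow> dg_module A H" "dg_monoform A H \<Longrightarrow> op_monoform (dg_ops A) (dgr H)"
  using dg_monoform_iff by blast+

lemma dg_atom_iff:
  assumes "dg_module A H"
  shows "X \<in> dg_atom A H \<longleftrightarrow> dg_monoform A X \<and> dg_common A X H"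
  unfolding dg_atom_def using dg_common_sub_iff[OF dg_monoformD(1) assms] by auto

lemma dg_atom_eqI:
  assumes "dg_monoform A H" "dg_monoform A H'" "dg_common A H H'"
  shows "dg_atom A H = dg_atom A H'"
proof (rule Set.set_eqI)
  note m = dg_monoformD[OF assms(1)] dg_monoformD[OF assms(2)]
  show "X \<in> dg_atom A H \<longleftrightarrow> X \<in> dg_atom A H'" for X
    unfolding dg_atom_iff[OF m(1)] dg_atom_iff[OF m(3)]
    using op_common_trans[OF _ assms(3) m(2)] op_common_trans[OF _ op_common_sym[OF assms(3)] m(4)]
    by metis
qed

lemma dg_copy:
  fixes M :: "('a, 'm) dgmodule" and A :: "'a dgring" and e :: "'m \<Rightarrow> 'u"
  assumes M: "dg_module A M" and e: "inj_on e (carrier M)"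
  shows "\<exists>N :: ('a, 'u) dgmodule. dg_module A N \<and> op_iso (dg_ops A) (dgr M) (dgr N)"
proof -
  interpret M: dg_module A M by fact
  note oM = dg_module_op_group[OF M]
  have sc: "op_sub (dg_ops A) (carrier M) (dgr M)" using op_sub_carrier[OF oM] by simp
  let ?i = "inv_into (carrier M) e"
  define N :: "('a, 'u) dgmodule" where
    "N = \<lparr>carrier = e ` carrier M, mult = undefined, one = undefined, zero = e \<zero>\<^bsub>M\<^esub>,
      add = (\<lambda>x y. e (?i x \<oplus>\<^bsub>M\<^esub> ?i y)), ract = (\<lambda>x a. e (?i x \<triangleleft>\<^bsub>M\<^esub> a)),
      mcomp = (\<lambda>i. e ` mcomp M i), mdiff = (\<lambda>x. e (mdiff M (?i x)))\<rparr>"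
  have a: "e ` carrier M = carrier N" "e \<zero>\<^bsub>M\<^esub> = \<zero>\<^bsub>N\<^esub>"
    "\<And>x y. \<lbrakk>x \<in> carrier M; y \<in> carrier M\<rbrakk> \<Longrightarrow> e (x \<oplus>\<^bsub>M\<^esub> y) = e x \<oplus>\<^bsub>N\<^esub> e y"
    "\<And>x a. \<lbrakk>x \<in> carrier M; a \<in> carrier A\<rbrakk> \<Longrightarrow> e (x \<triangleleft>\<^bsub>M\<^esub> a) = e x \<triangleleft>\<^bsub>N\<^esub> a"
    "\<And>x. x \<in> carrier M \<Longrightarrow> e (mdiff M x) = mdiff N (e x)"
    using e by (simp_all add: N_def)
  have b: "\<And>i. mcomp N i = e ` (mcomp M i \<inter> carrier M)"
    using M.gm.comp_carrier by (auto simp: N_def)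
  have z: "x = \<zero>\<^bsub>M\<^esub>" if "x \<in> carrier M" "e x = \<zero>\<^bsub>N\<^esub>" for x
    using that e a(2) unfolding inj_on_def by auto
  then have c: "\<And>x i. \<lbrakk>x \<in> carrier M; e x = \<zero>\<^bsub>N\<^esub>\<rbrakk> \<Longrightarrow> e (dcomp M i x) = \<zero>\<^bsub>N\<^esub>"
    using a(2) M.gm.hcomp_zero by metis
  note im = dg_module_image[OF M sc a b c]
  have "op_iso (dg_ops A) (dgr M) (dgr N)" unfolding op_iso_def
  proof (intro exI conjI)
    let ?G = "{(x, e x) | x. x \<in> carrier M}"
    show "dg_rel A M N ?G" by (rule im(3))
    show "single_val (dgr M) (dgr N) ?G" using a(2) by (auto simp: single_val_def)
    show "single_val (dgr N) (dgr M) (?G\<inverse>)" using z by (auto simp: single_val_def)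
    show "Domain ?G = carrier (dgr M)" by auto
    show "Range ?G = carrier (dgr N)" unfolding dgr_simps(1) a(1)[symmetric] by blast
  qed
  then show ?thesis using im(1) by blast
qed

text \<open>The domain of \<open>G\<close> modulo its kernel is a subquotient of \<open>M\<close>
  embedding in \<open>H\<close>; as a nonzero subobject of a monoform object it represents the same
  atom. \<open>H\<close> may live over any type, as is the case for \<open>D(H)\<close>.\<close>

lemma dg_SuppI:
  fixes M :: "('a, 'u) dgmodule" and H :: "('a, 'm) dgmodule" and A :: "'a dgring"
  assumes M: "dg_module A M" and H: "dg_monoform A H"
    and G: "dg_rel A M H G" "single_val (dgr M) (dgr H) G" "nonzero_rel (dgr H) G"
  shows "dg_atom A H \<in> dg_Supp A M"
proof -
  let ?K = "Domain G" and ?L = "{x. (x, \<zero>\<^bsub>H\<^esub>) \<in> G}"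
  have K: "op_sub (dg_ops A) ?K (dgr M)" and L: "op_sub (dg_ops A) ?L (dgr M)"
    using op_sub_Domain[OF G(1)] op_sub_kernel[OF G(1)] by simp_all
  have LK: "?L \<subseteq> ?K" by auto
  note s = dg_sub_props[OF M K]
  have L': "op_sub (dg_ops A) ?L (dgr (dg_sub M ?K))" using s(4) L LK by blast
  note q = dg_quot_props[OF s(1) L']
  let ?Q = "dg_quot (dg_sub M ?K) ?L"
  define P where "P = {(x, ?L +>\<^bsub>dg_sub M ?K\<^esub> x) | x. x \<in> carrier (dg_sub M ?K)}"
  note q = q[folded P_def]
  have c: "carrier (dg_sub M ?K) = ?K" by (simp add: dg_sub_def)
  have "Id_on ?K O P = P" unfolding P_def c by auto
  then have P: "dg_rel A M ?Q P" using op_rel_comp[OF s(3) q(2)] by simp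
  have sv: "single_val (dgr M) (dgr ?Q) P" using q(3) by (simp add: single_val_def dg_sub_def)
  have D: "Domain P = Domain G" "Range P = carrier (dgr ?Q)" using q(4,5) unfolding c by auto
  have k: "(x, \<zero>\<^bsub>dgr ?Q\<^esub>) \<in> P \<longleftrightarrow> (x, \<zero>\<^bsub>dgr H\<^esub>) \<in> G" for x using q(6)[of x] by simp
  note m = op_monoform_subquotient[OF dg_monoformD(2)[OF H] G P sv D k]
  have "dg_monoform A ?Q" using m(1) q(1) unfolding dg_monoform_iff by simp
  moreover from this have "dg_atom A ?Q = dg_atom A H" using dg_atom_eqI H m(2) by blast
  ultimately show ?thesis unfolding dg_Supp_def dg_submodule_iff_op_sub using K L LK by blast
qed

text \<open>As for right modules, coset representatives move the subquotient into the
  universe.\<close>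

lemma dg_SuppE:
  fixes M :: "('a, 'u) dgmodule" and \<alpha> :: "('a, 'u) dgmodule set" and A :: "'a dgring"
  assumes M: "dg_module A M" and \<alpha>: "\<alpha> \<in> dg_Supp A M"
  obtains Q :: "('a, 'u) dgmodule" and G where "dg_monoform A Q" "dg_rel A M Q G"
    "single_val (dgr M) (dgr Q) G" "Range G = carrier Q" "nonzero_rel (dgr Q) G" "\<alpha> = dg_atom A Q"
proof -
  obtain K L where K: "op_sub (dg_ops A) K (dgr M)" "op_sub (dg_ops A) L (dgr M)" "L \<subseteq> K"
    and m: "dg_monoform A (dg_quot (dg_sub M K) L)"
    and \<alpha>: "\<alpha> = dg_atom A (dg_quot (dg_sub M K) L)"
    using \<alpha> unfolding dg_Supp_def dg_submodule_iff_op_sub by blast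
  let ?Q = "dg_quot (dg_sub M K) L"
  note s = dg_sub_props[OF M K(1)]
  have L: "op_sub (dg_ops A) L (dgr (dg_sub M K))" using s(4) K by blast
  note q = dg_quot_props[OF s(1) L]
  define P where "P = {(x, L +>\<^bsub>dg_sub M K\<^esub> x) | x. x \<in> carrier (dg_sub M K)}"
  note q = q[folded P_def]
  have c: "carrier (dg_sub M K) = K" by (simp add: dg_sub_def)
  have "Id_on K O P = P" unfolding P_def c by auto
  then have P: "dg_rel A M ?Q P" using op_rel_comp[OF s(3) q(2)] by simp
  have sv: "single_val (dgr M) (dgr ?Q) P" using q(3) by (simp add: single_val_def dg_sub_def)
  note D = q(5)
  have "inj_on (\<lambda>X. SOME x. x \<in> X) (carrier ?Q)"
    using inj_on_some_rcosets[OF dg_module_op_group[OF s(1)] L] by (simp add: dg_quot_def)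
  from dg_copy[OF q(1) this] obtain N :: "('a, 'u) dgmodule"
    where N: "dg_module A N" "op_iso (dg_ops A) (dgr ?Q) (dgr N)" by blast
  have mN: "dg_monoform A N"
    using N(1) op_iso_monoform[OF op_iso_sym[OF N(2)]] m unfolding dg_monoform_iff by simp
  obtain F where F: "dg_rel A ?Q N F" "single_val (dgr ?Q) (dgr N) F"
    "Domain F = carrier ?Q" "Range F = carrier N"
    using N(2) unfolding op_iso_def dgr_simps by metis
  have r: "Range (P O F) = carrier N" using D F(3,4) by blast
  moreover have "nonzero_rel (dgr N) (P O F)"
    using op_monoform_Range[OF dg_monoformD(2)[OF mN] dg_module_op_group[OF N(1)]] r by simp
  moreover have "dg_common A ?Q N"
    using op_iso_common[OF N(2)] mN unfolding dg_monoform_def by simp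
  then have "\<alpha> = dg_atom A N" using \<alpha> dg_atom_eqI[OF m mN] by simp
  ultimately show ?thesis
    using that mN op_rel_comp[OF P F(1)] single_val_comp[OF sv F(2)] by blast
qed

section \<open>Non-positive dg rings\<close>

locale nonpos_dg = dg_ring A for A :: "'a dgring" (structure) +
  assumes nonpos: "nonpositive_dg A"
begin

abbreviation S :: "'a ring" where "S \<equiv> degree_zero_ring A"
abbreviation ac :: "int \<Rightarrow> 'a \<Rightarrow> 'a" where "ac i a \<equiv> hcomp A (rcomp A) i a"

sublocale grA: graded_group A "rcomp A"
  using dg_ring_graded dg_ring_axioms by blast

lemma rcomp_pos: "0 < i \<Longrightarrow> a \<in> rcomp A i \<Longrightarrow> a = \<zero>"
  using nonpos unfolding nonpositive_dg_def by blast

lemma ac_pos: "0 < i \<Longrightarrow> a \<in> carrier A \<Longrightarrow> ac i a = \<zero>"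
  using rcomp_pos grA.hcomp_mem by blast

lemma rdiff_closed [simp]: "a \<in> carrier A \<Longrightarrow> rdiff A a \<in> carrier A"
  using diff_hom unfolding hom_def by auto

lemma rdiff_add [simp]: "\<lbrakk>a \<in> carrier A; b \<in> carrier A\<rbrakk> \<Longrightarrow> rdiff A (a \<oplus> b) = rdiff A a \<oplus> rdiff A b"
  using diff_hom unfolding hom_def by auto

lemma rdiff_degree_zero: "a \<in> rcomp A 0 \<Longrightarrow> rdiff A a = \<zero>"
  using diff_comp[of a 0] rcomp_pos[of 1] by simp

lemma ac_rdiff: "a \<in> carrier A \<Longrightarrow> ac i (rdiff A a) = rdiff A (ac (i - 1) a)"
  using graded_group_map[OF grA.graded_group_axioms grA.graded_group_axioms, of "rdiff A" 1 a i]
    diff_comp by simp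

lemma ac_mult_homog:
  assumes "a \<in> carrier A" "b \<in> rcomp A j" shows "ac i (a \<otimes> b) = ac (i - j) a \<otimes> b"
  using graded_group_map[OF grA.graded_group_axioms grA.graded_group_axioms, of "\<lambda>a. a \<otimes> b" j a i]
    grA.comp_carrier assms mult_comp by (simp add: l_distr)

text \<open>Nonpositive degrees add up to \<open>0\<close> only as \<open>0 + 0\<close>, and to
  \<open>-1\<close> only as \<open>0 + (-1)\<close> or \<open>(-1) + 0\<close>.\<close>

lemma ac_mult:
  assumes a: "a \<in> carrier A" and b: "b \<in> carrier A"
  shows "ac 0 (a \<otimes> b) = ac 0 a \<otimes> ac 0 b" "ac (-1) (a \<otimes> b) = ac 0 a \<otimes> ac (-1) b \<oplus> ac (-1) a \<otimes> ac 0 b"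
proof -
  have "ac 0 (a \<otimes> b) = ac 0 a \<otimes> ac 0 b \<and> ac (-1) (a \<otimes> b) = ac 0 a \<otimes> ac (-1) b \<oplus> ac (-1) a \<otimes> ac 0 b"
    using b
  proof (induction rule: grA.graded_induct)
    case (homog j b)
    have bc: "b \<in> carrier A" using grA.comp_carrier homog .
    have ac: "ac i b = (if i = j then b else \<zero>)" for i using grA.hcomp_homog homog by simp
    consider "j = 0" | "j = -1" | "j < -1" | "j > 0" by linarith
    then show ?case
    proof cases
      case 3
      then have "ac (- 1 - j) a = \<zero>" "ac (- j) a = \<zero>" using ac_pos a by simp_all
      then show ?thesis using ac ac_mult_homog[OF a homog] bc a 3 by simp
    next
      case 4
      then have "b = \<zero>" using rcomp_pos homog by simp
      then show ?thesis using a by simp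
    qed (use ac ac_mult_homog[OF a homog] bc a ac_pos[of 1 a] in simp_all)
  next
    case (add y z)
    then show ?case using a by (simp add: r_distr a_ac)
  qed (use a in simp)
  then show "ac 0 (a \<otimes> b) = ac 0 a \<otimes> ac 0 b"
    "ac (-1) (a \<otimes> b) = ac 0 a \<otimes> ac (-1) b \<oplus> ac (-1) a \<otimes> ac 0 b" by auto
qed

text \<open>Leibniz, where the terms containing \<open>d\<close> of a degree \<open>0\<close>
  element vanish, and with them the only sign. This is what makes the action on \<open>D(N)\<close>
  associative in its mixed part.\<close>

lemma rdiff_ac_mult:
  assumes a: "a \<in> carrier A" and b: "b \<in> carrier A"
  shows "rdiff A (ac (-1) (a \<otimes> b)) = ac 0 a \<otimes> rdiff A (ac (-1) b) \<oplus> rdiff A (ac (-1) a) \<otimes> ac 0 b"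
proof -
  note m = grA.hcomp_mem[OF a] grA.hcomp_mem[OF b]
  have "rdiff A (ac 0 a \<otimes> ac (-1) b) = ac 0 a \<otimes> rdiff A (ac (-1) b)"
    using leibniz[OF m(1), of "ac (-1) b" 0] a b rdiff_degree_zero[OF m(1)] by (simp add: signed_def)
  moreover have "rdiff A (ac (-1) a \<otimes> ac 0 b) = rdiff A (ac (-1) a) \<otimes> ac 0 b"
    using leibniz[OF m(1), of "ac 0 b" "-1"] a b rdiff_degree_zero[OF m(2)] by (simp add: signed_def)
  ultimately show ?thesis using ac_mult(2)[OF a b] a b by simp
qed

lemma S_simps [simp]:
  "carrier S = rcomp A 0" "a \<otimes>\<^bsub>S\<^esub> b = a \<otimes> b" "a \<oplus>\<^bsub>S\<^esub> b = a \<oplus> b" "\<zero>\<^bsub>S\<^esub> = \<zero>" "\<one>\<^bsub>S\<^esub> = \<one>"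
  by (simp_all add: degree_zero_ring_def)

lemma rcomp0_carrier: "a \<in> rcomp A 0 \<Longrightarrow> a \<in> carrier A"
  using grA.comp_carrier .

lemma ring_S: "ring S"
proof (rule ringI)
  interpret Z: additive_subgroup "rcomp A 0" A by (rule grA.comp_subgroup)
  show "abelian_group S"
  proof (rule abelian_groupI)
    fix x assume "x \<in> carrier S"
    then show "\<exists>y\<in>carrier S. y \<oplus>\<^bsub>S\<^esub> x = \<zero>\<^bsub>S\<^esub>"
      by (intro bexI[of _ "\<ominus> x"]) (simp_all add: l_neg rcomp0_carrier)
  qed (simp_all add: a_ac rcomp0_carrier)
  show "monoid S"
    by (rule monoidI) (use mult_comp[of _ 0 _ 0] one_comp in \<open>simp_all add: m_assoc rcomp0_carrier\<close>)
qed (simp_all add: l_distr r_distr rcomp0_carrier)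

lemma ac_S: "a \<in> rcomp A 0 \<Longrightarrow> ac 0 a = a" "a \<in> rcomp A 0 \<Longrightarrow> ac (-1) a = \<zero>"
  by (simp_all add: grA.hcomp_homog)

lemma rdiff_ac_S [simp]: "a \<in> carrier A \<Longrightarrow> rdiff A (ac (-1) a) \<in> rcomp A 0"
  using diff_comp[of "ac (-1) a" "-1"] by simp

lemma right_module_S:
  fixes M :: "('a, 'm) dgmodule"
  assumes "dg_module A M" shows "right_module S (forget M)"
proof -
  interpret M: dg_module A M by fact
  have "right_module_axioms S (forget M)"
    unfolding right_module_axioms_def
    by (simp add: rcomp0_carrier M.ract_closed M.ract_add_left M.ract_add_right M.ract_assoc M.ract_one)
  then show ?thesis using ring_S M.M.abelian_group_axioms by (simp add: right_module_def)
qed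

text \<open>No element of \<open>A\<close> raises degrees, so the components of \<open>x a\<close>
  in degrees \<open>0\<close> and \<open>-1\<close> see only those of \<open>x\<close> in the same
  two degrees. This is the computation behind linearity of the canonical partial morphism.\<close>

lemma hcomp_ract_top:
  fixes M :: "('a, 'm) dgmodule"
  assumes M: "dg_module A M" and x: "x \<in> carrier M" "\<And>k. 0 < k \<Longrightarrow> dcomp M k x = \<zero>\<^bsub>M\<^esub>"
    and a: "a \<in> carrier A"
  shows "dcomp M 0 (x \<triangleleft>\<^bsub>M\<^esub> a) = dcomp M 0 x \<triangleleft>\<^bsub>M\<^esub> ac 0 a"
    "dcomp M (-1) (x \<triangleleft>\<^bsub>M\<^esub> a) =
      (dcomp M 0 x \<triangleleft>\<^bsub>M\<^esub> ac (-1) a) \<oplus>\<^bsub>M\<^esub> (dcomp M (-1) x \<triangleleft>\<^bsub>M\<^esub> ac 0 a)"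
    "0 < k \<Longrightarrow> dcomp M k (x \<triangleleft>\<^bsub>M\<^esub> a) = \<zero>\<^bsub>M\<^esub>"
proof -
  interpret M: dg_module A M by fact
  let ?p = "dcomp M"
  have "?p 0 (x \<triangleleft>\<^bsub>M\<^esub> a) = ?p 0 x \<triangleleft>\<^bsub>M\<^esub> ac 0 a \<and>
      ?p (-1) (x \<triangleleft>\<^bsub>M\<^esub> a) = (?p 0 x \<triangleleft>\<^bsub>M\<^esub> ac (-1) a) \<oplus>\<^bsub>M\<^esub> (?p (-1) x \<triangleleft>\<^bsub>M\<^esub> ac 0 a) \<and>
      (\<forall>k>0. ?p k (x \<triangleleft>\<^bsub>M\<^esub> a) = \<zero>\<^bsub>M\<^esub>)"
    using a
  proof (induction rule: grA.graded_induct)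
    case (homog j b)
    have bc: "b \<in> carrier A" using grA.comp_carrier homog .
    have ac: "ac i b = (if i = j then b else \<zero>)" for i using grA.hcomp_homog homog by simp
    note pr = M.hcomp_ract[OF x(1) homog]
    show ?case
    proof (cases "0 < j")
      case True
      then have "b = \<zero>" using rcomp_pos homog by simp
      then show ?thesis using x(1) by simp
    next
      case False
      have "\<forall>k>0. ?p k (x \<triangleleft>\<^bsub>M\<^esub> b) = \<zero>\<^bsub>M\<^esub>" using False pr x(2) bc by simp
      moreover have "?p 0 (x \<triangleleft>\<^bsub>M\<^esub> b) = ?p 0 x \<triangleleft>\<^bsub>M\<^esub> ac 0 b"
        using False pr[of 0] x ac bc by (cases "j = 0") simp_all
      moreover have "?p (-1) (x \<triangleleft>\<^bsub>M\<^esub> b) = (?p 0 x \<triangleleft>\<^bsub>M\<^esub> ac (-1) b) \<oplus>\<^bsub>M\<^esub> (?p (-1) x \<triangleleft>\<^bsub>M\<^esub> ac 0 b)"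
      proof -
        consider "j = 0" | "j = -1" | "j < -1" using False by linarith
        then show ?thesis using pr[of "-1"] x ac bc by cases (simp_all add: M.ract_closed)
      qed
      ultimately show ?thesis by blast
    qed
  next
    case (add y z)
    then show ?case using x(1) by (simp add: M.ract_add_right M.ract_closed M.M.a_ac)
  qed (use x in simp)
  then show "?p 0 (x \<triangleleft>\<^bsub>M\<^esub> a) = ?p 0 x \<triangleleft>\<^bsub>M\<^esub> ac 0 a"
    "?p (-1) (x \<triangleleft>\<^bsub>M\<^esub> a) = (?p 0 x \<triangleleft>\<^bsub>M\<^esub> ac (-1) a) \<oplus>\<^bsub>M\<^esub> (?p (-1) x \<triangleleft>\<^bsub>M\<^esub> ac 0 a)"
    "0 < k \<Longrightarrow> ?p k (x \<triangleleft>\<^bsub>M\<^esub> a) = \<zero>\<^bsub>M\<^esub>" by auto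
qed

subsection \<open>The dg module \<open>D(N)\<close>\<close>

lemma Dmod_simps [simp]:
  "carrier (Dmod A N) = carrier N \<times> carrier N" "\<zero>\<^bsub>Dmod A N\<^esub> = (\<zero>\<^bsub>N\<^esub>, \<zero>\<^bsub>N\<^esub>)"
  "(x, y) \<oplus>\<^bsub>Dmod A N\<^esub> (x', y') = (x \<oplus>\<^bsub>N\<^esub> x', y \<oplus>\<^bsub>N\<^esub> y')"
  "(x, y) \<triangleleft>\<^bsub>Dmod A N\<^esub> a = ((x \<triangleleft>\<^bsub>N\<^esub> ac 0 a) \<oplus>\<^bsub>N\<^esub> (y \<triangleleft>\<^bsub>N\<^esub> rdiff A (ac (-1) a)), y \<triangleleft>\<^bsub>N\<^esub> ac 0 a)"
  "mdiff (Dmod A N) (x, y) = (\<zero>\<^bsub>N\<^esub>, x)"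
  by (simp_all add: Dmod_def)

lemma Dmod_mcomp: "mcomp (Dmod A N) i = (if i = -1 then carrier N \<times> {\<zero>\<^bsub>N\<^esub>}
    else if i = 0 then {\<zero>\<^bsub>N\<^esub>} \<times> carrier N else {(\<zero>\<^bsub>N\<^esub>, \<zero>\<^bsub>N\<^esub>)})"
  by (simp add: Dmod_def)

lemma Dmod_props:
  fixes N :: "('a, 'n) rmodule"
  assumes N: "right_module S N"
  shows "dg_module A (Dmod A N)"
    "\<lbrakk>x \<in> carrier N; y \<in> carrier N\<rbrakk> \<Longrightarrow> dcomp (Dmod A N) i (x, y) =
      (if i = -1 then (x, \<zero>\<^bsub>N\<^esub>) else if i = 0 then (\<zero>\<^bsub>N\<^esub>, y) else (\<zero>\<^bsub>N\<^esub>, \<zero>\<^bsub>N\<^esub>))"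
proof -
  interpret N: right_module S N by fact
  interpret No: op_group "rcomp A 0" N using right_module_op_group[OF N] by simp
  let ?D = "Dmod A N"
  have nz [simp]: "x \<triangleleft>\<^bsub>N\<^esub> \<zero> = \<zero>\<^bsub>N\<^esub>" if "x \<in> carrier N" for x
    using N.ract_add_right[of x \<zero> \<zero>] N.ract_closed[of x \<zero>] that N.M.add.l_cancel_one by simp
  have cl [simp]: "x \<triangleleft>\<^bsub>N\<^esub> a \<in> carrier N" if "x \<in> carrier N" "a \<in> rcomp A 0" for x a
    using No.op_closed that by simp
  have ab: "abelian_group ?D"
  proof (rule abelian_groupI)
    fix p assume "p \<in> carrier ?D"
    then obtain x y where p: "p = (x, y)" "x \<in> carrier N" "y \<in> carrier N" by auto
    then show "\<exists>q\<in>carrier ?D. q \<oplus>\<^bsub>?D\<^esub> p = \<zero>\<^bsub>?D\<^esub>"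
      by (intro bexI[of _ "(\<ominus>\<^bsub>N\<^esub> x, \<ominus>\<^bsub>N\<^esub> y)"]) (simp_all add: N.M.l_neg)
  qed (auto simp: N.M.a_ac)
  interpret D: abelian_group ?D by fact
  define q where "q i = (\<lambda>(x, y). if i = -1 then (x, \<zero>\<^bsub>N\<^esub>) else if i = 0 then (\<zero>\<^bsub>N\<^esub>, y) else (\<zero>\<^bsub>N\<^esub>, \<zero>\<^bsub>N\<^esub>))"
    for i :: int
  have neg: "\<ominus>\<^bsub>?D\<^esub> (x, y) = (\<ominus>\<^bsub>N\<^esub> x, \<ominus>\<^bsub>N\<^esub> y)" if "x \<in> carrier N" "y \<in> carrier N" for x y
    by (rule D.minus_equality) (use that in \<open>simp_all add: N.M.l_neg\<close>)
  have sub: "additive_subgroup (mcomp ?D i) ?D" for i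
    by (rule D.additive_subgroup_minusI) (auto simp: Dmod_mcomp a_minus_def neg split: if_splits)
  have q1: "q i p \<in> mcomp ?D i" if "p \<in> carrier ?D" for i p
    using that by (auto simp: q_def Dmod_mcomp)
  have q2: "q i (p \<oplus>\<^bsub>?D\<^esub> p') = q i p \<oplus>\<^bsub>?D\<^esub> q i p'" if "p \<in> carrier ?D" "p' \<in> carrier ?D" for i p p'
    using that by (auto simp: q_def)
  have q3: "q j p = (if j = i then p else \<zero>\<^bsub>?D\<^esub>)" if "p \<in> mcomp ?D i" for i j p
    using that by (auto simp: q_def Dmod_mcomp split: if_splits)
  have q4: "finite {i. q i p \<noteq> \<zero>\<^bsub>?D\<^esub>}" for p
    by (rule finite_subset[of _ "{-1, 0}"]) (cases p, auto simp: q_def split: if_splits)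
  have q5: "p = \<zero>\<^bsub>?D\<^esub>" if "p \<in> carrier ?D" "\<And>i. q i p = \<zero>\<^bsub>?D\<^esub>" for p
    using that(2)[of "-1"] that(2)[of 0] by (cases p) (simp add: q_def)
  note gr = D.is_gradingI[OF sub q1 q2 q3 q4 q5]
  show "dcomp ?D i (x, y) =
      (if i = -1 then (x, \<zero>\<^bsub>N\<^esub>) else if i = 0 then (\<zero>\<^bsub>N\<^esub>, y) else (\<zero>\<^bsub>N\<^esub>, \<zero>\<^bsub>N\<^esub>))"
    if "x \<in> carrier N" "y \<in> carrier N" using gr(2)[of "(x, y)" i] that by (simp add: q_def)
  have m0: "ac 0 a \<in> rcomp A 0" if "a \<in> carrier A" for a using that by simp
  have madd: "x \<triangleleft>\<^bsub>N\<^esub> (a \<oplus> b) = (x \<triangleleft>\<^bsub>N\<^esub> a) \<oplus>\<^bsub>N\<^esub> (x \<triangleleft>\<^bsub>N\<^esub> b)"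
    if "x \<in> carrier N" "a \<in> rcomp A 0" "b \<in> rcomp A 0" for x a b
    using N.ract_add_right that by simp
  have mass: "x \<triangleleft>\<^bsub>N\<^esub> (a \<otimes> b) = (x \<triangleleft>\<^bsub>N\<^esub> a) \<triangleleft>\<^bsub>N\<^esub> b"
    if "x \<in> carrier N" "a \<in> rcomp A 0" "b \<in> rcomp A 0" for x a b
    using N.ract_assoc that by simp
  have mc: "a \<otimes> b \<in> rcomp A 0" if "a \<in> rcomp A 0" "b \<in> rcomp A 0" for a b
    using mult_comp[OF that] by simp
  have rm: "right_module A ?D"
  proof (intro right_module.intro right_module_axioms.intro)
    show "ring A" by (rule ring_axioms)
    fix p a b assume "p \<in> carrier ?D" and a: "a \<in> carrier A" and b: "b \<in> carrier A"
    then obtain x y where p: "p = (x, y)" "x \<in> carrier N" "y \<in> carrier N" by auto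
    show "p \<triangleleft>\<^bsub>?D\<^esub> (a \<oplus> b) = (p \<triangleleft>\<^bsub>?D\<^esub> a) \<oplus>\<^bsub>?D\<^esub> (p \<triangleleft>\<^bsub>?D\<^esub> b)"
      using p a b by (simp add: madd N.M.a_ac)
    show "p \<triangleleft>\<^bsub>?D\<^esub> (a \<otimes> b) = (p \<triangleleft>\<^bsub>?D\<^esub> a) \<triangleleft>\<^bsub>?D\<^esub> b"
      using p a b by (simp add: ac_mult(1) rdiff_ac_mult madd mass mc No.op_add N.M.a_ac)
  next
    fix p p' a assume "p \<in> carrier ?D" "p' \<in> carrier ?D" and a: "a \<in> carrier A"
    then obtain x y x' y' where p: "p = (x, y)" "x \<in> carrier N" "y \<in> carrier N"
      "p' = (x', y')" "x' \<in> carrier N" "y' \<in> carrier N" by auto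
    then show "(p \<oplus>\<^bsub>?D\<^esub> p') \<triangleleft>\<^bsub>?D\<^esub> a = (p \<triangleleft>\<^bsub>?D\<^esub> a) \<oplus>\<^bsub>?D\<^esub> (p' \<triangleleft>\<^bsub>?D\<^esub> a)"
      using a by (simp add: No.op_add N.M.a_ac)
  next
    fix p a assume "p \<in> carrier ?D" and a: "a \<in> carrier A"
    then show "p \<triangleleft>\<^bsub>?D\<^esub> a \<in> carrier ?D" by auto
  next
    fix p assume "p \<in> carrier ?D"
    then show "p \<triangleleft>\<^bsub>?D\<^esub> \<one> = p" using ac_S[OF one_comp] rdiff_degree_zero[of \<zero>] N.ract_one by auto
  qed fact
  show "dg_module A ?D"
  proof (intro dg_module.intro dg_module_axioms.intro)
    show "dg_ring A" by (rule dg_ring_axioms)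
    show "right_module A ?D" by (rule rm)
    show "is_grading ?D (mcomp ?D)" by (rule gr(1))
    fix p a i j assume p: "p \<in> mcomp ?D i" and a: "a \<in> rcomp A j"
    have ac: "ac k a = (if k = j then a else \<zero>)" for k using grA.hcomp_homog a by simp
    have r0: "rdiff A \<zero> = \<zero>" using rdiff_degree_zero by simp
    have ra: "j = -1 \<Longrightarrow> rdiff A a \<in> rcomp A 0" using diff_comp[OF a] by simp
    show "p \<triangleleft>\<^bsub>?D\<^esub> a \<in> mcomp ?D (i + j)"
      using p a by (cases p) (auto simp: Dmod_mcomp ac r0 ra split: if_splits)
  next
    show "mdiff ?D \<in> hom (add_monoid ?D) (add_monoid ?D)" by (rule homI) auto
  next
    fix p i assume "p \<in> mcomp ?D i"
    then show "mdiff ?D p \<in> mcomp ?D (i + 1)" by (cases p) (auto simp: Dmod_mcomp split: if_splits)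
  next
    fix p assume "p \<in> carrier ?D"
    then show "mdiff ?D (mdiff ?D p) = \<zero>\<^bsub>?D\<^esub>" by auto
  next
    fix p i a assume p: "p \<in> mcomp ?D i" and a: "a \<in> carrier A"
    \<comment> \<open>The two components of \<open>d a\<close> that act on \<open>D(N)\<close>: the
      one in degree \<open>0\<close> is \<open>d(a\<^sub>-\<^sub>1)\<close>, and the one in degree
      \<open>-1\<close> acts only through its differential, which is zero.\<close>
    have d: "ac 0 (rdiff A a) = rdiff A (ac (-1) a)" "rdiff A (ac (-1) (rdiff A a)) = \<zero>"
      using ac_rdiff[OF a] a diff_diff by simp_all
    obtain x y where xy: "p = (x, y)" "x \<in> carrier N" "y \<in> carrier N"
      using p by (cases p) (auto simp: Dmod_mcomp split: if_splits)
    show "mdiff ?D (p \<triangleleft>\<^bsub>?D\<^esub> a) = (mdiff ?D p \<triangleleft>\<^bsub>?D\<^esub> a) \<oplus>\<^bsub>?D\<^esub> signed ?D i (p \<triangleleft>\<^bsub>?D\<^esub> rdiff A a)"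
    proof (cases "i = -1")
      case True
      then have "y = \<zero>\<^bsub>N\<^esub>" using p xy by (simp add: Dmod_mcomp)
      \<comment> \<open>Acting on \<open>(0, x)\<close> produces the extra first entry
        \<open>x d(a\<^sub>-\<^sub>1)\<close>; the Leibniz term, which has a minus sign in degree
        \<open>-1\<close>, cancels it.\<close>
      then show ?thesis using xy a d True by (simp add: signed_def neg N.M.r_neg)
    next
      case False
      then have "x = \<zero>\<^bsub>N\<^esub>" "i \<noteq> 0 \<Longrightarrow> y = \<zero>\<^bsub>N\<^esub>" using p xy by (auto simp: Dmod_mcomp split: if_splits)
      then show ?thesis using xy a d False by (cases "i = 0") (auto simp: signed_def neg)
    qed
  qed
qed

lemma Dmod_minus:
  fixes N :: "('a, 'n) rmodule"
  assumes N: "right_module S N" and x: "x \<in> carrier N" "y \<in> carrier N" "x' \<in> carrier N" "y' \<in> carrier N"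
  shows "(x, y) \<ominus>\<^bsub>Dmod A N\<^esub> (x', y') = (x \<ominus>\<^bsub>N\<^esub> x', y \<ominus>\<^bsub>N\<^esub> y')"
proof -
  interpret N: right_module S N by fact
  interpret D: dg_module A "Dmod A N" using Dmod_props(1)[OF N] .
  have "\<ominus>\<^bsub>Dmod A N\<^esub> (x', y') = (\<ominus>\<^bsub>N\<^esub> x', \<ominus>\<^bsub>N\<^esub> y')"
    by (rule D.M.minus_equality) (use x in \<open>simp_all add: N.M.l_neg\<close>)
  then show ?thesis by (simp add: a_minus_def)
qed

lemma ract_zeros:
  fixes N :: "('a, 'n) rmodule"
  assumes N: "right_module S N"
  shows "x \<in> carrier N \<Longrightarrow> x \<triangleleft>\<^bsub>N\<^esub> \<zero> = \<zero>\<^bsub>N\<^esub>" "a \<in> rcomp A 0 \<Longrightarrow> \<zero>\<^bsub>N\<^esub> \<triangleleft>\<^bsub>N\<^esub> a = \<zero>\<^bsub>N\<^esub>"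
proof -
  interpret N: right_module S N by fact
  interpret No: op_group "rcomp A 0" N using right_module_op_group[OF N] by simp
  show "x \<in> carrier N \<Longrightarrow> x \<triangleleft>\<^bsub>N\<^esub> \<zero> = \<zero>\<^bsub>N\<^esub>"
    using N.ract_add_right[of x \<zero> \<zero>] N.ract_closed[of x \<zero>] N.M.add.l_cancel_one by simp
  show "a \<in> rcomp A 0 \<Longrightarrow> \<zero>\<^bsub>N\<^esub> \<triangleleft>\<^bsub>N\<^esub> a = \<zero>\<^bsub>N\<^esub>" by simp
qed

lemma Dmod_ract_S:
  fixes N :: "('a, 'n) rmodule"
  assumes N: "right_module S N" and x: "x \<in> carrier N" "y \<in> carrier N" and a: "a \<in> rcomp A 0"
  shows "(x, y) \<triangleleft>\<^bsub>Dmod A N\<^esub> a = (x \<triangleleft>\<^bsub>N\<^esub> a, y \<triangleleft>\<^bsub>N\<^esub> a)"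
proof -
  interpret N: right_module S N by fact
  have "x \<triangleleft>\<^bsub>N\<^esub> a \<in> carrier N" using N.ract_closed x(1) a by simp
  then show ?thesis using ac_S[OF a] rdiff_degree_zero[of \<zero>] ract_zeros(1)[OF N] x by simp
qed

lemma dg_rel_forget:
  fixes M :: "('a, 'm) dgmodule" and N :: "('a, 'n) dgmodule"
  assumes M: "dg_module A M" and N: "dg_module A N"
    and G: "dg_rel A M N G"
  shows "op_rel (carrier S) (forget M) (forget N) G"
proof (rule op_relI)
  show "op_group (carrier S) (forget M)" by (rule right_module_op_group[OF right_module_S[OF M]])
  show "op_group (carrier S) (forget N)" by (rule right_module_op_group[OF right_module_S[OF N]])
  show "(x \<triangleleft>\<^bsub>forget M\<^esub> a, y \<triangleleft>\<^bsub>forget N\<^esub> a) \<in> G" if "(x, y) \<in> G" "a \<in> carrier S" for x y a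
    using dg_relD(3)[OF G that(1), of a] rcomp0_carrier that(2) by simp
  show "(x \<ominus>\<^bsub>forget M\<^esub> x', y \<ominus>\<^bsub>forget N\<^esub> y') \<in> G" if "(x, y) \<in> G" "(x', y') \<in> G" for x y x' y'
    using op_relD(6)[OF G that] by simp
qed (use op_relD(3-5)[OF G] in auto)

text \<open>An element of \<open>A\<^sup>0\<close> acts on both entries separately, so over
  \<open>A\<^sup>0\<close> the inclusions of \<open>N\<close> in degrees \<open>0\<close> and
  \<open>-1\<close> and the projection to degree \<open>0\<close> are linear.\<close>

lemma Dmod_embeddings:
  fixes N :: "('a, 'n) rmodule"
  assumes N: "right_module S N"
  shows "op_rel (carrier S) N (forget (Dmod A N)) {(y, (\<zero>\<^bsub>N\<^esub>, y)) | y. y \<in> carrier N}"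
    "op_rel (carrier S) N (forget (Dmod A N)) {(x, (x, \<zero>\<^bsub>N\<^esub>)) | x. x \<in> carrier N}"
    "op_rel (carrier S) (forget (Dmod A N)) N {((x, y), y) | x y. x \<in> carrier N \<and> y \<in> carrier N}"
proof -
  interpret N: right_module S N by fact
  note oN = right_module_op_group[OF N]
  note oD = right_module_op_group[OF right_module_S[OF Dmod_props(1)[OF N]]]
  have c: "x \<triangleleft>\<^bsub>N\<^esub> a \<in> carrier N" if "x \<in> carrier N" "a \<in> rcomp A 0" for x a
    using N.ract_closed that by simp
  have z: "\<zero>\<^bsub>N\<^esub> \<ominus>\<^bsub>N\<^esub> \<zero>\<^bsub>N\<^esub> = \<zero>\<^bsub>N\<^esub>" by (simp add: a_minus_def)
  show "op_rel (carrier S) N (forget (Dmod A N)) {(y, (\<zero>\<^bsub>N\<^esub>, y)) | y. y \<in> carrier N}"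
    by (rule op_relI[OF oN oD]) (auto simp: Dmod_minus[OF N] Dmod_ract_S[OF N] c z ract_zeros[OF N]
      simp del: Dmod_simps(4))
  show "op_rel (carrier S) N (forget (Dmod A N)) {(x, (x, \<zero>\<^bsub>N\<^esub>)) | x. x \<in> carrier N}"
    by (rule op_relI[OF oN oD]) (auto simp: Dmod_minus[OF N] Dmod_ract_S[OF N] c z ract_zeros[OF N]
      simp del: Dmod_simps(4))
  show "op_rel (carrier S) (forget (Dmod A N)) N {((x, y), y) | x y. x \<in> carrier N \<and> y \<in> carrier N}"
    by (rule op_relI[OF oD oN]) (auto simp: Dmod_minus[OF N] Dmod_ract_S[OF N] c
      simp del: Dmod_simps(4))
qed

section \<open>Functoriality of \<open>D\<close> and monoform objects\<close>

text \<open>The functor \<open>D\<close> on partial morphisms: the same relation in both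
  degrees.\<close>

definition Drel :: "('m \<times> 'n) set \<Rightarrow> (('m \<times> 'm) \<times> ('n \<times> 'n)) set" where
  "Drel G = {((x, y), (x', y')) | x y x' y'. (x, x') \<in> G \<and> (y, y') \<in> G}"

lemma Drel_iff [simp]: "((x, y), (x', y')) \<in> Drel G \<longleftrightarrow> (x, x') \<in> G \<and> (y, y') \<in> G"
  by (simp add: Drel_def)

lemma Drel_props:
  fixes N :: "('a, 'n) rmodule" and N' :: "('a, 'm) rmodule"
  assumes N: "right_module S N" and N': "right_module S N'" and G: "op_rel (carrier S) N N' G"
  shows "dg_rel A (Dmod A N) (Dmod A N') (Drel G)"
    "single_val N N' G \<Longrightarrow> single_val (dgr (Dmod A N)) (dgr (Dmod A N')) (Drel G)"
    "single_val N' N (G\<inverse>) \<Longrightarrow> single_val (dgr (Dmod A N')) (dgr (Dmod A N)) ((Drel G)\<inverse>)"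
proof -
  note Gd = op_relD[OF G]
  have act: "(x \<triangleleft>\<^bsub>N\<^esub> a, y \<triangleleft>\<^bsub>N'\<^esub> a) \<in> G" if "(x, y) \<in> G" "a \<in> rcomp A 0" for x y a
    using Gd(9) that by simp
  show "dg_rel A (Dmod A N) (Dmod A N') (Drel G)"
  proof (rule dg_relI[OF Dmod_props(1)[OF N] Dmod_props(1)[OF N']])
    fix p q a assume "(p, q) \<in> Drel G" and a: "a \<in> carrier A"
    then obtain x y x' y' where p: "p = (x, y)" "q = (x', y')" "(x, x') \<in> G" "(y, y') \<in> G"
      by (auto simp: Drel_def)
    have "(x \<triangleleft>\<^bsub>N\<^esub> ac 0 a, x' \<triangleleft>\<^bsub>N'\<^esub> ac 0 a) \<in> G" "(y \<triangleleft>\<^bsub>N\<^esub> ac 0 a, y' \<triangleleft>\<^bsub>N'\<^esub> ac 0 a) \<in> G"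
      "(y \<triangleleft>\<^bsub>N\<^esub> rdiff A (ac (-1) a), y' \<triangleleft>\<^bsub>N'\<^esub> rdiff A (ac (-1) a)) \<in> G"
      using act p a by simp_all
    then show "(p \<triangleleft>\<^bsub>Dmod A N\<^esub> a, q \<triangleleft>\<^bsub>Dmod A N'\<^esub> a) \<in> Drel G" using p Gd(7) by simp
  next
    fix p q i assume "(p, q) \<in> Drel G"
    then obtain x y x' y' where p: "p = (x, y)" "q = (x', y')" "(x, x') \<in> G" "(y, y') \<in> G"
      by (auto simp: Drel_def)
    then show "(dcomp (Dmod A N) i p, dcomp (Dmod A N') i q) \<in> Drel G"
      using Gd(3-5) Dmod_props(2)[OF N] Dmod_props(2)[OF N'] by simp
  qed (use Gd(3-5,7) in \<open>auto simp: Drel_def\<close>)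
  show "single_val N N' G \<Longrightarrow> single_val (dgr (Dmod A N)) (dgr (Dmod A N')) (Drel G)"
    by (auto simp: single_val_def Drel_def)
  show "single_val N' N (G\<inverse>) \<Longrightarrow> single_val (dgr (Dmod A N')) (dgr (Dmod A N)) ((Drel G)\<inverse>)"
    by (auto simp: single_val_def Drel_def)
qed

lemma Dmod_common:
  fixes N :: "('a, 'n) rmodule" and N' :: "('a, 'm) rmodule"
  assumes N: "right_module S N" and N': "right_module S N'" and c: "op_common (carrier S) N N'"
  shows "dg_common A (Dmod A N) (Dmod A N')"
proof -
  obtain G where G: "op_rel (carrier S) N N' G" "single_val N N' G" "single_val N' N (G\<inverse>)" "nonzero_rel N' G"
    using c op_common_def by metis
  note D = Drel_props[OF N N' G(1)]
  obtain x y where "(x, y) \<in> G" "y \<noteq> \<zero>\<^bsub>N'\<^esub>" using G(4) nonzero_rel_def by metis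
  then have "((x, x), (y, y)) \<in> Drel G" "(y, y) \<noteq> \<zero>\<^bsub>dgr (Dmod A N')\<^esub>" by simp_all
  then have "nonzero_rel (dgr (Dmod A N')) (Drel G)" unfolding nonzero_rel_def by blast
  then show ?thesis using D(1) D(2)[OF G(2)] D(3)[OF G(3)] op_common_def by blast
qed

text \<open>A partial endomorphism \<open>G\<close> of \<open>D(H)\<close> is controlled by its
  restriction \<open>F\<close> to degree \<open>0\<close>, which is a partial endomorphism of
  \<open>H\<close>. Projecting shows that second entries are related by \<open>F\<close>; the
  differential moves first entries to second place and shows the same for them.\<close>

lemma Dmod_monoform:
  fixes H :: "('a, 'n) rmodule"
  assumes H: "rmod_monoform S H"
  shows "dg_monoform A (Dmod A H)"
proof -
  have rH: "right_module S H" and mH: "op_monoform (carrier S) H" using H rmod_monoform_iff by blast+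
  interpret H: right_module S H by fact
  let ?D = "Dmod A H" and ?J = "{(y, (\<zero>\<^bsub>H\<^esub>, y)) | y. y \<in> carrier H}"
  note dD = Dmod_props(1)[OF rH] and hD = Dmod_props(2)[OF rH]
  have J: "op_rel (carrier S) H (forget ?D) ?J" by (rule Dmod_embeddings(1)[OF rH])
  have "single_val (dgr ?D) (dgr ?D) (G\<inverse>)"
    if G: "dg_rel A ?D ?D G" and sv: "single_val (dgr ?D) (dgr ?D) G"
      and nz: "nonzero_rel (dgr ?D) G" for G
  proof -
    define F where "F = ?J O G O ?J\<inverse>"
    have F: "op_rel (carrier S) H H F" unfolding F_def
      by (rule op_rel_comp[OF J op_rel_comp[OF dg_rel_forget[OF dD dD G] op_rel_converse[OF J]]])
    have mem: "(y, y') \<in> F" if "((\<zero>\<^bsub>H\<^esub>, y), (\<zero>\<^bsub>H\<^esub>, y')) \<in> G" for y y'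
      using that op_relD(3,4)[OF G that] by (auto simp: F_def)
    have parts: "(y, y') \<in> F" "(x, x') \<in> F" if "((x, y), (x', y')) \<in> G" for x y x' y'
    proof -
      have c: "x \<in> carrier H" "y \<in> carrier H" "x' \<in> carrier H" "y' \<in> carrier H"
        using op_relD(3,4)[OF G that] by auto
      show "(y, y') \<in> F" by (rule mem) (use dg_relD(4)[OF G that, of 0] c hD in simp)
      show "(x, x') \<in> F" by (rule mem) (use dg_relD(5)[OF G that] in simp)
    qed
    have svF: "single_val H H F" using sv unfolding single_val_def F_def by auto
    obtain p q where "(p, q) \<in> G" "q \<noteq> \<zero>\<^bsub>dgr ?D\<^esub>" using nz nonzero_rel_def by metis
    then obtain x y x' y' where xy: "((x, y), (x', y')) \<in> G" "x' \<noteq> \<zero>\<^bsub>H\<^esub> \<or> y' \<noteq> \<zero>\<^bsub>H\<^esub>"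
      by (cases p, cases q) auto
    then have "nonzero_rel H F" using parts[OF xy(1)] xy(2) unfolding nonzero_rel_def by blast
    then have "single_val H H (F\<inverse>)" using mH F svF unfolding op_monoform_def by simp
    then have inj: "y = \<zero>\<^bsub>H\<^esub>" if "(y, \<zero>\<^bsub>H\<^esub>) \<in> F" for y using that unfolding single_val_def by blast
    show ?thesis unfolding single_val_def
    proof (intro allI impI)
      fix p assume "(\<zero>\<^bsub>dgr ?D\<^esub>, p) \<in> G\<inverse>"
      then obtain x y where "p = (x, y)" "((x, y), (\<zero>\<^bsub>H\<^esub>, \<zero>\<^bsub>H\<^esub>)) \<in> G" by (cases p) auto
      then show "p = \<zero>\<^bsub>dgr ?D\<^esub>" using parts inj by simp
    qed
  qed
  moreover have "carrier ?D \<noteq> {\<zero>\<^bsub>?D\<^esub>}"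
  proof
    assume "carrier ?D = {\<zero>\<^bsub>?D\<^esub>}"
    then have "carrier H \<times> carrier H = {(\<zero>\<^bsub>H\<^esub>, \<zero>\<^bsub>H\<^esub>)}" by simp
    then have "carrier H = {\<zero>\<^bsub>H\<^esub>}" using H.M.zero_closed by blast
    then show False using H unfolding rmod_monoform_def by simp
  qed
  ultimately have "op_monoform (dg_ops A) (dgr ?D)"
    unfolding op_monoform_def using dg_module_op_group[OF dD] by simp
  then show ?thesis using dD dg_monoform_iff by blast
qed

text \<open>Over \<open>A\<^sup>0\<close> the module \<open>D(H)\<close> is \<open>H \<oplus> H\<close>.\<close>
lemma forget_Dmod_rel:
  fixes H :: "('a, 'n) rmodule" and N :: "('a, 'm) rmodule"
  assumes H: "right_module S H"
    and G: "op_rel (carrier S) (forget (Dmod A H)) N G" "single_val (forget (Dmod A H)) N G" "nonzero_rel N G"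
  shows "\<exists>F. op_rel (carrier S) H N F \<and> single_val H N F \<and> nonzero_rel N F \<and>
    (single_val N (forget (Dmod A H)) (G\<inverse>) \<longrightarrow> single_val N H (F\<inverse>))"
proof -
  note J = Dmod_embeddings(2)[OF H] and P = Dmod_embeddings(3)[OF H]
  let ?J = "{(x, (x, \<zero>\<^bsub>H\<^esub>)) | x. x \<in> carrier H}"
    and ?P = "{((x, y), y) | x y. x \<in> carrier H \<and> y \<in> carrier H}"
  show ?thesis
  \<comment> \<open>Either \<open>G\<close> is nonzero on the copy of \<open>H\<close> in degree
    \<open>-1\<close> and is restricted to it, or it vanishes there and descends along the
    projection to degree \<open>0\<close>.\<close>
  proof (cases "\<exists>x n. ((x, \<zero>\<^bsub>H\<^esub>), n) \<in> G \<and> n \<noteq> \<zero>\<^bsub>N\<^esub>")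
    case True
    then obtain x n where xn: "((x, \<zero>\<^bsub>H\<^esub>), n) \<in> G" "n \<noteq> \<zero>\<^bsub>N\<^esub>" by blast
    then have "(x, n) \<in> ?J O G" using op_relD(3)[OF G(1) xn(1)] by auto
    then have "nonzero_rel N (?J O G)" using xn(2) unfolding nonzero_rel_def by blast
    moreover have "single_val H N (?J O G)"
      by (rule single_val_comp[OF _ G(2)]) (auto simp: single_val_def)
    moreover have "single_val N H ((?J O G)\<inverse>)" if "single_val N (forget (Dmod A H)) (G\<inverse>)"
      unfolding converse_relcomp by (rule single_val_comp[OF that]) (auto simp: single_val_def)
    ultimately show ?thesis using op_rel_comp[OF J G(1)] by blast
  next
    case False
    have "single_val H N (?P\<inverse> O G)" using False unfolding single_val_def by auto
    moreover have "single_val N H ((?P\<inverse> O G)\<inverse>)" if "single_val N (forget (Dmod A H)) (G\<inverse>)"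
      unfolding converse_relcomp by (rule single_val_comp[OF that]) (auto simp: single_val_def)
    moreover have "nonzero_rel N (?P\<inverse> O G)"
    proof -
      obtain p n where pn: "(p, n) \<in> G" "n \<noteq> \<zero>\<^bsub>N\<^esub>" using G(3) nonzero_rel_def by metis
      then have "(snd p, n) \<in> ?P\<inverse> O G" using op_relD(3)[OF G(1) pn(1)] by (cases p) auto
      then show ?thesis using pn(2) unfolding nonzero_rel_def by blast
    qed
    ultimately show ?thesis using op_rel_comp[OF op_rel_converse[OF P] G(1)] by blast
  qed
qed

lemma common_forget_Dmod:
  fixes H :: "('a, 'n) rmodule" and N :: "('a, 'm) rmodule"
  assumes H: "right_module S H" and c: "op_common (carrier S) (forget (Dmod A H)) N"
  shows "op_common (carrier S) H N"
proof -
  obtain G where G: "op_rel (carrier S) (forget (Dmod A H)) N G" "single_val (forget (Dmod A H)) N G"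
    "single_val N (forget (Dmod A H)) (G\<inverse>)" "nonzero_rel N G"
    using c op_common_def by metis
  from forget_Dmod_rel[OF H G(1,2,4)] G(3) show ?thesis unfolding op_common_def by blast
qed

text \<open>The partial morphism \<open>x \<mapsto> (d x\<^sub>-\<^sub>1, x\<^sub>0)\<close> from \<open>M\<close> to \<open>D(M)\<close>, defined on the dg submodule
  of those \<open>x\<close> that live in degrees at most \<open>0\<close> and whose degree \<open>0\<close> part is a cycle.\<close>
definition Erel :: "('a, 'm) dgmodule \<Rightarrow> ('m \<times> 'm \<times> 'm) set" where
  "Erel M = {(x, (mdiff M (dcomp M (-1) x), dcomp M 0 x)) | x. x \<in> carrier M \<and>
     (\<forall>k>0. dcomp M k x = \<zero>\<^bsub>M\<^esub>) \<and> mdiff M (dcomp M 0 x) = \<zero>\<^bsub>M\<^esub>}"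

text \<open>Linearity rests on \<open>d (x\<^sub>0 a) = x\<^sub>0 (d a)\<close> for \<open>a\<close>
  of degree \<open>-1\<close>, valid because \<open>x\<^sub>0\<close> is a cycle; compatibility with
  differentials uses that the degree \<open>-1\<close> part of \<open>d x\<close>, being a boundary,
  is sent to zero.\<close>

lemma Erel_props:
  fixes M :: "('a, 'm) dgmodule"
  assumes M: "dg_module A M"
  shows "dg_rel A M (Dmod A (forget M)) (Erel M)"
    "single_val (dgr M) (dgr (Dmod A (forget M))) (Erel M)"
    "\<lbrakk>x \<in> mcomp M 0; mdiff M x = \<zero>\<^bsub>M\<^esub>\<rbrakk> \<Longrightarrow> (x, (\<zero>\<^bsub>M\<^esub>, x)) \<in> Erel M"
proof -
  interpret M: dg_module A M by fact
  note N = right_module_S[OF M]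
  let ?p = "dcomp M" and ?D = "Dmod A (forget M)"
  show sv: "single_val (dgr M) (dgr ?D) (Erel M)" by (auto simp: single_val_def Erel_def)
  show "(x, (\<zero>\<^bsub>M\<^esub>, x)) \<in> Erel M" if "x \<in> mcomp M 0" "mdiff M x = \<zero>\<^bsub>M\<^esub>"
    using that M.gm.hcomp_homog[OF that(1)] M.gm.comp_carrier[OF that(1)] by (simp add: Erel_def)
  have EI: "(x, (u, v)) \<in> Erel M" if "x \<in> carrier M" "\<And>k. 0 < k \<Longrightarrow> ?p k x = \<zero>\<^bsub>M\<^esub>"
    "mdiff M (?p 0 x) = \<zero>\<^bsub>M\<^esub>" "u = mdiff M (?p (-1) x)" "v = ?p 0 x" for x u v
    using that by (simp add: Erel_def)
  show "dg_rel A M ?D (Erel M)"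
  proof (rule dg_relI[OF M Dmod_props(1)[OF N]])
    fix x q assume "(x, q) \<in> Erel M"
    then have x: "x \<in> carrier M" "\<And>k. 0 < k \<Longrightarrow> ?p k x = \<zero>\<^bsub>M\<^esub>" "mdiff M (?p 0 x) = \<zero>\<^bsub>M\<^esub>"
      and q: "q = (mdiff M (?p (-1) x), ?p 0 x)" by (auto simp: Erel_def)
    show "x \<in> carrier M \<and> q \<in> carrier ?D" using x q by simp
    have hD: "dcomp ?D i q = (if i = -1 then (mdiff M (?p (-1) x), \<zero>\<^bsub>M\<^esub>)
      else if i = 0 then (\<zero>\<^bsub>M\<^esub>, ?p 0 x) else (\<zero>\<^bsub>M\<^esub>, \<zero>\<^bsub>M\<^esub>))" for i
      using Dmod_props(2)[OF N, of "mdiff M (?p (-1) x)" "?p 0 x" i] x(1) q by simp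
    show "(?p i x, dcomp ?D i q) \<in> Erel M" for i
    proof -
      consider "i > 0" | "i = 0" | "i = -1" | "i < -1" by linarith
      then show ?thesis unfolding hD using x by cases (auto intro!: EI simp: M.gm.hcomp_hcomp)
    qed
    have "mdiff M (?p (-2) x) \<in> carrier M" using x by simp
    show "(mdiff M x, mdiff ?D q) \<in> Erel M" unfolding q Dmod_simps
    proof (rule EI)
      show "mdiff M x \<in> carrier M" using x by simp
      \<comment> \<open>In degree \<open>1\<close> this is \<open>d x\<^sub>0\<close>, zero because
        \<open>x\<^sub>0\<close> is a cycle; in higher degrees it comes from a vanishing component
        of \<open>x\<close>.\<close>
      show "?p k (mdiff M x) = \<zero>\<^bsub>M\<^esub>" if "0 < k" for k
        using M.hcomp_mdiff[OF x(1), of k] x(2)[of "k - 1"] x(3) that by (cases "k = 1") simp_all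
    qed (use x(1) in \<open>simp_all add: M.hcomp_mdiff M.mdiff_mdiff\<close>)
  next
    fix x q a assume "(x, q) \<in> Erel M" and a: "a \<in> carrier A"
    then have x: "x \<in> carrier M" "\<And>k. 0 < k \<Longrightarrow> ?p k x = \<zero>\<^bsub>M\<^esub>" "mdiff M (?p 0 x) = \<zero>\<^bsub>M\<^esub>"
      and q: "q = (mdiff M (?p (-1) x), ?p 0 x)" by (auto simp: Erel_def)
    note t = hcomp_ract_top[OF M x(1,2) a]
    have "mdiff M (?p 0 x \<triangleleft>\<^bsub>M\<^esub> ac (-1) a) = ?p 0 x \<triangleleft>\<^bsub>M\<^esub> rdiff A (ac (-1) a)"
      using M.mleibniz[of "?p 0 x" 0 "ac (-1) a"] x a by (simp add: signed_def M.ract_closed)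
    moreover have "mdiff M (?p (-1) x \<triangleleft>\<^bsub>M\<^esub> ac 0 a) = mdiff M (?p (-1) x) \<triangleleft>\<^bsub>M\<^esub> ac 0 a"
      using M.mleibniz[of "?p (-1) x" "-1" "ac 0 a"] x a rdiff_degree_zero[of "ac 0 a"]
      by (simp add: signed_def M.ract_closed)
    moreover have "mdiff M (?p 0 x \<triangleleft>\<^bsub>M\<^esub> ac 0 a) = \<zero>\<^bsub>M\<^esub>"
      using M.mleibniz[of "?p 0 x" 0 "ac 0 a"] x a rdiff_degree_zero[of "ac 0 a"]
      by (simp add: signed_def M.ract_closed)
    ultimately show "(x \<triangleleft>\<^bsub>M\<^esub> a, q \<triangleleft>\<^bsub>?D\<^esub> a) \<in> Erel M"
      unfolding q Dmod_simps
      by (intro EI) (use x a t in \<open>simp_all add: M.ract_closed M.M.a_ac\<close>)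
  next
    fix x q x' q' assume "(x, q) \<in> Erel M" "(x', q') \<in> Erel M"
    then have x: "x \<in> carrier M" "\<And>k. 0 < k \<Longrightarrow> ?p k x = \<zero>\<^bsub>M\<^esub>" "mdiff M (?p 0 x) = \<zero>\<^bsub>M\<^esub>"
      "x' \<in> carrier M" "\<And>k. 0 < k \<Longrightarrow> ?p k x' = \<zero>\<^bsub>M\<^esub>" "mdiff M (?p 0 x') = \<zero>\<^bsub>M\<^esub>"
      and q: "q = (mdiff M (?p (-1) x), ?p 0 x)" "q' = (mdiff M (?p (-1) x'), ?p 0 x')"
      by (auto simp: Erel_def)
    show "(x \<oplus>\<^bsub>M\<^esub> x', q \<oplus>\<^bsub>?D\<^esub> q') \<in> Erel M"
      unfolding q Dmod_simps by (intro EI) (use x in simp_all)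
  qed (auto intro!: EI)
qed

text \<open>The canonical morphism sends a cycle \<open>x\<close> of degree \<open>0\<close> to
  \<open>(0, x)\<close>, so a nonzero value of \<open>G\<close> survives as the second entry of an
  element of \<open>D(H)\<close>.\<close>

lemma cycles_rel:
  fixes M :: "('a, 'm) dgmodule" and H :: "('a, 'n) rmodule"
  assumes M: "dg_module A M" and rH: "right_module S H"
    and G: "op_rel (carrier S) (forget M) H G" "single_val (forget M) H G" "nonzero_rel H G"
    and Z: "\<And>x h. (x, h) \<in> G \<Longrightarrow> x \<in> mcomp M 0 \<and> mdiff M x = \<zero>\<^bsub>M\<^esub>"
  shows "\<exists>F. dg_rel A M (Dmod A H) F \<and> single_val (dgr M) (dgr (Dmod A H)) F \<and>
    nonzero_rel (dgr (Dmod A H)) F"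
proof (intro exI conjI)
  note E = Erel_props[OF M] and D = Drel_props[OF right_module_S[OF M] rH G(1)]
  show "dg_rel A M (Dmod A H) (Erel M O Drel G)" by (rule op_rel_comp[OF E(1) D(1)])
  show "single_val (dgr M) (dgr (Dmod A H)) (Erel M O Drel G)" by (rule single_val_comp[OF E(2) D(2)[OF G(2)]])
  obtain x h where xh: "(x, h) \<in> G" "h \<noteq> \<zero>\<^bsub>H\<^esub>" using G(3) nonzero_rel_def by metis
  have "(x, (\<zero>\<^bsub>M\<^esub>, x)) \<in> Erel M" using E(3) Z[OF xh(1)] by blast
  moreover have "((\<zero>\<^bsub>M\<^esub>, x), (\<zero>\<^bsub>H\<^esub>, h)) \<in> Drel G" using xh(1) op_relD(5)[OF G(1)] by simp
  ultimately have "(x, (\<zero>\<^bsub>H\<^esub>, h)) \<in> Erel M O Drel G" by blast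
  moreover have "(\<zero>\<^bsub>H\<^esub>, h) \<noteq> \<zero>\<^bsub>dgr (Dmod A H)\<^esub>" using xh(2) by simp
  ultimately show "nonzero_rel (dgr (Dmod A H)) (Erel M O Drel G)" unfolding nonzero_rel_def by blast
qed

end

section \<open>Shifts\<close>

lemma dg_shift_simps [simp]:
  "carrier (dg_shift n M) = carrier M" "\<zero>\<^bsub>dg_shift n M\<^esub> = \<zero>\<^bsub>M\<^esub>" "x \<oplus>\<^bsub>dg_shift n M\<^esub> y = x \<oplus>\<^bsub>M\<^esub> y"
  "x \<triangleleft>\<^bsub>dg_shift n M\<^esub> a = x \<triangleleft>\<^bsub>M\<^esub> a" "mcomp (dg_shift n M) i = mcomp M (i + n)"
  "mdiff (dg_shift n M) x = signed M n (mdiff M x)"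
  by (simp_all add: dg_shift_def)

lemma dg_shift_derived [simp]:
  "\<ominus>\<^bsub>dg_shift n M\<^esub> x = \<ominus>\<^bsub>M\<^esub> x" "x \<ominus>\<^bsub>dg_shift n M\<^esub> y = x \<ominus>\<^bsub>M\<^esub> y"
  "additive_subgroup L (dg_shift n M) \<longleftrightarrow> additive_subgroup L M"
  "abelian_group (dg_shift n M) \<longleftrightarrow> abelian_group M"
  by (intro same_group; simp add: dg_shift_def)+

lemma dg_shift_props:
  fixes M :: "('a, 'm) dgmodule" and A :: "'a dgring"
  assumes M: "dg_module A M"
  shows "dg_module A (dg_shift n M)"
    "x \<in> carrier M \<Longrightarrow> dcomp (dg_shift n M) i x = dcomp M (i + n) x"
proof -
  interpret M: dg_module A M by fact
  let ?T = "dg_shift n M" and ?p = "dcomp M"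
  have ab: "abelian_group ?T" using M.M.abelian_group_axioms by simp
  then interpret T: abelian_group ?T .
  have sub: "additive_subgroup (mcomp ?T i) ?T" for i using M.gm.comp_subgroup by simp
  have fin: "finite {i. ?p (i + n) x \<noteq> \<zero>\<^bsub>?T\<^esub>}" if "x \<in> carrier ?T" for x
  proof (rule finite_subset)
    show "{i. ?p (i + n) x \<noteq> \<zero>\<^bsub>?T\<^esub>} \<subseteq> (\<lambda>j. j - n) ` {j. ?p j x \<noteq> \<zero>\<^bsub>M\<^esub>}"
    proof
      fix i assume "i \<in> {i. ?p (i + n) x \<noteq> \<zero>\<^bsub>?T\<^esub>}"
      then show "i \<in> (\<lambda>j. j - n) ` {j. ?p j x \<noteq> \<zero>\<^bsub>M\<^esub>}" by (intro image_eqI[of _ _ "i + n"]) simp_all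
    qed
    show "finite ((\<lambda>j. j - n) ` {j. ?p j x \<noteq> \<zero>\<^bsub>M\<^esub>})" using M.gm.hcomp_finite that by simp
  qed
  have sep: "x = \<zero>\<^bsub>?T\<^esub>" if "x \<in> carrier ?T" "\<And>i. ?p (i + n) x = \<zero>\<^bsub>?T\<^esub>" for x
    using M.gm.zero_of_hcomp[of x] that(1) that(2)[of "_ - n"] by simp
  note gr = T.is_gradingI[of "mcomp ?T" "\<lambda>i x. ?p (i + n) x", OF sub _ _ _ fin sep]
  have gr1: "is_grading ?T (mcomp ?T)"
    by (rule gr(1)) (simp_all add: M.gm.hcomp_homog)
  show "x \<in> carrier M \<Longrightarrow> dcomp ?T i x = ?p (i + n) x"
    by (rule gr(2)) (simp_all add: M.gm.hcomp_homog)
  have negl: "(\<ominus>\<^bsub>M\<^esub> x) \<triangleleft>\<^bsub>M\<^esub> a = \<ominus>\<^bsub>M\<^esub> (x \<triangleleft>\<^bsub>M\<^esub> a)" if "x \<in> carrier M" "a \<in> carrier A" for x a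
    using M.ract_add_left[of "\<ominus>\<^bsub>M\<^esub> x" x a] that M.ract_closed
    by (simp add: M.M.l_neg M.M.minus_equality)
  have rm: "right_module A ?T"
    using M.right_module_axioms ab unfolding right_module_def right_module_axioms_def by simp
  have sg: "signed ?T i x = signed M i x" for i x by (simp add: signed_def)
  show "dg_module A ?T"
  proof (intro dg_module.intro dg_module_axioms.intro)
    show "dg_ring A" by (rule M.dg_ring_axioms)
    show "x \<triangleleft>\<^bsub>?T\<^esub> a \<in> mcomp ?T (i + j)" if "x \<in> mcomp ?T i" "a \<in> rcomp A j" for x a i j
      using M.ract_comp[of x "i + n" a j] that by (simp add: ac_simps)
    show "mdiff ?T \<in> hom (add_monoid ?T) (add_monoid ?T)"
      by (rule homI) (auto simp: signed_def M.M.minus_add)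
    show "mdiff ?T x \<in> mcomp ?T (i + 1)" if "x \<in> mcomp ?T i" for x i
      using M.mdiff_comp[of x "i + n"] that additive_subgroup.a_inv_closed[OF M.gm.comp_subgroup]
        M.M.abelian_group_axioms
      by (simp add: signed_def ac_simps)
    show "mdiff ?T (mdiff ?T x) = \<zero>\<^bsub>?T\<^esub>" if "x \<in> carrier ?T" for x
      using M.mdiff_mdiff that by (simp add: signed_def)
    show "mdiff ?T (x \<triangleleft>\<^bsub>?T\<^esub> a) = (mdiff ?T x \<triangleleft>\<^bsub>?T\<^esub> a) \<oplus>\<^bsub>?T\<^esub> signed ?T i (x \<triangleleft>\<^bsub>?T\<^esub> rdiff A a)"
      if x: "x \<in> mcomp ?T i" and a: "a \<in> carrier A" for x i a
    proof -
      \<comment> \<open>The Leibniz sign of \<open>M\<close> in degree \<open>i + n\<close>,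
        multiplied by the sign of the shifted differential, is the sign required in degree
        \<open>i\<close>.\<close>
      have "rdiff A a \<in> carrier A" using M.diff_hom a unfolding hom_def by auto
      then show ?thesis
        using M.mleibniz[of x "i + n" a] x a M.gm.comp_carrier[of x "i + n"]
        by (auto simp: sg signed_def negl M.ract_closed M.M.minus_add)
    qed
  qed (use rm gr1 in simp_all)
qed

lemma signed_simps [simp]:
  "even n \<Longrightarrow> signed M n x = x" "odd n \<Longrightarrow> signed M n x = \<ominus>\<^bsub>M\<^esub> x"
  by (simp_all add: signed_def)

lemma forget_shift [simp]: "forget (dg_shift n M) = forget M"
  by (simp add: forget_def rmodule.truncate_def dg_shift_def)

lemma single_val_shift [simp]:
  "single_val (dgr (dg_shift n M)) (dgr (dg_shift m N)) G \<longleftrightarrow> single_val (dgr M) (dgr N) G"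
  by (simp add: single_val_def)

lemma nonzero_rel_shift [simp]: "nonzero_rel (dgr (dg_shift n M)) G \<longleftrightarrow> nonzero_rel (dgr M) G"
  by (simp add: nonzero_rel_def)

text \<open>Shifting relabels the components and changes the differential at most by a sign.
  Relations are closed under negation, so the same sets of pairs qualify.\<close>

lemma dg_rel_shift_iff:
  fixes M :: "('a, 'm) dgmodule" and N :: "('a, 'n) dgmodule" and A :: "'a dgring"
  assumes M: "dg_module A M" and N: "dg_module A N"
  shows "dg_rel A (dg_shift n M) (dg_shift n N) G \<longleftrightarrow>
    dg_rel A M N G" (is "?l \<longleftrightarrow> ?r")
proof
  interpret M: dg_module A M by fact
  interpret N: dg_module A N by fact
  note sM = dg_shift_props[OF M] and sN = dg_shift_props[OF N]
  show ?l if G: ?r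
  proof (rule dg_relI[OF sM(1) sN(1)])
    fix x y assume xy: "(x, y) \<in> G"
    note c = dg_relD[OF G xy]
    show "(dcomp (dg_shift n M) i x, dcomp (dg_shift n N) i y) \<in> G"
      for i using c(1,2,4) by (simp add: sM(2) sN(2))
    show "(mdiff (dg_shift n M) x, mdiff (dg_shift n N) y) \<in> G"
      using c(5) op_relD(8)[OF G c(5)] by (cases "even n") simp_all
    show "(x \<triangleleft>\<^bsub>dg_shift n M\<^esub> a, y \<triangleleft>\<^bsub>dg_shift n N\<^esub> a) \<in> G" if "a \<in> carrier A" for a
      using c(3) that by simp
  qed (use op_relD(3-5,7)[OF G] in auto)
  show ?r if G: ?l
  proof (rule dg_relI[OF M N])
    fix x y assume xy: "(x, y) \<in> G"
    note c = dg_relD[OF G xy]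
    show "(dcomp M i x, dcomp N i y) \<in> G"
      for i using c(1,2) c(4)[of "i - n"] by (simp add: sM(2) sN(2))
    show "(mdiff M x, mdiff N y) \<in> G"
      using c(1,2,5) op_relD(8)[OF G c(5)] by (cases "even n") simp_all
    show "(x \<triangleleft>\<^bsub>M\<^esub> a, y \<triangleleft>\<^bsub>N\<^esub> a) \<in> G" if "a \<in> carrier A" for a
      using c(3)[OF that] by simp
  qed (use op_relD(3-5,7)[OF G] in auto)
qed

lemma dg_common_shift:
  fixes M :: "('a, 'm) dgmodule" and N :: "('a, 'n) dgmodule" and A :: "'a dgring"
  assumes "dg_module A M" "dg_module A N" "dg_common A M N"
  shows "dg_common A (dg_shift n M) (dg_shift n N)"
  using assms(3) unfolding op_common_def single_val_shift nonzero_rel_shift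
    dg_rel_shift_iff[OF assms(1,2)] .

lemma dg_monoform_shift:
  assumes "dg_monoform A H" shows "dg_monoform A (dg_shift n H)"
proof -
  note H = dg_monoformD[OF assms]
  show ?thesis
    using H(2) dg_shift_props(1)[OF H(1)] dg_module_op_group[OF dg_shift_props(1)[OF H(1)]]
    unfolding dg_monoform_iff op_monoform_def single_val_shift nonzero_rel_shift
      dg_rel_shift_iff[OF H(1) H(1)] by simp
qed

text \<open>Two odd signs cancel only on the carrier, so the iterated shift is compared with the
  single one through an identity relation and not as an equality of records.\<close>

lemma dg_shift_shift_rel:
  fixes M :: "('a, 'm) dgmodule" and A :: "'a dgring"
  assumes M: "dg_module A M"
  shows "dg_rel A (dg_shift n (dg_shift m M)) (dg_shift (m + n) M) (Id_on (carrier M))"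
    "dg_rel A (dg_shift 0 M) M (Id_on (carrier M))"
proof -
  interpret M: dg_module A M by fact
  note s = dg_shift_props[OF M]
  note ss = dg_shift_props[OF s(1)]
  show "dg_rel A (dg_shift n (dg_shift m M)) (dg_shift (m + n) M) (Id_on (carrier M))"
  proof (rule dg_relI[OF ss(1) s(1)])
    fix x y assume "(x, y) \<in> Id_on (carrier M)"
    then have x: "x \<in> carrier M" "y = x" by auto
    show "(dcomp (dg_shift n (dg_shift m M)) i x,
        dcomp (dg_shift (m + n) M) i y) \<in> Id_on (carrier M)" for i
      using x ss(2)[of x m n i] s(2)[of x m "i + n"] s(2)[of x "m + n" i] by (simp add: ac_simps Id_on_iff)
    show "(mdiff (dg_shift n (dg_shift m M)) x, mdiff (dg_shift (m + n) M) y) \<in> Id_on (carrier M)"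
      using x by (cases "even n"; cases "even m") (simp_all add: Id_on_iff)
  qed (auto simp: M.ract_closed)
  show "dg_rel A (dg_shift 0 M) M (Id_on (carrier M))"
    by (rule dg_relI[OF s(1) M]) (auto simp: M.ract_closed s(2))
qed

section \<open>Atoms and their orbits under shifts\<close>

lemma dg_common_Id:
  assumes M: "dg_monoform A M" and r: "dg_rel A M N (Id_on (carrier M))"
    and z: "\<zero>\<^bsub>M\<^esub> = \<zero>\<^bsub>N\<^esub>"
  shows "dg_common A M N"
proof -
  have "op_monoform (dg_ops A) (dgr M)" using dg_monoformD(2)[OF M] .
  then have "nonzero_rel (dgr M) (Id_on (carrier M))"
    using op_monoform_Range op_relD(1)[OF r] Range_Id_on dgr_simps(1) by metis
  then show ?thesis unfolding op_common_def using r z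
    by (intro exI[of _ "Id_on (carrier M)"]) (auto simp: single_val_def nonzero_rel_def)
qed

lemma dg_shift_shift_common:
  assumes "dg_monoform A M"
  shows "dg_common A (dg_shift n (dg_shift m M)) (dg_shift (m + n) M)"
    "dg_common A (dg_shift 0 M) M"
  using dg_common_Id[OF dg_monoform_shift[OF dg_monoform_shift[OF assms]], of n m "dg_shift (m + n) M"]
    dg_common_Id[OF dg_monoform_shift[OF assms], of 0 M] dg_shift_shift_rel[OF dg_monoformD(1)[OF assms]]
  by simp_all

text \<open>Several facts on atoms assume that the atom has a representative in the universe, because
  the class \<open>dg_atom\<close> of a module over another type could otherwise be empty.\<close>

lemma atom_shift_eq:
  assumes X: "dg_monoform A X" and ne: "(dg_atom A X :: ('a, 'u) dgmodule set) \<noteq> {}"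
  shows "atom_shift A n (dg_atom A X :: ('a, 'u) dgmodule set) = dg_atom A (dg_shift n X)"
proof -
  have "dg_atom A (dg_shift n X') = (dg_atom A (dg_shift n X) :: ('a, 'u) dgmodule set)"
    if "X' \<in> dg_atom A X" for X' :: "('a, 'u) dgmodule"
  proof -
    have X': "dg_monoform A X'" "dg_common A X' X"
      using that dg_atom_iff[OF dg_monoformD(1)[OF X]] by auto
    show ?thesis
      by (rule dg_atom_eqI[OF dg_monoform_shift[OF X'(1)] dg_monoform_shift[OF X]
          dg_common_shift[OF dg_monoformD(1)[OF X'(1)] dg_monoformD(1)[OF X] X'(2)]])
  qed
  then show ?thesis using ne unfolding atom_shift_def by (simp add: UN_constant cong: SUP_cong_simp)
qed

lemma dg_common_trans:
  assumes "dg_common A X Y" "dg_common A Y Z" "dg_monoform A Y"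
  shows "dg_common A X Z"
  using op_common_trans[OF assms(1,2) dg_monoformD(2)[OF assms(3)]] .

text \<open>If \<open>X\<close> and \<open>Y[n]\<close> share a subobject, so do \<open>X[m]\<close>
  and \<open>Y[n + m]\<close>; the two orbits are the same family with index moved by
  \<open>n\<close>.\<close>

lemma atom_orbit_eqI:
  assumes X: "dg_monoform A X" and neX: "(dg_atom A X :: ('a, 'u) dgmodule set) \<noteq> {}"
    and Y: "dg_monoform A Y" and neY: "(dg_atom A Y :: ('a, 'u) dgmodule set) \<noteq> {}"
    and c: "dg_common A X (dg_shift n Y)"
  shows "atom_orbit A (dg_atom A X :: ('a, 'u) dgmodule set) = atom_orbit A (dg_atom A Y)"
proof -
  note mX = dg_monoformD(1)[OF X] and mY = dg_monoformD(1)[OF Y]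
  have e: "dg_atom A (dg_shift m X) = (dg_atom A (dg_shift (n + m) Y) :: ('a, 'u) dgmodule set)" for m
  proof (rule dg_atom_eqI[OF dg_monoform_shift[OF X] dg_monoform_shift[OF Y]])
    show "dg_common A (dg_shift m X) (dg_shift (n + m) Y)"
      by (rule dg_common_trans[OF dg_common_shift[OF mX dg_shift_props(1)[OF mY] c]
            dg_shift_shift_common(1)[OF Y]])
        (intro dg_monoform_shift Y)
  qed
  have "(\<exists>m. \<beta> = dg_atom A (dg_shift m X)) \<longleftrightarrow> (\<exists>m. \<beta> = dg_atom A (dg_shift m Y))"
    for \<beta> :: "('a, 'u) dgmodule set"
  proof
    assume "\<exists>m. \<beta> = dg_atom A (dg_shift m Y)"
    then obtain m where m: "\<beta> = dg_atom A (dg_shift m Y)" by blast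
    have "\<beta> = dg_atom A (dg_shift (m - n) X)" using e[of "m - n"] m by simp
    then show "\<exists>m. \<beta> = dg_atom A (dg_shift m X)" by blast
  qed (use e in blast)
  then show ?thesis unfolding atom_orbit_def atom_shift_eq[OF X neX] atom_shift_eq[OF Y neY] by auto
qed

text \<open>\<open>X\<close> and \<open>Y\<close> may live over different types outside the
  universe; a representative of the shared atom, which exists by nonemptiness, links them by
  transitivity.\<close>

lemma dg_common_of_atom_eq:
  assumes X: "dg_monoform A X" and Y: "dg_monoform A Y"
    and ne: "(dg_atom A X :: ('a, 'u) dgmodule set) \<noteq> {}"
    and e: "(dg_atom A X :: ('a, 'u) dgmodule set) = dg_atom A Y"
  shows "dg_common A X Y"
proof -
  obtain X' :: "('a, 'u) dgmodule" where X': "X' \<in> dg_atom A X" using ne by blast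
  then have "X' \<in> dg_atom A Y" using e by simp
  with X' have "dg_monoform A X'" "dg_common A X' X" "dg_common A X' Y"
    using dg_atom_iff[OF dg_monoformD(1)[OF X]] dg_atom_iff[OF dg_monoformD(1)[OF Y]] by auto
  then show ?thesis using dg_common_trans op_common_sym by blast
qed

text \<open>The atom of \<open>X[0]\<close> is that of \<open>X\<close> and lies in the common
  orbit, so it is the atom of some \<open>Y[n]\<close>.\<close>

lemma dg_common_of_orbit_eq:
  assumes X: "dg_monoform A X" and neX: "(dg_atom A X :: ('a, 'u) dgmodule set) \<noteq> {}"
    and Y: "dg_monoform A Y" and neY: "(dg_atom A Y :: ('a, 'u) dgmodule set) \<noteq> {}"
    and e: "atom_orbit A (dg_atom A X :: ('a, 'u) dgmodule set) = atom_orbit A (dg_atom A Y)"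
  obtains n where "dg_common A X (dg_shift n Y)"
proof -
  have "dg_atom A (dg_shift 0 X) \<in> atom_orbit A (dg_atom A X :: ('a, 'u) dgmodule set)"
    unfolding atom_orbit_def atom_shift_eq[OF X neX] by blast
  then obtain n where "dg_atom A (dg_shift 0 X) = (dg_atom A (dg_shift n Y) :: ('a, 'u) dgmodule set)"
    unfolding e unfolding atom_orbit_def atom_shift_eq[OF Y neY] by blast
  moreover have "dg_atom A (dg_shift 0 X) = (dg_atom A X :: ('a, 'u) dgmodule set)"
    by (rule dg_atom_eqI[OF dg_monoform_shift[OF X] X dg_shift_shift_common(2)[OF X]])
  ultimately have "(dg_atom A X :: ('a, 'u) dgmodule set) = dg_atom A (dg_shift n Y)" by simp
  from dg_common_of_atom_eq[OF X dg_monoform_shift[OF Y] neX this] show thesis by (rule that)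
qed

lemma dg_atom_self: "dg_monoform A X \<Longrightarrow> X \<in> dg_atom A X"
  using dg_atom_iff[OF dg_monoformD(1)] op_common_refl[OF dg_monoformD(2)] by blast

lemma rmod_atom_self: "rmod_monoform R X \<Longrightarrow> X \<in> rmod_atom R X"
  using rmod_atom_iff op_common_refl unfolding rmod_monoform_iff by blast

lemma dg_atom_nonempty:
  fixes X :: "('a, 'm) dgmodule" and e :: "'m \<Rightarrow> 'u" and A :: "'a dgring"
  assumes X: "dg_monoform A X" and e: "inj_on e (carrier X)"
  shows "(dg_atom A X :: ('a, 'u) dgmodule set) \<noteq> {}"
proof -
  obtain N :: "('a, 'u) dgmodule" where N: "dg_module A N" "op_iso (dg_ops A) (dgr X) (dgr N)"
    using dg_copy[OF dg_monoformD(1)[OF X] e] by blast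
  note i = op_iso_sym[OF N(2)]
  have "dg_monoform A N"
    using N(1) op_iso_monoform[OF i dg_monoformD(2)[OF X]] dg_monoform_iff by blast
  moreover have "dg_common A N X"
    by (rule op_iso_common[OF i]) (use X in \<open>simp add: dg_monoform_def\<close>)
  ultimately show ?thesis using dg_atom_iff[OF dg_monoformD(1)[OF X]] by blast
qed

context nonpos_dg
begin

section \<open>Cycles\<close>

lemma op_sub_cycles:
  fixes M :: "('a, 'm) dgmodule"
  assumes M: "dg_module A M"
  shows "op_sub (carrier S) {x \<in> carrier M. mdiff M x = \<zero>\<^bsub>M\<^esub>} (forget M)"
    "op_sub (carrier S) {x \<in> mcomp M 0. mdiff M x = \<zero>\<^bsub>M\<^esub>} (forget M)"
    "op_rel (carrier S) (forget M) (forget M) {(x, mdiff M x) | x. x \<in> carrier M}"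
    "op_rel (carrier S) (forget M) (forget M) {(x, dcomp M i x) | x. x \<in> carrier M}"
proof -
  interpret M: dg_module A M by fact
  interpret Z: additive_subgroup "mcomp M 0" M by (rule M.gm.comp_subgroup)
  note oM = right_module_op_group[OF right_module_S[OF M]]
  have dm: "mdiff M (x \<ominus>\<^bsub>M\<^esub> y) = mdiff M x \<ominus>\<^bsub>M\<^esub> mdiff M y" if "x \<in> carrier M" "y \<in> carrier M" for x y
    using that by (simp add: a_minus_def)
  \<comment> \<open>Since \<open>d\<close> kills \<open>A\<^sup>0\<close>, the second Leibniz term
    vanishes: the differential is linear over \<open>A\<^sup>0\<close>, without any sign.\<close>
  have da: "mdiff M (x \<triangleleft>\<^bsub>M\<^esub> a) = mdiff M x \<triangleleft>\<^bsub>M\<^esub> a" if x: "x \<in> carrier M" and a: "a \<in> rcomp A 0" for x a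
    using x
  proof (induction rule: M.gm.graded_induct)
    case (homog i y)
    then show ?case using M.mleibniz[OF homog rcomp0_carrier[OF a]] rdiff_degree_zero[OF a]
        M.gm.comp_carrier[OF homog] M.ract_closed rcomp0_carrier[OF a] by (simp add: signed_def)
  qed (use rcomp0_carrier[OF a] in \<open>simp_all add: M.ract_add_left M.ract_closed\<close>)
  have z: "\<zero>\<^bsub>M\<^esub> \<ominus>\<^bsub>M\<^esub> \<zero>\<^bsub>M\<^esub> = \<zero>\<^bsub>M\<^esub>" by (simp add: a_minus_def)
  show "op_sub (carrier S) {x \<in> carrier M. mdiff M x = \<zero>\<^bsub>M\<^esub>} (forget M)"
    by (rule op_subI[OF oM]) (use M.M.zero_closed in \<open>auto simp: dm da z rcomp0_carrier M.ract_closed\<close>)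
  have c0: "x \<ominus>\<^bsub>M\<^esub> y \<in> mcomp M 0" if "x \<in> mcomp M 0" "y \<in> mcomp M 0" for x y
    using that by (simp add: a_minus_def)
  have a0: "x \<triangleleft>\<^bsub>M\<^esub> a \<in> mcomp M 0" if "x \<in> mcomp M 0" "a \<in> rcomp A 0" for x a
    using M.ract_comp[OF that] by simp
  show "op_sub (carrier S) {x \<in> mcomp M 0. mdiff M x = \<zero>\<^bsub>M\<^esub>} (forget M)"
    by (rule op_subI[OF oM])
      (use Z.zero_closed in \<open>auto simp: dm da z c0 a0 rcomp0_carrier M.ract_closed M.gm.comp_carrier
        intro!: exI[of _ "\<zero>\<^bsub>M\<^esub>"]\<close>)
  show "op_rel (carrier S) (forget M) (forget M) {(x, mdiff M x) | x. x \<in> carrier M}"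
    by (rule op_relI[OF oM oM]) (auto simp: dm da rcomp0_carrier M.ract_closed)
  show "op_rel (carrier S) (forget M) (forget M) {(x, dcomp M i x) | x. x \<in> carrier M}"
    by (rule op_relI[OF oM oM])
      (auto simp: rcomp0_carrier M.ract_closed M.hcomp_ract[of _ _ 0])
qed

lemma Id_on_rel:
  fixes M :: "('a, 'm) rmodule"
  assumes "right_module S M" "op_sub (carrier S) K M"
  shows "op_rel (carrier S) M (rmod_sub M K) (Id_on K)"
    "single_val M (rmod_sub M K) (Id_on K)" "single_val (rmod_sub M K) M ((Id_on K)\<inverse>)"
  using rmod_sub_props(2)[OF assms] by (auto simp: single_val_def rmod_sub_def)

text \<open>If the cycles of a monoform \<open>T\<close> start in degree \<open>0\<close>, then \<open>T\<close> contains the dg submodule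
  \<open>T\<^sup>-\<^sup>1 \<oplus> Z\<^sup>0(T)\<close>, which embeds into \<open>D(Z\<^sup>0(T))\<close>.\<close>
lemma lowest_cycles:
  fixes T :: "('a, 'm) dgmodule"
  assumes T: "dg_monoform A T"
    and nz: "z \<in> mcomp T 0" "mdiff T z = \<zero>\<^bsub>T\<^esub>" "z \<noteq> \<zero>\<^bsub>T\<^esub>"
    and low: "\<And>k x. \<lbrakk>k < 0; x \<in> mcomp T k; mdiff T x = \<zero>\<^bsub>T\<^esub>\<rbrakk> \<Longrightarrow> x = \<zero>\<^bsub>T\<^esub>"
  defines "H \<equiv> rmod_sub (forget T) {x \<in> mcomp T 0. mdiff T x = \<zero>\<^bsub>T\<^esub>}"
  shows "rmod_monoform S H" "dg_common A T (Dmod A H)"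
proof -
  have M: "dg_module A T" and mT: "op_monoform (dg_ops A) (dgr T)" using dg_monoformD[OF T] by auto
  interpret M: dg_module A T by fact
  let ?Z = "{x \<in> mcomp T 0. mdiff T x = \<zero>\<^bsub>T\<^esub>}" and ?p = "dcomp T"
  note rT = right_module_S[OF M]
  note Z = op_sub_cycles(2)[OF M]
  note I = Id_on_rel[OF rT Z, folded H_def]
  have rH: "right_module S H" unfolding H_def by (rule rmod_sub_props(1)[OF rT Z])
  have cH: "carrier H = ?Z" "\<zero>\<^bsub>H\<^esub> = \<zero>\<^bsub>T\<^esub>" by (simp_all add: H_def rmod_sub_def)
  note E = Erel_props[OF M] and D = Drel_props[OF rT rH I(1)]
  \<comment> \<open>An element of the kernel has \<open>x\<^sub>0 = 0\<close>, and its component of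
    degree \<open>-1\<close> is a cycle, which vanishes by \<open>low\<close>.\<close>
  have inj: "single_val (dgr (Dmod A (forget T))) (dgr T) ((Erel T)\<inverse>)"
    unfolding single_val_def
  proof (intro allI impI)
    fix x assume "(\<zero>\<^bsub>dgr (Dmod A (forget T))\<^esub>, x) \<in> (Erel T)\<inverse>"
    then have x: "x \<in> carrier T" "\<And>k. 0 < k \<Longrightarrow> ?p k x = \<zero>\<^bsub>T\<^esub>" "?p 0 x = \<zero>\<^bsub>T\<^esub>"
      "mdiff T (?p (-1) x) = \<zero>\<^bsub>T\<^esub>" by (auto simp: Erel_def)
    have m1: "?p (-1) x = \<zero>\<^bsub>T\<^esub>" using low[of "-1"] x(1,4) by simp
    have "?p k x = \<zero>\<^bsub>T\<^esub>" for k
    proof -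
      consider "k > 0" | "k = 0" | "k = -1" | "k < -1" by linarith
      then show ?thesis
      proof cases
        case 4
        \<comment> \<open>\<open>d x\<^sub>k\<close> is a cycle of degree \<open>k + 1 < 0\<close>,
          hence zero; so \<open>x\<^sub>k\<close> is itself a cycle of negative degree and vanishes
          too.\<close>
        have "mdiff T (mdiff T (?p k x)) = \<zero>\<^bsub>T\<^esub>" using M.mdiff_mdiff x(1) by simp
        then have "mdiff T (?p k x) = \<zero>\<^bsub>T\<^esub>"
          using low[of "k + 1" "mdiff T (?p k x)"] M.mdiff_comp[of "?p k x" k] x(1) 4 by simp
        then show ?thesis using low[of k "?p k x"] x(1) 4 by simp
      qed (use x m1 in auto)
    qed
    then show "x = \<zero>\<^bsub>dgr T\<^esub>" using M.gm.zero_of_hcomp[OF x(1)] by simp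
  qed
  define F where "F = Erel T O Drel (Id_on ?Z)"
  have F: "dg_rel A T (Dmod A H) F"
    unfolding F_def by (rule op_rel_comp[OF E(1) D(1)])
  have svF: "single_val (dgr T) (dgr (Dmod A H)) F"
    unfolding F_def by (rule single_val_comp[OF E(2) D(2)[OF I(2)]])
  have injF: "single_val (dgr (Dmod A H)) (dgr T) (F\<inverse>)"
    unfolding F_def converse_relcomp by (rule single_val_comp[OF D(3)[OF I(3)] inj])
  have memF: "(x, (\<zero>\<^bsub>H\<^esub>, x)) \<in> F" if "x \<in> ?Z" for x
  proof -
    have "(x, (\<zero>\<^bsub>T\<^esub>, x)) \<in> Erel T" using E(3) that by blast
    moreover have "((\<zero>\<^bsub>T\<^esub>, x), (\<zero>\<^bsub>H\<^esub>, x)) \<in> Drel (Id_on ?Z)" using that cH(2) by auto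
    ultimately show ?thesis unfolding F_def by blast
  qed
  have "(z, (\<zero>\<^bsub>H\<^esub>, z)) \<in> F" "(\<zero>\<^bsub>H\<^esub>, z) \<noteq> \<zero>\<^bsub>dgr (Dmod A H)\<^esub>" using memF nz cH(2) by auto
  then have "nonzero_rel (dgr (Dmod A H)) F" unfolding nonzero_rel_def by blast
  then show "dg_common A T (Dmod A H)"
    using F svF injF op_common_def by blast
  have "single_val H H (G\<inverse>)"
    if G: "op_rel (carrier S) H H G" "single_val H H G" "nonzero_rel H G" for G
  proof -
    \<comment> \<open>The embedding \<open>F\<close> of a dg submodule of \<open>T\<close> in
      \<open>D(H)\<close> turns \<open>D(G)\<close> into a partial endomorphism of \<open>T\<close>,
      which is injective as \<open>T\<close> is monoform. \<open>G\<close> is contained in it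
      through the degree \<open>0\<close> cycles.\<close>
    define P where "P = F O Drel G O F\<inverse>"
    note DG = Drel_props[OF rH rH G(1)]
    have P: "dg_rel A T T P" unfolding P_def
      by (rule op_rel_comp[OF F op_rel_comp[OF DG(1) op_rel_converse[OF F]]])
    have svP: "single_val (dgr T) (dgr T) P" unfolding P_def
      by (rule single_val_comp[OF svF single_val_comp[OF DG(2)[OF G(2)] injF]])
    have mem: "(h, h') \<in> P" if "(h, h') \<in> G" for h h'
    proof -
      have "h \<in> ?Z" "h' \<in> ?Z" using op_relD(3,4)[OF G(1) that] cH by auto
      moreover have "((\<zero>\<^bsub>H\<^esub>, h), (\<zero>\<^bsub>H\<^esub>, h')) \<in> Drel G" using that op_relD(5)[OF G(1)] by simp
      ultimately show ?thesis unfolding P_def using memF by blast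
    qed
    obtain h h' where "(h, h') \<in> G" "h' \<noteq> \<zero>\<^bsub>H\<^esub>" using G(3) nonzero_rel_def by metis
    then have "nonzero_rel (dgr T) P" unfolding nonzero_rel_def using mem cH(2) by auto
    then have "single_val (dgr T) (dgr T) (P\<inverse>)" using mT P svP unfolding op_monoform_def by simp
    then show ?thesis using mem cH(2) unfolding single_val_def by auto
  qed
  moreover have "carrier H \<noteq> {\<zero>\<^bsub>H\<^esub>}" using nz unfolding cH by auto
  ultimately have "op_monoform (carrier S) H"
    unfolding op_monoform_def using right_module_op_group[OF rH] by blast
  then show "rmod_monoform S H" using rH rmod_monoform_iff by blast
qed

section \<open>Extracting cycles from dg modules\<close>

text \<open>As \<open>z\<close> is a homogeneous cycle, \<open>d (z a)\<close> is
  \<open>z (d a)\<close> up to sign, and components of \<open>z a\<close> are \<open>z\<close> times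
  components of \<open>a\<close>. The submodule \<open>z A\<close> is therefore already closed under
  all operators.\<close>

lemma cyclic_op_sub:
  fixes X :: "('a, 'm) dgmodule"
  assumes X: "dg_module A X" and z: "z \<in> mcomp X i" "mdiff X z = \<zero>\<^bsub>X\<^esub>"
  shows "op_sub (dg_ops A) ((\<lambda>a. z \<triangleleft>\<^bsub>X\<^esub> a) ` carrier A) (dgr X)"
proof (rule op_subI[OF dg_module_op_group[OF X]])
  interpret X: dg_module A X by fact
  have zc: "z \<in> carrier X" using X.gm.comp_carrier z(1) .
  let ?W = "(\<lambda>a. z \<triangleleft>\<^bsub>X\<^esub> a) ` carrier A"
  show "?W \<subseteq> carrier (dgr X)" using zc by (auto simp: X.ract_closed)
  show "?W \<noteq> {}" using zero_closed by blast
  show "x \<ominus>\<^bsub>dgr X\<^esub> y \<in> ?W" if "x \<in> ?W" "y \<in> ?W" for x y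
  proof -
    obtain a b where ab: "a \<in> carrier A" "b \<in> carrier A" "x = z \<triangleleft>\<^bsub>X\<^esub> a" "y = z \<triangleleft>\<^bsub>X\<^esub> b" using \<open>x \<in> ?W\<close> \<open>y \<in> ?W\<close> by blast
    then have "x \<ominus>\<^bsub>dgr X\<^esub> y = z \<triangleleft>\<^bsub>X\<^esub> (a \<ominus> b)"
      using zc by (simp add: a_minus_def X.ract_add_right X.ract_neg_right)
    then show ?thesis using ab by simp
  qed
  fix x t assume "x \<in> ?W" and t: "t \<in> dg_ops A"
  then obtain a where a: "a \<in> carrier A" "x = z \<triangleleft>\<^bsub>X\<^esub> a" by blast
  consider b where "t = Act b" "b \<in> carrier A" | j where "t = Comp j" | "t = Diff"
    using t unfolding dg_ops_def by blast
  then show "x \<triangleleft>\<^bsub>dgr X\<^esub> t \<in> ?W"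
  proof cases
    case 1
    then have "x \<triangleleft>\<^bsub>dgr X\<^esub> t = z \<triangleleft>\<^bsub>X\<^esub> (a \<otimes> b)" using a zc by (simp add: X.ract_assoc)
    then show ?thesis using a 1 by simp
  next
    case 2
    have "dcomp X j (z \<triangleleft>\<^bsub>X\<^esub> a) = z \<triangleleft>\<^bsub>X\<^esub> ac (j - i) a"
      using graded_group_map[OF grA.graded_group_axioms X.gm.graded_group_axioms, of "\<lambda>a. z \<triangleleft>\<^bsub>X\<^esub> a" i a j]
        zc a X.ract_comp[OF z(1)] by (simp add: X.ract_closed X.ract_add_right add.commute)
    then show ?thesis using a 2 by simp
  next
    case 3
    have "mdiff X x = signed X i (z \<triangleleft>\<^bsub>X\<^esub> rdiff A a)"
      using X.mleibniz[OF z(1) a(1)] z(2) a zc by (auto simp: signed_def X.ract_closed)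
    also have "\<dots> = z \<triangleleft>\<^bsub>X\<^esub> (if even i then rdiff A a else \<ominus> rdiff A a)"
      using a zc by (simp add: signed_def X.ract_neg_right)
    finally show ?thesis using 3 a by (auto simp: image_iff)
  qed
qed

text \<open>Besides identifying the atom of \<open>X\<close>, the relation \<open>G\<close> exhibits
  \<open>H\<close> as a subquotient of \<open>X\<close> over \<open>A\<^sup>0\<close>. The
  comparison of supports needs this to find \<open>H\<close> inside a module of which
  \<open>X\<close> is a dg subquotient.\<close>

lemma monoform_from_cycles:
  fixes X :: "('a, 'm) dgmodule"
  assumes bd: "bounded_dg A" and X: "dg_monoform A X"
  obtains n and H :: "('a, 'm) rmodule" and G where "rmod_monoform S H"
    "dg_common A X (dg_shift n (Dmod A H))"
    "op_rel (carrier S) (forget X) H G" "single_val (forget X) H G" "nonzero_rel H G"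
proof -
  have M: "dg_module A X" and mX: "op_monoform (dg_ops A) (dgr X)" using dg_monoformD[OF X] by auto
  interpret X: dg_module A X by fact
  let ?p = "dcomp X"
  \<comment> \<open>A nonzero element has a nonzero component, which either is a cycle or has a
    nonzero differential, and the latter is a cycle.\<close>
  obtain z i where z: "z \<in> mcomp X i" "mdiff X z = \<zero>\<^bsub>X\<^esub>" "z \<noteq> \<zero>\<^bsub>X\<^esub>"
  proof -
    have "carrier X \<noteq> {\<zero>\<^bsub>X\<^esub>}" using X unfolding dg_monoform_def by simp
    then obtain x where x: "x \<in> carrier X" "x \<noteq> \<zero>\<^bsub>X\<^esub>" using X.M.zero_closed by blast
    then obtain j where j: "?p j x \<noteq> \<zero>\<^bsub>X\<^esub>" using X.gm.zero_of_hcomp by blast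
    show thesis
    proof (cases "mdiff X (?p j x) = \<zero>\<^bsub>X\<^esub>")
      case True
      then show thesis using that[of "?p j x" j] j x(1) by simp
    next
      case False
      then show thesis using that[of "mdiff X (?p j x)" "j + 1"] X.mdiff_comp[of "?p j x" j]
          X.mdiff_mdiff[of "?p j x"] x(1) by simp
    qed
  qed
  have zc: "z \<in> carrier X" using X.gm.comp_carrier z(1) .
  define W where "W = (\<lambda>a. z \<triangleleft>\<^bsub>X\<^esub> a) ` carrier A"
  have W: "op_sub (dg_ops A) W (dgr X)" unfolding W_def by (rule cyclic_op_sub[OF M z(1,2)])
  define Y where "Y = dg_sub X W"
  note s = dg_sub_props[OF M W, folded Y_def]
  have cY: "carrier Y = W" "\<zero>\<^bsub>Y\<^esub> = \<zero>\<^bsub>X\<^esub>" "mdiff Y = mdiff X" "mcomp Y i = mcomp X i \<inter> W" for i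
    by (simp_all add: Y_def dg_sub_def)
  have svI: "single_val (dgr X) (dgr Y) (Id_on W)" "single_val (dgr Y) (dgr X) ((Id_on W)\<inverse>)"
    using cY by (auto simp: single_val_def)
  have "z = z \<triangleleft>\<^bsub>X\<^esub> \<one>" using X.ract_one zc by simp
  then have zW: "z \<in> W" unfolding W_def using one_closed by blast
  have "nonzero_rel (dgr Y) (Id_on W)" using zW z(3) cY unfolding nonzero_rel_def by auto
  then have XY: "dg_common A X Y" unfolding op_common_def using s(3) svI by blast
  have "op_monoform (dg_ops A) (dgr Y)"
    by (rule op_monoform_pullback[OF mX op_rel_converse[OF s(3)]])
      (use svI cY zW z(3) in auto)
  then have Y: "dg_monoform A Y" using s(1) dg_monoform_iff by blast
  obtain N where N: "\<And>n. N < \<bar>n\<bar> \<Longrightarrow> rcomp A n = {\<zero>}" using bd unfolding bounded_dg_def by blast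
  \<comment> \<open>The part of \<open>z A\<close> in degree \<open>k\<close> is \<open>z\<close>
    times the component of \<open>A\<close> of degree \<open>k - i\<close>, zero far enough below
    \<open>i\<close>. The absolute value of \<open>N\<close> keeps the bound
    \<open>i - \<bar>N\<bar>\<close> at or below \<open>i\<close> even when \<open>N\<close> is
    negative.\<close>
  have low: "x = \<zero>\<^bsub>X\<^esub>" if x: "x \<in> W" "x \<in> mcomp X k" and k: "k - i < - \<bar>N\<bar>" for x k
  proof -
    obtain a where a: "a \<in> carrier A" "x = z \<triangleleft>\<^bsub>X\<^esub> a" using x(1) unfolding W_def by blast
    have "x = ?p k x" using X.gm.hcomp_homog[OF x(2)] by simp
    also have "\<dots> = z \<triangleleft>\<^bsub>X\<^esub> ac (k - i) a"
      using graded_group_map[OF grA.graded_group_axioms X.gm.graded_group_axioms, of "\<lambda>a. z \<triangleleft>\<^bsub>X\<^esub> a" i a k]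
        zc a X.ract_comp[OF z(1)] by (simp add: X.ract_closed X.ract_add_right add.commute)
    also have "ac (k - i) a = \<zero>" using N[of "k - i"] k grA.hcomp_mem[OF a(1), of "k - i"] by auto
    finally show ?thesis using zc by simp
  qed
  define J where "J k \<longleftrightarrow> (\<exists>x\<in>W. x \<in> mcomp X k \<and> mdiff X x = \<zero>\<^bsub>X\<^esub> \<and> x \<noteq> \<zero>\<^bsub>X\<^esub>)" for k
  \<comment> \<open>Degrees are counted by natural numbers from \<open>i - \<bar>N\<bar>\<close>
    upwards so that a least one exists; \<open>z\<close> itself is a cycle in degree
    \<open>i\<close>.\<close>
  have "\<exists>m. J (i - \<bar>N\<bar> + int m)"
  proof -
    have "J i" unfolding J_def using zW z by blast
    then show ?thesis using zW by (intro exI[of _ "nat \<bar>N\<bar>"]) simp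
  qed
  define m where "m = (LEAST m. J (i - \<bar>N\<bar> + int m))"
  define n where "n = i - \<bar>N\<bar> + int m"
  have Jn: "J n" unfolding n_def m_def using \<open>\<exists>m. J (i - \<bar>N\<bar> + int m)\<close> by (rule LeastI_ex)
  have Jlow: "\<not> J k" if "k < n" for k
  proof
    assume Jk: "J k"
    then have "\<not> k - i < - \<bar>N\<bar>" unfolding J_def using low by blast
    then have "k = i - \<bar>N\<bar> + int (nat (k - i + \<bar>N\<bar>))" by simp
    moreover have "nat (k - i + \<bar>N\<bar>) < m" using that \<open>\<not> k - i < - \<bar>N\<bar>\<close> unfolding n_def by linarith
    ultimately show False using Jk not_less_Least m_def by metis
  qed
  define T where "T = dg_shift n Y"
  have T: "dg_monoform A T" unfolding T_def by (rule dg_monoform_shift[OF Y])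
  have sg: "signed Y n x = \<zero>\<^bsub>X\<^esub> \<longleftrightarrow> x = \<zero>\<^bsub>X\<^esub>" if "x \<in> W" for x
  proof -
    interpret Y: dg_module A Y by (rule s(1))
    show ?thesis using that cY(1,2) by (cases "even n") (metis signed_simps(1), metis signed_simps(2) Y.M.minus_minus Y.M.minus_zero_zero)
  qed
  have dW: "mdiff X x \<in> W" if "x \<in> W" for x
    using op_subD(5)[OF dg_module_op_group[OF M] W that, of Diff] by (simp add: dg_ops_def)
  obtain y where y: "y \<in> W" "y \<in> mcomp X n" "mdiff X y = \<zero>\<^bsub>X\<^esub>" "y \<noteq> \<zero>\<^bsub>X\<^esub>" using Jn J_def by blast
  define H where "H = rmod_sub (forget T) {x \<in> mcomp T 0. mdiff T x = \<zero>\<^bsub>T\<^esub>}"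
  have y': "y \<in> mcomp T 0" "mdiff T y = \<zero>\<^bsub>T\<^esub>" "y \<noteq> \<zero>\<^bsub>T\<^esub>"
    using y sg[of "\<zero>\<^bsub>X\<^esub>"] dW[OF y(1)] cY by (simp_all add: T_def)
  have low': "x = \<zero>\<^bsub>T\<^esub>" if "k < 0" "x \<in> mcomp T k" "mdiff T x = \<zero>\<^bsub>T\<^esub>" for k x
    using that sg[OF dW] Jlow[of "k + n"] cY unfolding J_def by (auto simp: T_def)
  have L: "rmod_monoform S H" "dg_common A T (Dmod A H)"
    unfolding H_def by (rule lowest_cycles(1)[OF T y'], erule (2) low') (rule lowest_cycles(2)[OF T y'], erule (2) low')
  have dT: "dg_module A T" using dg_monoformD(1)[OF T] .
  have dD: "dg_module A (Dmod A H)" by (rule dg_monoformD(1)[OF Dmod_monoform[OF L(1)]])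
  \<comment> \<open>Shifting by \<open>-n\<close> undoes the passage from \<open>Y\<close> to
    \<open>T\<close>, so \<open>X\<close>, \<open>Y\<close> and \<open>D(H)[-n]\<close> are
    atom-equivalent.\<close>
  have c1: "dg_common A (dg_shift (-n) T) (dg_shift (-n) (Dmod A H))"
    by (rule dg_common_shift[OF dT dD L(2)])
  have "dg_common A (dg_shift (-n) T) (dg_shift 0 Y)"
    using dg_shift_shift_common(1)[OF Y, of "-n" n] by (simp add: T_def)
  then have c2: "dg_common A (dg_shift (-n) T) Y"
    by (rule dg_common_trans[OF _ dg_shift_shift_common(2)[OF Y] dg_monoform_shift[OF Y]])
  have "dg_common A Y (dg_shift (-n) (Dmod A H))"
    by (rule dg_common_trans[OF op_common_sym[OF c2] c1 dg_monoform_shift[OF T]])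
  then have c3: "dg_common A X (dg_shift (-n) (Dmod A H))"
    by (rule dg_common_trans[OF XY _ Y])
  let ?Z = "{x \<in> mcomp T 0. mdiff T x = \<zero>\<^bsub>T\<^esub>}"
  note I = Id_on_rel[OF right_module_S[OF dT] op_sub_cycles(2)[OF dT], folded H_def]
  \<comment> \<open>Over \<open>A\<^sup>0\<close> the shift is forgotten, so the degree
    \<open>0\<close> cycles of \<open>T\<close> form a submodule of \<open>X\<close>.\<close>
  have fT: "forget T = forget Y" by (simp add: T_def)
  have r: "op_rel (carrier S) (forget X) H (Id_on W O Id_on ?Z)"
    by (rule op_rel_comp[OF _ I(1)]) (simp only: fT, rule dg_rel_forget[OF M s(1,3)])
  have "single_val (forget X) H (Id_on W O Id_on ?Z)"
    by (rule single_val_comp[OF _ I(2)]) (auto simp: single_val_def cY fT)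
  moreover have "nonzero_rel H (Id_on W O Id_on ?Z)"
  proof -
    have "(y, y) \<in> Id_on W O Id_on ?Z" using y(1) y' by blast
    moreover have "y \<noteq> \<zero>\<^bsub>H\<^esub>" using y'(3) by (simp add: H_def rmod_sub_def)
    ultimately show ?thesis unfolding nonzero_rel_def by blast
  qed
  ultimately show thesis using that[OF L(1) c3 r] by blast
qed

text \<open>A partial morphism \<open>M \<rightarrow> H\<close> over \<open>A\<^sup>0\<close> can be moved to the cycles of a single degree: either it
  is nonzero on the cycles, or it factors through the differential; then restrict it to the submodule
  generated by an element with as few components as possible and not mapped to zero.\<close>
lemma homogeneous_cycle_rel:
  fixes M :: "('a, 'm) dgmodule" and H :: "('a, 'n) rmodule"
  assumes M: "dg_module A M"
    and G: "op_rel (carrier S) (forget M) H G" "single_val (forget M) H G" "nonzero_rel H G"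
  obtains n F where "op_rel (carrier S) (forget M) H F" "single_val (forget M) H F" "nonzero_rel H F"
    "\<And>x h. (x, h) \<in> F \<Longrightarrow> x \<in> mcomp M n \<and> mdiff M x = \<zero>\<^bsub>M\<^esub>"
proof -
  interpret M: dg_module A M by fact
  let ?p = "dcomp M"
  note oM = op_relD(1)[OF G(1)] and oH = op_relD(2)[OF G(1)]
  interpret oH: op_group "carrier S" H by (rule oH)
  obtain F where F: "op_rel (carrier S) (forget M) H F" "single_val (forget M) H F" "nonzero_rel H F"
    and FZ: "\<And>x h. (x, h) \<in> F \<Longrightarrow> mdiff M x = \<zero>\<^bsub>M\<^esub>"
  proof (cases "\<exists>x h. (x, h) \<in> G \<and> mdiff M x = \<zero>\<^bsub>M\<^esub> \<and> h \<noteq> \<zero>\<^bsub>H\<^esub>")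
    case True
    then obtain x h where xh: "(x, h) \<in> G" "mdiff M x = \<zero>\<^bsub>M\<^esub>" "h \<noteq> \<zero>\<^bsub>H\<^esub>" by blast
    let ?F = "G \<inter> {x \<in> carrier M. mdiff M x = \<zero>\<^bsub>M\<^esub>} \<times> carrier H"
    have "op_rel (carrier S) (forget M) H ?F"
      by (rule op_rel_restrict[OF G(1) op_sub_cycles(1)[OF M] op_sub_carrier[OF oH]])
    moreover have "single_val (forget M) H ?F" using G(2) by (simp add: single_val_def)
    moreover have "(x, h) \<in> ?F" using xh op_relD(3,4)[OF G(1) xh(1)] by simp
    then have "nonzero_rel H ?F" using xh(3) unfolding nonzero_rel_def by blast
    ultimately show thesis by (rule that) blast
  next
    case False
    let ?d = "{(x, mdiff M x) | x. x \<in> carrier M}"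
    have "op_rel (carrier S) (forget M) H (?d\<inverse> O G)"
      by (rule op_rel_comp[OF op_rel_converse[OF op_sub_cycles(3)[OF M]] G(1)])
    \<comment> \<open>Two preimages of a boundary differ by a cycle, on which \<open>G\<close> is
      zero in this case; boundaries are themselves cycles, so the new domain is as required.\<close>
    moreover have "single_val (forget M) H (?d\<inverse> O G)" using False by (auto simp: single_val_def)
    moreover have "nonzero_rel H (?d\<inverse> O G)"
    proof -
      obtain x h where xh: "(x, h) \<in> G" "h \<noteq> \<zero>\<^bsub>H\<^esub>" using G(3) nonzero_rel_def by metis
      then have "(mdiff M x, h) \<in> ?d\<inverse> O G" using op_relD(3)[OF G(1) xh(1)] by auto
      then show ?thesis using xh(2) unfolding nonzero_rel_def by blast
    qed
    ultimately show thesis by (rule that) (auto simp: M.mdiff_mdiff)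
  qed
  define c where "c x = card {i. ?p i x \<noteq> \<zero>\<^bsub>M\<^esub>}" for x
  define Q where "Q q \<longleftrightarrow> q \<in> F \<and> snd q \<noteq> \<zero>\<^bsub>H\<^esub>" for q
  have "\<exists>q. Q q" using F(3) unfolding Q_def nonzero_rel_def by auto
  then obtain q where q: "Q q" "\<And>q'. Q q' \<Longrightarrow> c (fst q) \<le> c (fst q')"
    using ex_has_least_nat[of Q _ "\<lambda>q. c (fst q)"] by metis
  obtain x h where xh: "q = (x, h)" by (cases q)
  have x: "(x, h) \<in> F" "h \<noteq> \<zero>\<^bsub>H\<^esub>" and min: "\<And>x' h'. \<lbrakk>(x', h') \<in> F; h' \<noteq> \<zero>\<^bsub>H\<^esub>\<rbrakk> \<Longrightarrow> c x \<le> c x'"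
    using q(1) q(2) unfolding Q_def xh by auto
  have xc: "x \<in> carrier M" using op_relD(3)[OF F(1) x(1)] by simp
  have "x \<noteq> \<zero>\<^bsub>M\<^esub>" using x F(2) by (auto simp: single_val_def)
  then obtain n where n: "?p n x \<noteq> \<zero>\<^bsub>M\<^esub>" using M.gm.zero_of_hcomp[OF xc] by blast
  let ?K = "(\<lambda>a. x \<triangleleft>\<^bsub>M\<^esub> a) ` rcomp A 0"
  interpret Z: additive_subgroup "rcomp A 0" A by (rule grA.comp_subgroup)
  have K: "op_sub (carrier S) ?K (forget M)"
  proof (rule op_subI[OF oM])
    show "?K \<subseteq> carrier (forget M)" using xc rcomp0_carrier by (auto simp: M.ract_closed)
    show "?K \<noteq> {}" using one_comp by blast
    show "u \<ominus>\<^bsub>forget M\<^esub> v \<in> ?K" if "u \<in> ?K" "v \<in> ?K" for u v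
    proof -
      obtain a b where ab: "a \<in> rcomp A 0" "b \<in> rcomp A 0" "u = x \<triangleleft>\<^bsub>M\<^esub> a" "v = x \<triangleleft>\<^bsub>M\<^esub> b"
        using \<open>u \<in> ?K\<close> \<open>v \<in> ?K\<close> by blast
      then have "u \<ominus>\<^bsub>forget M\<^esub> v = x \<triangleleft>\<^bsub>M\<^esub> (a \<ominus> b)"
        using xc rcomp0_carrier
        by (simp add: a_minus_def[of M] a_minus_def[of A] M.ract_add_right M.ract_neg_right)
      moreover have "a \<ominus> b \<in> rcomp A 0" using ab by (simp add: a_minus_def)
      ultimately show ?thesis by blast
    qed
    show "u \<triangleleft>\<^bsub>forget M\<^esub> b \<in> ?K" if "u \<in> ?K" "b \<in> carrier S" for u b
    proof -
      obtain a where a: "a \<in> rcomp A 0" "u = x \<triangleleft>\<^bsub>M\<^esub> a" using \<open>u \<in> ?K\<close> by blast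
      then have "u \<triangleleft>\<^bsub>forget M\<^esub> b = x \<triangleleft>\<^bsub>M\<^esub> (a \<otimes> b)" using xc rcomp0_carrier that(2) by (simp add: M.ract_assoc)
      moreover have "a \<otimes> b \<in> rcomp A 0" using mult_comp[OF a(1), of b 0] that(2) by simp
      ultimately show ?thesis by blast
    qed
  qed
  let ?P = "{(x, ?p n x) | x. x \<in> carrier M}"
  let ?F = "?P\<inverse> O (F \<inter> ?K \<times> carrier H)"
  have r: "op_rel (carrier S) (forget M) H ?F"
    by (rule op_rel_comp[OF op_rel_converse[OF op_sub_cycles(4)[OF M]]
          op_rel_restrict[OF F(1) K op_sub_carrier[OF oH]]])
  \<comment> \<open>If \<open>x a\<close> has no component in degree \<open>n\<close>, it has
    strictly fewer nonzero components than \<open>x\<close>, and minimality makes \<open>F\<close>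
    send it to zero. So on this submodule the value depends on the degree \<open>n\<close> component
    alone.\<close>
  have "single_val (forget M) H ?F" unfolding single_val_def
  proof (intro allI impI)
    fix h' assume "(\<zero>\<^bsub>forget M\<^esub>, h') \<in> ?F"
    then obtain a where a: "a \<in> rcomp A 0" "?p n (x \<triangleleft>\<^bsub>M\<^esub> a) = \<zero>\<^bsub>M\<^esub>" "(x \<triangleleft>\<^bsub>M\<^esub> a, h') \<in> F" by auto
    have p: "?p i (x \<triangleleft>\<^bsub>M\<^esub> a) = ?p i x \<triangleleft>\<^bsub>M\<^esub> a" for i using M.hcomp_ract[OF xc a(1)] by simp
    have "{i. ?p i (x \<triangleleft>\<^bsub>M\<^esub> a) \<noteq> \<zero>\<^bsub>M\<^esub>} \<subset> {i. ?p i x \<noteq> \<zero>\<^bsub>M\<^esub>}"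
    proof
      show "{i. ?p i (x \<triangleleft>\<^bsub>M\<^esub> a) \<noteq> \<zero>\<^bsub>M\<^esub>} \<subseteq> {i. ?p i x \<noteq> \<zero>\<^bsub>M\<^esub>}" using p rcomp0_carrier[OF a(1)] by auto
      show "{i. ?p i (x \<triangleleft>\<^bsub>M\<^esub> a) \<noteq> \<zero>\<^bsub>M\<^esub>} \<noteq> {i. ?p i x \<noteq> \<zero>\<^bsub>M\<^esub>}" using a(2) n by blast
    qed
    then have "c (x \<triangleleft>\<^bsub>M\<^esub> a) < c x" unfolding c_def using psubset_card_mono M.gm.hcomp_finite[OF xc] by blast
    then show "h' = \<zero>\<^bsub>H\<^esub>" using min[OF a(3)] by (meson not_le)
  qed
  moreover have "nonzero_rel H ?F"
  proof -
    have "x \<in> ?K" using M.ract_one[OF xc] one_comp by (metis image_eqI)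
    then have "(?p n x, h) \<in> ?F" using x(1) xc op_relD(4)[OF F(1) x(1)] by blast
    then show ?thesis using x(2) unfolding nonzero_rel_def by blast
  qed
  moreover have "u \<in> mcomp M n \<and> mdiff M u = \<zero>\<^bsub>M\<^esub>" if "(u, h') \<in> ?F" for u h'
  proof -
    \<comment> \<open>The components of a cycle are cycles: \<open>d\<close> of the degree
      \<open>n\<close> component is the degree \<open>n + 1\<close> component of the
      differential.\<close>
    obtain v where v: "v \<in> carrier M" "u = ?p n v" "(v, h') \<in> F" using \<open>(u, h') \<in> ?F\<close> by auto
    then show ?thesis using FZ[OF v(3)] M.hcomp_mdiff[OF v(1), of "n + 1"] by simp
  qed
  ultimately show thesis by (rule that[OF r])
qed

section \<open>The comparison map\<close>

text \<open>\<open>D(H)\<close> lives on pairs; an infinite universe is equipollent to its square,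
  which makes room for a copy of \<open>D(H)\<close> in it.\<close>

lemma inj_on_pairs:
  assumes "infinite (UNIV :: 'u set)"
  obtains e :: "'u \<times> 'u \<Rightarrow> 'u" where "inj_on e X"
proof -
  have "\<exists>e. bij_betw e (UNIV \<times> UNIV :: ('u \<times> 'u) set) (UNIV :: 'u set)"
    by (rule iffD2[OF card_of_ordIso card_of_Times_same_infinite[OF assms]])
  then obtain e :: "'u \<times> 'u \<Rightarrow> 'u" where e: "bij_betw e (UNIV \<times> UNIV) UNIV" by (rule exE)
  show thesis by (rule that[OF inj_on_subset[OF bij_betw_imp_inj_on[OF e]]]) simp
qed

lemma Dmod_atom_nonempty:
  fixes H :: "('a, 'u) rmodule"
  assumes inf: "infinite (UNIV :: 'u set)" and H: "rmod_monoform S H"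
  shows "(dg_atom A (Dmod A H) :: ('a, 'u) dgmodule set) \<noteq> {}"
proof -
  obtain e :: "'u \<times> 'u \<Rightarrow> 'u" where "inj_on e (carrier (Dmod A H))" using inj_on_pairs[OF inf] .
  then show ?thesis by (rule dg_atom_nonempty[OF Dmod_monoform[OF H]])
qed

lemma Dmod_atom_eqI:
  assumes "rmod_monoform S H" "rmod_monoform S H'" "op_common (carrier S) H H'"
  shows "dg_atom A (Dmod A H) = dg_atom A (Dmod A H')"
proof (rule dg_atom_eqI[OF Dmod_monoform[OF assms(1)] Dmod_monoform[OF assms(2)]])
  have "right_module S H" "right_module S H'" using rmod_monoformD(1) assms(1,2) by auto
  then show "dg_common A (Dmod A H) (Dmod A H')" by (rule Dmod_common[OF _ _ assms(3)])
qed

text \<open>The atom of \<open>D(H')\<close> is the same for all representatives \<open>H'\<close>,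
  so the union is over a constant nonempty family. The function \<open>f\<close> allows the use both
  with orbits and with plain atoms.\<close>

lemma UN_rmod_atom:
  fixes H :: "('a, 'u) rmodule"
  assumes H: "rmod_monoform S H"
  shows "(\<Union>H'\<in>rmod_atom S H. f (dg_atom A (Dmod A (H' :: ('a, 'u) rmodule)) :: ('a, 'w) dgmodule set)) =
    f (dg_atom A (Dmod A H))"
proof -
  have rH: "right_module S H" using rmod_monoformD(1)[OF H] .
  have "(dg_atom A (Dmod A H') :: ('a, 'w) dgmodule set) = dg_atom A (Dmod A H)"
    if "H' \<in> rmod_atom S H" for H' :: "('a, 'u) rmodule"
    using Dmod_atom_eqI[OF _ H] that unfolding rmod_atom_iff[OF rH] by blast
  then have "(\<Union>H'\<in>rmod_atom S H. f (dg_atom A (Dmod A (H' :: ('a, 'u) rmodule)) :: ('a, 'w) dgmodule set)) =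
    (\<Union>H'\<in>(rmod_atom S H :: ('a, 'u) rmodule set). f (dg_atom A (Dmod A H)))"
    by (intro SUP_cong refl arg_cong[of _ _ f])
  also have "\<dots> = f (dg_atom A (Dmod A H))" using rmod_atom_self[OF H] by (intro SUP_const) blast
  finally show ?thesis .
qed

lemma spec_bij_atom:
  fixes H :: "('a, 'u) rmodule"
  assumes "rmod_monoform S H"
  shows "(spec_bij A (rmod_atom S H) :: ('a, 'u) dgmodule set set) = atom_orbit A (dg_atom A (Dmod A H))"
  unfolding spec_bij_def using UN_rmod_atom[OF assms] .

text \<open>Equal orbits give a common subobject of \<open>D(H)\<close> and some
  \<open>D(H')[n]\<close>. Forgetting grading and differential removes the shift and leaves two
  copies each of \<open>H\<close> and of \<open>H'\<close> over \<open>A\<^sup>0\<close>, from which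
  a common subobject of \<open>H\<close> and \<open>H'\<close> is extracted.\<close>

lemma spec_bij_inj:
  assumes inf: "infinite (UNIV :: 'u set)"
  shows "inj_on (spec_bij A :: ('a, 'u) rmodule set \<Rightarrow> ('a, 'u) dgmodule set set) (rmod_Spec S)"
proof (rule inj_onI)
  fix \<alpha> \<beta> :: "('a, 'u) rmodule set"
  assume "\<alpha> \<in> rmod_Spec S" "\<beta> \<in> rmod_Spec S" and e: "spec_bij A \<alpha> = spec_bij A \<beta>"
  then obtain H H' :: "('a, 'u) rmodule" where H: "rmod_monoform S H" "\<alpha> = rmod_atom S H"
    and H': "rmod_monoform S H'" "\<beta> = rmod_atom S H'" unfolding rmod_Spec_def by blast
  have rH: "right_module S H" "right_module S H'" using rmod_monoformD(1) H(1) H'(1) by auto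
  note m = Dmod_monoform[OF H(1)] and m' = Dmod_monoform[OF H'(1)]
  note e = e[unfolded H(2) H'(2) spec_bij_atom[OF H(1)] spec_bij_atom[OF H'(1)]]
  obtain n where n: "dg_common A (Dmod A H) (dg_shift n (Dmod A H'))"
    by (rule dg_common_of_orbit_eq[OF m Dmod_atom_nonempty[OF inf H(1)] m' Dmod_atom_nonempty[OF inf H'(1)] e])
  note d = dg_monoformD(1)[OF m] and d' = dg_monoformD(1)[OF m']
  have "op_common (carrier S) (forget (Dmod A H)) (forget (Dmod A H'))"
  proof -
    obtain G where G: "dg_rel A (Dmod A H) (dg_shift n (Dmod A H')) G"
      and sv: "single_val (dgr (Dmod A H)) (dgr (dg_shift n (Dmod A H'))) G"
        "single_val (dgr (dg_shift n (Dmod A H'))) (dgr (Dmod A H)) (G\<inverse>)"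
        "nonzero_rel (dgr (dg_shift n (Dmod A H'))) G"
      using n op_common_def by metis
    have "op_rel (carrier S) (forget (Dmod A H)) (forget (Dmod A H')) G"
      using dg_rel_forget[OF d dg_shift_props(1)[OF d'] G] by simp
    moreover have "single_val (forget (Dmod A H)) (forget (Dmod A H')) G"
      using sv(1) by (simp only: single_val_def dgr_simps forget_simps dg_shift_simps)
    moreover have "single_val (forget (Dmod A H')) (forget (Dmod A H)) (G\<inverse>)"
      using sv(2) by (simp only: single_val_def dgr_simps forget_simps dg_shift_simps)
    moreover have "nonzero_rel (forget (Dmod A H')) G"
      using sv(3) by (simp only: nonzero_rel_def dgr_simps forget_simps dg_shift_simps)
    ultimately show ?thesis unfolding op_common_def by (intro exI[of _ G] conjI)
  qed
  then have "op_common (carrier S) H (forget (Dmod A H'))" by (rule common_forget_Dmod[OF rH(1)])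
  then have "op_common (carrier S) H' H" by (rule common_forget_Dmod[OF rH(2) op_common_sym])
  then have "op_common (carrier S) H H'" by (rule op_common_sym)
  then show "\<alpha> = \<beta>" unfolding H(2) H'(2) by (rule rmod_atom_eqI[OF H(1) H'(1)])
qed

section \<open>Comparison of supports\<close>

lemma orbit_eq_spec_bij:
  fixes X :: "('a, 'u) dgmodule" and H :: "('a, 'u) rmodule"
  assumes inf: "infinite (UNIV :: 'u set)" and X: "dg_monoform A X" and H: "rmod_monoform S H"
    and c: "dg_common A X (dg_shift n (Dmod A H))"
  shows "atom_orbit A (dg_atom A X) = (spec_bij A (rmod_atom S H) :: ('a, 'u) dgmodule set set)"
  unfolding spec_bij_atom[OF H]
  by (rule atom_orbit_eqI[OF X _ Dmod_monoform[OF H] Dmod_atom_nonempty[OF inf H] c])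
    (use dg_atom_self[OF X] in blast)

text \<open>The same set of pairs works, up to composition with an identity relation; only the shift
  moves from the source to the target.\<close>

lemma unshift_rel:
  fixes M :: "('a, 'm) dgmodule" and N :: "('a, 'n) dgmodule"
  assumes M: "dg_module A M" and N: "dg_module A N"
    and G: "dg_rel A (dg_shift n M) N G" "single_val (dgr (dg_shift n M)) (dgr N) G"
      "nonzero_rel (dgr N) G"
  shows "\<exists>F. dg_rel A M (dg_shift (-n) N) F \<and>
    single_val (dgr M) (dgr (dg_shift (-n) N)) F \<and> nonzero_rel (dgr (dg_shift (-n) N)) F"
proof -
  let ?I = "Id_on (carrier M)"
  have II: "?I O ?I = ?I" by auto
  note s = dg_shift_props(1)[OF M]
  have "dg_rel A (dg_shift (-n) (dg_shift n M)) (dg_shift 0 M) ?I"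
    using dg_shift_shift_rel(1)[OF M, of "-n" n] by simp
  from op_rel_comp[OF this dg_shift_shift_rel(2)[OF M]]
  have I: "dg_rel A (dg_shift (-n) (dg_shift n M)) M ?I"
    unfolding II .
  have G': "dg_rel A (dg_shift (-n) (dg_shift n M)) (dg_shift (-n) N) G"
    using dg_rel_shift_iff[OF s N] G(1) by blast
  have e: "?I\<inverse> O G = G" using op_relD(3)[OF G(1)] by auto
  have "dg_rel A M (dg_shift (-n) N) G"
    using op_rel_comp[OF op_rel_converse[OF I] G'] e by simp
  moreover have "single_val (dgr M) (dgr (dg_shift (-n) N)) G"
    using G(2) by (simp only: single_val_def dgr_simps dg_shift_simps)
  moreover have "nonzero_rel (dgr (dg_shift (-n) N)) G" using G(3) by simp
  ultimately show ?thesis by (intro exI[of _ G] conjI)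
qed

text \<open>Both inclusions pass through cycles. A monoform dg subquotient of \<open>M\<close>
  contains a module of lowest cycles that is a subquotient of \<open>M\<close> over
  \<open>A\<^sup>0\<close>. Conversely a monoform \<open>A\<^sup>0\<close>-subquotient is first
  moved to cycles of a single degree \<open>n\<close>, and the canonical morphism is applied to
  \<open>M[n]\<close>.\<close>

theorem SuppZ_eq:
  fixes M :: "('a, 'u) dgmodule"
  assumes inf: "infinite (UNIV :: 'u set)" and bd: "bounded_dg A" and M: "dg_module A M"
  shows "dg_SuppZ A M = spec_bij A ` rmod_Supp S (forget M)"
proof (intro subset_antisym subsetI)
  note rM = right_module_S[OF M]
  fix \<omega> assume "\<omega> \<in> dg_SuppZ A M"
  then obtain \<alpha> where \<alpha>: "\<alpha> \<in> dg_Supp A M" "\<omega> = atom_orbit A \<alpha>" unfolding dg_SuppZ_def by blast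
  obtain X :: "('a, 'u) dgmodule" and G where X: "dg_monoform A X"
    and G: "dg_rel A M X G" "single_val (dgr M) (dgr X) G" "Range G = carrier X"
    and aX: "\<alpha> = dg_atom A X" using dg_SuppE[OF M \<alpha>(1)] by metis
  obtain n and H :: "('a, 'u) rmodule" and F where H: "rmod_monoform S H"
    and c: "dg_common A X (dg_shift n (Dmod A H))"
    and F: "op_rel (carrier S) (forget X) H F" "single_val (forget X) H F" "nonzero_rel H F"
    using monoform_from_cycles[OF bd X] by metis
  have dX: "dg_module A X" using dg_monoformD(1)[OF X] .
  have "rmod_atom S H \<in> rmod_Supp S (forget M)"
  proof (rule rmod_SuppI[OF rM H])
    show "op_rel (carrier S) (forget M) H (G O F)"
      by (rule op_rel_comp[OF dg_rel_forget[OF M dX G(1)] F(1)])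
    show "single_val (forget M) H (G O F)"
      by (rule single_val_comp[OF _ F(2)]) (use G(2) in \<open>simp add: single_val_def\<close>)
    obtain x h where xh: "(x, h) \<in> F" "h \<noteq> \<zero>\<^bsub>H\<^esub>" using F(3) nonzero_rel_def by metis
    then have "x \<in> Range G" using op_relD(3)[OF F(1) xh(1)] G(3) by simp
    then show "nonzero_rel H (G O F)" using xh unfolding nonzero_rel_def by blast
  qed
  moreover have "\<omega> = spec_bij A (rmod_atom S H)"
    using \<alpha>(2) aX orbit_eq_spec_bij[OF inf X H c] by simp
  ultimately show "\<omega> \<in> spec_bij A ` rmod_Supp S (forget M)" by blast
next
  note rM = right_module_S[OF M]
  fix \<omega> assume "\<omega> \<in> spec_bij A ` rmod_Supp S (forget M)"
  then obtain \<alpha> where \<alpha>: "\<alpha> \<in> rmod_Supp S (forget M)" "\<omega> = spec_bij A \<alpha>" by blast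
  obtain H :: "('a, 'u) rmodule" and G where H: "rmod_monoform S H"
    and G: "op_rel (carrier S) (forget M) H G" "single_val (forget M) H G" "nonzero_rel H G"
    and aH: "\<alpha> = rmod_atom S H" using rmod_SuppE[OF rM \<alpha>(1)] by metis
  have rH: "right_module S H" using rmod_monoformD(1)[OF H] .
  obtain n F where F: "op_rel (carrier S) (forget M) H F" "single_val (forget M) H F" "nonzero_rel H F"
    and FZ: "\<And>x h. (x, h) \<in> F \<Longrightarrow> x \<in> mcomp M n \<and> mdiff M x = \<zero>\<^bsub>M\<^esub>"
    using homogeneous_cycle_rel[OF M G] by metis
  let ?T = "dg_shift n M" and ?D = "Dmod A H"
  have T: "dg_module A ?T" using dg_shift_props(1)[OF M] .
  interpret M: dg_module A M by (rule M)
  have Z: "x \<in> mcomp ?T 0 \<and> mdiff ?T x = \<zero>\<^bsub>?T\<^esub>" if "(x, h) \<in> F" for x h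
    using FZ[OF that] by (cases "even n") simp_all
  have F': "op_rel (carrier S) (forget ?T) H F" "single_val (forget ?T) H F" using F(1,2) by simp_all
  have mD: "dg_monoform A ?D" using Dmod_monoform[OF H] .
  obtain K where K: "dg_rel A ?T ?D K" "single_val (dgr ?T) (dgr ?D) K" "nonzero_rel (dgr ?D) K"
    using cycles_rel[OF T rH F' F(3)] Z by blast
  obtain L where L: "dg_rel A M (dg_shift (-n) ?D) L"
    "single_val (dgr M) (dgr (dg_shift (-n) ?D)) L" "nonzero_rel (dgr (dg_shift (-n) ?D)) L"
    using unshift_rel[OF M dg_monoformD(1)[OF mD] K] by metis
  have m: "dg_monoform A (dg_shift (-n) ?D)" using dg_monoform_shift[OF mD] .
  have S: "dg_atom A (dg_shift (-n) ?D) \<in> dg_Supp A M" by (rule dg_SuppI[OF M m L])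
  \<comment> \<open>\<open>D(H)[-n]\<close> lives on pairs; membership in the support provides a
    representative of its atom over the universe type.\<close>
  then obtain X :: "('a, 'u) dgmodule" where X: "dg_monoform A X"
    "(dg_atom A (dg_shift (-n) ?D) :: ('a, 'u) dgmodule set) = dg_atom A X"
    using dg_SuppE[OF M] by metis
  have "dg_common A X (dg_shift (-n) ?D)"
    by (rule dg_common_of_atom_eq[OF X(1) m _ X(2)[symmetric]]) (use dg_atom_self[OF X(1)] in blast)
  then have "atom_orbit A (dg_atom A (dg_shift (-n) ?D) :: ('a, 'u) dgmodule set) = spec_bij A (rmod_atom S H)"
    unfolding X(2) by (rule orbit_eq_spec_bij[OF inf X(1) H])
  then show "\<omega> \<in> dg_SuppZ A M" unfolding dg_SuppZ_def \<alpha>(2) aH using S by (metis imageI)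
qed

end

section \<open>Topologies\<close>

text \<open>An atom lies in the support of each of its representatives, the identity relation being
  the required partial morphism.\<close>

lemma topspace_rmod_Spec: "topspace (rmod_Spec_topology R :: ('a, 'u) rmodule set topology) = rmod_Spec R"
proof (intro subset_antisym subsetI)
  fix \<alpha> :: "('a, 'u) rmodule set"
  assume "\<alpha> \<in> topspace (rmod_Spec_topology R)"
  then obtain M :: "('a, 'u) rmodule" where M: "right_module R M" "\<alpha> \<in> rmod_Supp R M"
    unfolding rmod_Spec_topology_def topology_generated_by_topspace by blast
  from rmod_SuppE[OF this] show "\<alpha> \<in> rmod_Spec R" unfolding rmod_Spec_def by blast
next
  fix \<alpha> :: "('a, 'u) rmodule set"
  assume "\<alpha> \<in> rmod_Spec R"
  then obtain H :: "('a, 'u) rmodule" where H: "rmod_monoform R H" "\<alpha> = rmod_atom R H"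
    unfolding rmod_Spec_def by blast
  note r = rmod_monoformD[OF H(1)]
  note I = op_rel_Id[OF right_module_op_group[OF r(1)]]
  have "rmod_atom R H \<in> rmod_Supp R H"
    by (rule rmod_SuppI[OF r(1) H(1) I])
      (auto simp: single_val_def intro!: op_monoform_Range[OF r(2) right_module_op_group[OF r(1)]])
  then show "\<alpha> \<in> topspace (rmod_Spec_topology R)"
    unfolding rmod_Spec_topology_def topology_generated_by_topspace using H(2) r(1) by blast
qed

lemma topspace_dg_Spec: "topspace (dg_Spec_topology A :: ('a, 'u) dgmodule set topology) = dg_Spec A"
proof (intro subset_antisym subsetI)
  fix \<alpha> :: "('a, 'u) dgmodule set"
  assume "\<alpha> \<in> topspace (dg_Spec_topology A)"
  then obtain M :: "('a, 'u) dgmodule" where M: "dg_module A M" "\<alpha> \<in> dg_Supp A M"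
    unfolding dg_Spec_topology_def topology_generated_by_topspace by blast
  from dg_SuppE[OF this] show "\<alpha> \<in> dg_Spec A" unfolding dg_Spec_def by blast
next
  fix \<alpha> :: "('a, 'u) dgmodule set"
  assume "\<alpha> \<in> dg_Spec A"
  then obtain H :: "('a, 'u) dgmodule" where H: "dg_monoform A H" "\<alpha> = dg_atom A H"
    unfolding dg_Spec_def by blast
  note r = dg_monoformD[OF H(1)]
  note I = op_rel_Id[OF dg_module_op_group[OF r(1)]]
  have "dg_atom A H \<in> dg_Supp A H"
    by (rule dg_SuppI[OF r(1) H(1) I])
      (auto simp: single_val_def intro!: op_monoform_Range[OF r(2) dg_module_op_group[OF r(1)]])
  then show "\<alpha> \<in> topspace (dg_Spec_topology A)"
    unfolding dg_Spec_topology_def topology_generated_by_topspace using H(2) r(1) by blast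
qed

lemma openin_SpecZ:
  "openin (dg_SpecZ_topology A) U \<longleftrightarrow>
    U \<subseteq> dg_SpecZ A \<and> openin (dg_Spec_topology A) {\<alpha> \<in> dg_Spec A. atom_orbit A \<alpha> \<in> U}"
  unfolding dg_SpecZ_topology_def by (simp add: topology_inverse'[OF istopology_SpecZ])

lemma topspace_SpecZ: "topspace (dg_SpecZ_topology A) = dg_SpecZ A"
proof -
  have e: "{\<alpha> \<in> dg_Spec A. atom_orbit A \<alpha> \<in> dg_SpecZ A} = topspace (dg_Spec_topology A)"
    unfolding topspace_dg_Spec dg_SpecZ_def by blast
  have "openin (dg_SpecZ_topology A) (dg_SpecZ A)"
    unfolding openin_SpecZ e by (intro conjI order_refl openin_topspace)
  from openin_subset[OF this] show ?thesis
    using openin_SpecZ[THEN iffD1, OF openin_topspace] by (intro subset_antisym) auto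
qed

lemma continuous_map_atom_orbit:
  "continuous_map (dg_Spec_topology A) (dg_SpecZ_topology A) (atom_orbit A)"
  unfolding continuous_map_def topspace_dg_Spec topspace_SpecZ
  by (auto simp: openin_SpecZ dg_SpecZ_def)

section \<open>Continuity in both directions\<close>

context nonpos_dg
begin

text \<open>A lift of the comparison map to the spectrum before orbits are formed, so that
  continuity can be tested against supports. As for \<open>spec_bij\<close>, all representatives of
  an atom contribute the same set.\<close>

definition Dmod_atom :: "('a, 'u) rmodule set \<Rightarrow> ('a, 'u) dgmodule set" where
  "Dmod_atom \<alpha> = (\<Union>H\<in>\<alpha>. dg_atom A (Dmod A H))"

lemma Dmod_atom_eq:
  fixes H :: "('a, 'u) rmodule"
  assumes "rmod_monoform S H"
  shows "Dmod_atom (rmod_atom S H :: ('a, 'u) rmodule set) = dg_atom A (Dmod A H)"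
  unfolding Dmod_atom_def using UN_rmod_atom[OF assms, of "\<lambda>\<alpha> :: ('a, 'u) dgmodule set. \<alpha>"] .

lemma Dmod_atom_in_Spec:
  fixes H :: "('a, 'u) rmodule"
  assumes inf: "infinite (UNIV :: 'u set)" and H: "rmod_monoform S H"
  shows "(dg_atom A (Dmod A H) :: ('a, 'u) dgmodule set) \<in> dg_Spec A"
proof -
  obtain X :: "('a, 'u) dgmodule" where X: "X \<in> dg_atom A (Dmod A H)"
    using Dmod_atom_nonempty[OF inf H] by blast
  note m = Dmod_monoform[OF H]
  have X': "dg_monoform A X" "dg_common A X (Dmod A H)"
    using X unfolding dg_atom_iff[OF dg_monoformD(1)[OF m]] by auto
  have "(dg_atom A X :: ('a, 'u) dgmodule set) = dg_atom A (Dmod A H)"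
    by (rule dg_atom_eqI[OF X'(1) m X'(2)])
  then show ?thesis unfolding dg_Spec_def using X'(1) by blast
qed

text \<open>A neighbourhood of the atom of \<open>H\<close> that is mapped into \<open>Supp M\<close> is \<open>Supp (Z\<^sup>0 X)\<close>, for a
  subquotient \<open>X\<close> of \<open>M\<close> with the same atom as \<open>D(H)\<close>.\<close>
lemma continuous_map_Dmod_atom:
  assumes inf: "infinite (UNIV :: 'u set)"
  shows "continuous_map (rmod_Spec_topology S) (dg_Spec_topology A)
    (Dmod_atom :: ('a, 'u) rmodule set \<Rightarrow> ('a, 'u) dgmodule set)"
  unfolding dg_Spec_topology_def
proof (rule continuous_on_generated_topo)
  show "Dmod_atom ` topspace (rmod_Spec_topology S) \<subseteq>
      \<Union> {dg_Supp A M | M :: ('a, 'u) dgmodule. dg_module A M}"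
  proof
    fix \<beta> :: "('a, 'u) dgmodule set"
    assume "\<beta> \<in> Dmod_atom ` topspace (rmod_Spec_topology S)"
    then obtain H :: "('a, 'u) rmodule" where H: "rmod_monoform S H" "\<beta> = Dmod_atom (rmod_atom S H)"
      unfolding topspace_rmod_Spec rmod_Spec_def by blast
    have "\<beta> \<in> topspace (dg_Spec_topology A)"
      unfolding topspace_dg_Spec H(2) Dmod_atom_eq[OF H(1)] by (rule Dmod_atom_in_Spec[OF inf H(1)])
    then show "\<beta> \<in> \<Union> {dg_Supp A M | M :: ('a, 'u) dgmodule. dg_module A M}"
      unfolding dg_Spec_topology_def topology_generated_by_topspace .
  qed
next
  fix U assume "U \<in> {dg_Supp A M | M :: ('a, 'u) dgmodule. dg_module A M}"
  then obtain M :: "('a, 'u) dgmodule" where M: "dg_module A M" and U: "U = dg_Supp A M" by blast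
  let ?V = "Dmod_atom -` U \<inter> topspace (rmod_Spec_topology S) :: ('a, 'u) rmodule set set"
  show "openin (rmod_Spec_topology S) ?V"
  proof (subst openin_subopen, intro ballI)
    fix \<alpha> assume "\<alpha> \<in> ?V"
    then obtain H :: "('a, 'u) rmodule" where H: "rmod_monoform S H" "\<alpha> = rmod_atom S H"
      unfolding topspace_rmod_Spec rmod_Spec_def by blast
    have rH: "right_module S H" using rmod_monoformD(1)[OF H(1)] .
    have mD: "dg_monoform A (Dmod A H)" using Dmod_monoform[OF H(1)] .
    have aD: "(dg_atom A (Dmod A H) :: ('a, 'u) dgmodule set) \<in> dg_Supp A M"
      using \<open>\<alpha> \<in> ?V\<close> unfolding U H(2) vimage_def by (simp add: Dmod_atom_eq[OF H(1)])
    obtain X :: "('a, 'u) dgmodule" and G where X: "dg_monoform A X"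
      and G: "dg_rel A M X G" "single_val (dgr M) (dgr X) G" "Range G = carrier X"
      and aX: "(dg_atom A (Dmod A H) :: ('a, 'u) dgmodule set) = dg_atom A X"
      by (rule dg_SuppE[OF M aD])
    have dX: "dg_module A X" using dg_monoformD(1)[OF X] .
    interpret X: dg_module A X by (rule dX)
    have "dg_common A X (Dmod A H)"
      by (rule dg_common_of_atom_eq[OF X mD _ aX[symmetric]]) (use dg_atom_self[OF X] in blast)
    then obtain F where F: "dg_rel A X (Dmod A H) F"
      "single_val (dgr X) (dgr (Dmod A H)) F" "single_val (dgr (Dmod A H)) (dgr X) (F\<inverse>)"
      "nonzero_rel (dgr (Dmod A H)) F" using op_common_def by metis
    let ?Z = "{x \<in> mcomp X 0. mdiff X x = \<zero>\<^bsub>X\<^esub>}"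
    define Q where "Q = rmod_sub (forget X) ?Z"
    note rX = right_module_S[OF dX]
    note Z = op_sub_cycles(2)[OF dX]
    note I = Id_on_rel[OF rX Z, folded Q_def]
    have rQ: "right_module S Q" unfolding Q_def by (rule rmod_sub_props(1)[OF rX Z])
    let ?J = "{(y, (\<zero>\<^bsub>H\<^esub>, y)) | y. y \<in> carrier H}"
    \<comment> \<open>\<open>F\<close> is restricted to the degree \<open>0\<close> cycles of
      \<open>X\<close>, where its values are read off as the degree \<open>0\<close> entry in
      \<open>D(H)\<close>.\<close>
    let ?K = "(Id_on ?Z)\<inverse> O F O ?J\<inverse>"
    have J: "op_rel (carrier S) H (forget (Dmod A H)) ?J" by (rule Dmod_embeddings(1)[OF rH])
    have "op_rel (carrier S) Q H ?K"
      by (rule op_rel_comp[OF op_rel_converse[OF I(1)] op_rel_comp[OF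
            dg_rel_forget[OF dX dg_monoformD(1)[OF mD] F(1)] op_rel_converse[OF J]]])
    moreover have "single_val Q H ?K"
    proof (rule single_val_comp[OF I(3) single_val_comp])
      show "single_val (forget X) (forget (Dmod A H)) F"
        using F(2) by (simp only: single_val_def dgr_simps forget_simps)
      show "single_val (forget (Dmod A H)) H (?J\<inverse>)" by (auto simp: single_val_def)
    qed
    moreover have "nonzero_rel H ?K"
    proof -
      \<comment> \<open>The degree \<open>0\<close> component of \<open>x\<close> is related to
        \<open>(0, y)\<close>, whose differential is zero; since \<open>F\<close> is injective, that
        component must be a cycle.\<close>
      have mem: "(dcomp X 0 x, y) \<in> ?K" if xy: "(x, (u, y)) \<in> F" for x u y
      proof -
        have x: "x \<in> carrier X" "u \<in> carrier H" "y \<in> carrier H" using op_relD(3,4)[OF F(1) xy] by auto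
        let ?x = "dcomp X 0 x"
        have f: "(?x, (\<zero>\<^bsub>H\<^esub>, y)) \<in> F"
          using dg_relD(4)[OF F(1) xy, of 0] Dmod_props(2)[OF rH x(2,3), of 0] by simp
        have "(mdiff X ?x, (\<zero>\<^bsub>H\<^esub>, \<zero>\<^bsub>H\<^esub>)) \<in> F" using dg_relD(5)[OF F(1) f] by simp
        then have "mdiff X ?x = \<zero>\<^bsub>X\<^esub>" using F(3) by (simp add: single_val_def)
        then have "?x \<in> ?Z" using x(1) by simp
        then show ?thesis using f x(3) by blast
      qed
      obtain x p where xp: "(x, p) \<in> F" "p \<noteq> \<zero>\<^bsub>dgr (Dmod A H)\<^esub>" using F(4) nonzero_rel_def by metis
      obtain u v where p: "p = (u, v)" by (cases p)
      show ?thesis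
      proof (cases "v = \<zero>\<^bsub>H\<^esub>")
        case False
        then show ?thesis using mem[OF xp(1)[unfolded p]] unfolding nonzero_rel_def by blast
      next
        case True
        \<comment> \<open>When the degree \<open>0\<close> entry vanishes, the differential carries
          the entry of degree \<open>-1\<close> to degree \<open>0\<close>.\<close>
        then have "u \<noteq> \<zero>\<^bsub>H\<^esub>" using xp(2) p by simp
        moreover have "(mdiff X x, (\<zero>\<^bsub>H\<^esub>, u)) \<in> F" using dg_relD(5)[OF F(1) xp(1)] p by simp
        ultimately show ?thesis using mem unfolding nonzero_rel_def by blast
      qed
    qed
    ultimately have aQ: "\<alpha> \<in> rmod_Supp S Q" unfolding H(2) by (rule rmod_SuppI[OF rQ H(1)])
    have oQ: "openin (rmod_Spec_topology S) (rmod_Supp S Q)"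
      unfolding rmod_Spec_topology_def by (rule topology_generated_by_Basis) (use rQ in blast)
    \<comment> \<open>A monoform subquotient \<open>H'\<close> of the degree \<open>0\<close> cycles
      of \<open>X\<close> puts the atom of \<open>D(H')\<close> in the support of \<open>X\<close>,
      hence in that of \<open>M\<close>.\<close>
    have "\<beta> \<in> ?V" if \<beta>: "\<beta> \<in> rmod_Supp S Q" for \<beta>
    proof -
      obtain H' :: "('a, 'u) rmodule" and L where H': "rmod_monoform S H'" "\<beta> = rmod_atom S H'"
        and L: "op_rel (carrier S) Q H' L" "single_val Q H' L" "nonzero_rel H' L"
        using rmod_SuppE[OF rQ \<beta>] by metis
      let ?L = "Id_on ?Z O L"
      have L1: "op_rel (carrier S) (forget X) H' ?L" by (rule op_rel_comp[OF I(1) L(1)])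
      have L2: "single_val (forget X) H' ?L" by (rule single_val_comp[OF I(2) L(2)])
      have "nonzero_rel H' ?L"
      proof -
        obtain x h where xh: "(x, h) \<in> L" "h \<noteq> \<zero>\<^bsub>H'\<^esub>" using L(3) nonzero_rel_def by metis
        have "x \<in> ?Z" using op_relD(3)[OF L(1) xh(1)] by (simp add: Q_def rmod_sub_def)
        then have "(x, h) \<in> ?L" using xh(1) by blast
        then show ?thesis using xh(2) unfolding nonzero_rel_def by blast
      qed
      moreover have "x \<in> mcomp X 0 \<and> mdiff X x = \<zero>\<^bsub>X\<^esub>" if "(x, h) \<in> ?L" for x h using that by blast
      ultimately obtain K where K: "dg_rel A X (Dmod A H') K"
        "single_val (dgr X) (dgr (Dmod A H')) K" "nonzero_rel (dgr (Dmod A H')) K"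
        using cycles_rel[OF dX rmod_monoformD(1)[OF H'(1)] L1 L2] by blast
      have "(dg_atom A (Dmod A H') :: ('a, 'u) dgmodule set) \<in> dg_Supp A M"
      proof (rule dg_SuppI[OF M Dmod_monoform[OF H'(1)] op_rel_comp[OF G(1) K(1)] single_val_comp[OF G(2) K(2)]])
        obtain x p where xp: "(x, p) \<in> K" "p \<noteq> \<zero>\<^bsub>dgr (Dmod A H')\<^esub>" using K(3) nonzero_rel_def by metis
        have "x \<in> Range G" using op_relD(3)[OF K(1) xp(1)] G(3) by simp
        then show "nonzero_rel (dgr (Dmod A H')) (G O K)" using xp unfolding nonzero_rel_def by blast
      qed
      then have "Dmod_atom \<beta> \<in> U" unfolding U H'(2) Dmod_atom_eq[OF H'(1)] .
      moreover have "\<beta> \<in> topspace (rmod_Spec_topology S)" using openin_subset[OF oQ] \<beta> by blast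
      ultimately show ?thesis by blast
    qed
    then show "\<exists>T. openin (rmod_Spec_topology S) T \<and> \<alpha> \<in> T \<and> T \<subseteq> ?V" using aQ oQ by blast
  qed
qed

text \<open>The preimage is the union of the supports of the shifts of \<open>M\<close>: an atom in
  the orbit of some atom of \<open>Supp M\<close> belongs to \<open>Supp (M[n])\<close> for a
  suitable \<open>n\<close>, and all of \<open>Supp (M[n])\<close> is mapped into the orbits of
  \<open>Supp M\<close>.\<close>

lemma openin_SuppZ_preimage:
  fixes M :: "('a, 'u) dgmodule"
  assumes M: "dg_module A M"
  shows "openin (dg_Spec_topology A) {\<alpha> \<in> dg_Spec A. atom_orbit A \<alpha> \<in> dg_SuppZ A M}"
proof (subst openin_subopen, intro ballI)
  let ?V = "{\<alpha> \<in> dg_Spec A. atom_orbit A \<alpha> \<in> dg_SuppZ A M}"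
  fix \<alpha> assume \<alpha>: "\<alpha> \<in> ?V"
  then obtain X :: "('a, 'u) dgmodule" where X: "dg_monoform A X" "\<alpha> = dg_atom A X"
    unfolding dg_Spec_def by blast
  from \<alpha> obtain \<beta> where \<beta>: "\<beta> \<in> dg_Supp A M" "atom_orbit A \<alpha> = atom_orbit A \<beta>"
    unfolding dg_SuppZ_def by blast
  obtain Y :: "('a, 'u) dgmodule" and G where Y: "dg_monoform A Y" "\<beta> = dg_atom A Y"
    and G: "dg_rel A M Y G" "single_val (dgr M) (dgr Y) G" "nonzero_rel (dgr Y) G"
    using dg_SuppE[OF M \<beta>(1)] by metis
  have ne: "(dg_atom A Z :: ('a, 'u) dgmodule set) \<noteq> {}" if "dg_monoform A Z" for Z :: "('a, 'u) dgmodule"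
    using dg_atom_self[OF that] by blast
  obtain n where n: "dg_common A X (dg_shift n Y)"
    by (rule dg_common_of_orbit_eq[OF X(1) ne[OF X(1)] Y(1) ne[OF Y(1)]]) (use \<beta>(2) X(2) Y(2) in simp)
  let ?T = "dg_shift n M"
  have T: "dg_module A ?T" using dg_shift_props(1)[OF M] .
  have m: "dg_monoform A (dg_shift n Y)" using dg_monoform_shift[OF Y(1)] .
  have "dg_atom A (dg_shift n Y) \<in> dg_Supp A ?T"
    by (rule dg_SuppI[OF T m]) (use G dg_rel_shift_iff[OF M dg_monoformD(1)[OF Y(1)]] in simp_all)
  moreover have "(dg_atom A X :: ('a, 'u) dgmodule set) = dg_atom A (dg_shift n Y)" by (rule dg_atom_eqI[OF X(1) m n])
  ultimately have a: "\<alpha> \<in> dg_Supp A ?T" using X(2) by simp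
  have o: "openin (dg_Spec_topology A) (dg_Supp A ?T)"
    unfolding dg_Spec_topology_def by (rule topology_generated_by_Basis) (use T in blast)
  have "\<gamma> \<in> ?V" if \<gamma>: "\<gamma> \<in> dg_Supp A ?T" for \<gamma>
  proof -
    obtain Q :: "('a, 'u) dgmodule" and F where Q: "dg_monoform A Q" "\<gamma> = dg_atom A Q"
      and F: "dg_rel A ?T Q F" "single_val (dgr ?T) (dgr Q) F" "nonzero_rel (dgr Q) F"
      using dg_SuppE[OF T \<gamma>] by metis
    obtain L where L: "dg_rel A M (dg_shift (-n) Q) L"
      "single_val (dgr M) (dgr (dg_shift (-n) Q)) L" "nonzero_rel (dgr (dg_shift (-n) Q)) L"
      using unshift_rel[OF M dg_monoformD(1)[OF Q(1)] F] by metis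
    have mQ: "dg_monoform A (dg_shift (-n) Q)" using dg_monoform_shift[OF Q(1)] .
    have s: "dg_atom A (dg_shift (-n) Q) \<in> dg_Supp A M" by (rule dg_SuppI[OF M mQ L])
    have "atom_orbit A (dg_atom A (dg_shift (-n) Q)) = atom_orbit A \<gamma>"
      unfolding Q(2)
      by (rule atom_orbit_eqI[OF mQ ne[OF mQ] Q(1) ne[OF Q(1)] op_common_refl[OF dg_monoformD(2)[OF mQ]]])
    then have "atom_orbit A \<gamma> \<in> dg_SuppZ A M" unfolding dg_SuppZ_def using s by (metis imageI)
    moreover have "\<gamma> \<in> dg_Spec A" using Q unfolding dg_Spec_def by blast
    ultimately show ?thesis by blast
  qed
  then show "\<exists>T. openin (dg_Spec_topology A) T \<and> \<alpha> \<in> T \<and> T \<subseteq> ?V" using a o by blast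
qed

text \<open>\<open>C\<close> is a copy of \<open>D(N)\<close> in the universe. Over
  \<open>A\<^sup>0\<close> it consists of two copies of \<open>N\<close>, which have the support of
  \<open>N\<close>. Thus every basic open set of \<open>Spec (Mod A\<^sup>0)\<close> is the support
  of a dg module.\<close>

lemma rmod_Supp_Dmod:
  fixes N :: "('a, 'u) rmodule"
  assumes inf: "infinite (UNIV :: 'u set)" and N: "right_module S N"
  obtains C :: "('a, 'u) dgmodule" where "dg_module A C" "rmod_Supp S (forget C) = rmod_Supp S N"
proof -
  note dD = Dmod_props(1)[OF N]
  obtain e :: "'u \<times> 'u \<Rightarrow> 'u" where "inj_on e (carrier (Dmod A N))" using inj_on_pairs[OF inf] .
  then obtain C :: "('a, 'u) dgmodule" where C: "dg_module A C" "op_iso (dg_ops A) (dgr (Dmod A N)) (dgr C)"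
    using dg_copy[OF dD] by blast
  obtain B where B: "dg_rel A (Dmod A N) C B" "single_val (dgr (Dmod A N)) (dgr C) B"
    "single_val (dgr C) (dgr (Dmod A N)) (B\<inverse>)" "Domain B = carrier (dgr (Dmod A N))" "Range B = carrier (dgr C)"
    using C(2) op_iso_def by metis
  have B': "op_rel (carrier S) (forget (Dmod A N)) (forget C) B" by (rule dg_rel_forget[OF dD C(1) B(1)])
  have svB: "single_val (forget (Dmod A N)) (forget C) B" "single_val (forget C) (forget (Dmod A N)) (B\<inverse>)"
    using B(2,3) by (simp_all only: single_val_def dgr_simps forget_simps)
  note rC = right_module_S[OF C(1)]
  let ?P = "{((x, y), y) | x y. x \<in> carrier N \<and> y \<in> carrier N}"
  have P: "op_rel (carrier S) (forget (Dmod A N)) N ?P" by (rule Dmod_embeddings(3)[OF N])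
  have "rmod_Supp S (forget C) = rmod_Supp S N"
  proof (intro subset_antisym subsetI)
    fix \<alpha> :: "('a, 'u) rmodule set" assume "\<alpha> \<in> rmod_Supp S (forget C)"
    from rmod_SuppE[OF rC this] obtain H :: "('a, 'u) rmodule" and G where
      H: "rmod_monoform S H" "\<alpha> = rmod_atom S H"
      and G: "op_rel (carrier S) (forget C) H G" "single_val (forget C) H G" "nonzero_rel H G" by metis
    have "nonzero_rel H (B O G)"
    proof -
      obtain x h where xh: "(x, h) \<in> G" "h \<noteq> \<zero>\<^bsub>H\<^esub>" using G(3) nonzero_rel_def by metis
      then have "x \<in> Range B" using op_relD(3)[OF G(1) xh(1)] B(5) by simp
      then show ?thesis using xh unfolding nonzero_rel_def by blast
    qed
    then obtain F where "op_rel (carrier S) N H F" "single_val N H F" "nonzero_rel H F"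
      using forget_Dmod_rel[OF N op_rel_comp[OF B' G(1)] single_val_comp[OF svB(1) G(2)]] by metis
    then show "\<alpha> \<in> rmod_Supp S N" unfolding H(2) by (rule rmod_SuppI[OF N H(1)])
  next
    fix \<alpha> :: "('a, 'u) rmodule set" assume "\<alpha> \<in> rmod_Supp S N"
    from rmod_SuppE[OF N this] obtain H :: "('a, 'u) rmodule" and G where
      H: "rmod_monoform S H" "\<alpha> = rmod_atom S H"
      and G: "op_rel (carrier S) N H G" "single_val N H G" "nonzero_rel H G" by metis
    have svP: "single_val (forget (Dmod A N)) N ?P" by (auto simp: single_val_def)
    have "nonzero_rel H (B\<inverse> O ?P O G)"
    proof -
      obtain x h where xh: "(x, h) \<in> G" "h \<noteq> \<zero>\<^bsub>H\<^esub>" using G(3) nonzero_rel_def by metis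
      have x: "x \<in> carrier N" using op_relD(3)[OF G(1) xh(1)] .
      then have "(x, x) \<in> Domain B" using B(4) by simp
      then obtain c where "((x, x), c) \<in> B" by blast
      then have "(c, h) \<in> B\<inverse> O ?P O G" using xh(1) x by blast
      then show ?thesis using xh(2) unfolding nonzero_rel_def by blast
    qed
    then show "\<alpha> \<in> rmod_Supp S (forget C)" unfolding H(2)
      by (rule rmod_SuppI[OF rC H(1) op_rel_comp[OF op_rel_converse[OF B'] op_rel_comp[OF P G(1)]]
            single_val_comp[OF svB(2) single_val_comp[OF svP G(2)]]])
  qed
  with C(1) show thesis by (rule that)
qed

text \<open>Forward continuity follows from the factorization into \<open>Dmod_atom\<close> and the
  quotient map. For openness, the quotient map followed by the inverse bijection is shown to be
  continuous on the spectrum itself; by definition of the quotient topology this suffices.\<close>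

theorem homeomorphic_spec_bij:
  assumes inf: "infinite (UNIV :: 'u set)" and bd: "bounded_dg A"
  shows "homeomorphic_map (rmod_Spec_topology S :: ('a, 'u) rmodule set topology)
    (dg_SpecZ_topology A) (spec_bij A)"
proof (rule bijective_open_imp_homeomorphic_map)
  let ?\<phi> = "spec_bij A :: ('a, 'u) rmodule set \<Rightarrow> ('a, 'u) dgmodule set set"
  have \<phi>: "?\<phi> \<alpha> = atom_orbit A (Dmod_atom \<alpha>)" if "\<alpha> \<in> rmod_Spec S" for \<alpha>
  proof -
    obtain H :: "('a, 'u) rmodule" where H: "rmod_monoform S H" "\<alpha> = rmod_atom S H"
      using \<open>\<alpha> \<in> rmod_Spec S\<close> unfolding rmod_Spec_def by blast
    show ?thesis unfolding H(2) spec_bij_atom[OF H(1)] Dmod_atom_eq[OF H(1)] ..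
  qed
  show cont: "continuous_map (rmod_Spec_topology S) (dg_SpecZ_topology A) ?\<phi>"
    by (rule continuous_map_eq[OF continuous_map_compose[OF continuous_map_Dmod_atom[OF inf]
            continuous_map_atom_orbit]]) (simp add: topspace_rmod_Spec \<phi>)
  show inj: "inj_on ?\<phi> (topspace (rmod_Spec_topology S))"
    unfolding topspace_rmod_Spec by (rule spec_bij_inj[OF inf])
  show surj: "?\<phi> ` topspace (rmod_Spec_topology S) = topspace (dg_SpecZ_topology A)"
  proof (intro subset_antisym subsetI)
    fix \<omega> :: "('a, 'u) dgmodule set set" assume "\<omega> \<in> topspace (dg_SpecZ_topology A)"
    then obtain X :: "('a, 'u) dgmodule" where X: "dg_monoform A X" "\<omega> = atom_orbit A (dg_atom A X)"
      unfolding topspace_SpecZ dg_SpecZ_def dg_Spec_def by blast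
    obtain n and H :: "('a, 'u) rmodule" where H: "rmod_monoform S H"
      and c: "dg_common A X (dg_shift n (Dmod A H))"
      using monoform_from_cycles[OF bd X(1)] by metis
    have "(rmod_atom S H :: ('a, 'u) rmodule set) \<in> rmod_Spec S" using H unfolding rmod_Spec_def by blast
    moreover have "\<omega> = ?\<phi> (rmod_atom S H)" unfolding X(2) by (rule orbit_eq_spec_bij[OF inf X(1) H c])
    ultimately show "\<omega> \<in> ?\<phi> ` topspace (rmod_Spec_topology S)" unfolding topspace_rmod_Spec by blast
  qed (use continuous_map_image_subset_topspace[OF cont] in blast)
  let ?\<chi> = "\<lambda>\<alpha>. inv_into (rmod_Spec S) ?\<phi> (atom_orbit A \<alpha>)"
  have orbit: "\<exists>\<beta>\<in>rmod_Spec S. atom_orbit A \<alpha> = ?\<phi> \<beta>" if "\<alpha> \<in> dg_Spec A" for \<alpha>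
    using surj \<open>\<alpha> \<in> dg_Spec A\<close> unfolding topspace_rmod_Spec topspace_SpecZ dg_SpecZ_def
    by (metis imageE imageI)
  \<comment> \<open>Membership is rewritten through the bijection, so that preimages under
    \<open>\<chi>\<close> become conditions on orbits, which is the form of the quotient
    topology.\<close>
  have \<chi>: "?\<chi> \<alpha> \<in> U \<longleftrightarrow> atom_orbit A \<alpha> \<in> ?\<phi> ` U" if \<alpha>: "\<alpha> \<in> dg_Spec A" and U: "U \<subseteq> rmod_Spec S" for \<alpha> U
  proof -
    obtain \<beta> where \<beta>: "\<beta> \<in> rmod_Spec S" "atom_orbit A \<alpha> = ?\<phi> \<beta>" using orbit[OF \<alpha>] by blast
    then have "?\<chi> \<alpha> = \<beta>" using inv_into_f_f[OF spec_bij_inj[OF inf] \<beta>(1)] by simp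
    then show ?thesis using \<beta> U inj_on_image_mem_iff[OF spec_bij_inj[OF inf] \<beta>(1) U] by simp
  qed
  have \<chi>_cont: "continuous_map (dg_Spec_topology A) (rmod_Spec_topology S) ?\<chi>"
  proof -
    have "continuous_map (dg_Spec_topology A)
        (topology_generated_by {rmod_Supp S N | N :: ('a, 'u) rmodule. right_module S N}) ?\<chi>"
    proof (rule continuous_on_generated_topo)
      have top: "\<Union> {rmod_Supp S N | N :: ('a, 'u) rmodule. right_module S N} = rmod_Spec S"
        using topspace_rmod_Spec unfolding rmod_Spec_topology_def topology_generated_by_topspace .
      show "?\<chi> ` topspace (dg_Spec_topology A) \<subseteq> \<Union> {rmod_Supp S N | N :: ('a, 'u) rmodule. right_module S N}"
        unfolding top topspace_dg_Spec using orbit by (auto intro!: inv_into_into)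
      fix U assume "U \<in> {rmod_Supp S N | N :: ('a, 'u) rmodule. right_module S N}"
      then obtain N :: "('a, 'u) rmodule" where N: "right_module S N" "U = rmod_Supp S N" by blast
      then have U: "U \<subseteq> rmod_Spec S" using top by blast
      obtain C :: "('a, 'u) dgmodule" where C: "dg_module A C" "rmod_Supp S (forget C) = U"
        using rmod_Supp_Dmod[OF inf N(1)] N(2) by metis
      \<comment> \<open>Here the equality of supports is applied to \<open>C\<close>: pulling back
        \<open>Supp N\<close> along \<open>\<chi>\<close> gives the atoms whose orbit lies in the
        orbit support of \<open>C\<close>.\<close>
      have "?\<chi> -` U \<inter> topspace (dg_Spec_topology A) =
          {\<alpha> \<in> dg_Spec A. atom_orbit A \<alpha> \<in> dg_SuppZ A C}"
        unfolding SuppZ_eq[OF inf bd C(1)] C(2) topspace_dg_Spec using \<chi>[OF _ U] by auto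
      then show "openin (dg_Spec_topology A) (?\<chi> -` U \<inter> topspace (dg_Spec_topology A))"
        using openin_SuppZ_preimage[OF C(1)] by simp
    qed
    then show ?thesis unfolding rmod_Spec_topology_def .
  qed
  show "open_map (rmod_Spec_topology S) (dg_SpecZ_topology A) ?\<phi>"
    unfolding open_map_def
  proof (intro allI impI)
    fix U :: "('a, 'u) rmodule set set" assume U: "openin (rmod_Spec_topology S) U"
    then have US: "U \<subseteq> rmod_Spec S" using openin_subset topspace_rmod_Spec by metis
    have "{\<alpha> \<in> dg_Spec A. atom_orbit A \<alpha> \<in> ?\<phi> ` U} = {\<alpha> \<in> topspace (dg_Spec_topology A). ?\<chi> \<alpha> \<in> U}"
      unfolding topspace_dg_Spec using \<chi>[OF _ US] by blast
    then have "openin (dg_Spec_topology A) {\<alpha> \<in> dg_Spec A. atom_orbit A \<alpha> \<in> ?\<phi> ` U}"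
      using openin_continuous_map_preimage[OF \<chi>_cont U] by simp
    moreover have "?\<phi> ` U \<subseteq> dg_SpecZ A"
      using surj US unfolding topspace_rmod_Spec topspace_SpecZ by blast
    ultimately show "openin (dg_SpecZ_topology A) (?\<phi> ` U)" unfolding openin_SpecZ by blast
  qed
qed

end

theorem corollary6p18:
  fixes A :: "'a dgring"
  assumes "dg_ring A"
    and "bounded_dg A"
    and "nonpositive_dg A"
    and "right_dg_noetherian A"
    and "infinite (UNIV :: 'u set)"
    and "carrier A \<lesssim> (UNIV :: 'u set)"
  shows "(\<forall>M :: ('a, 'u) dgmodule. dg_module A M \<longrightarrow>
            dg_SuppZ A M = spec_bij A ` rmod_Supp (degree_zero_ring A) (forget M)) \<and>
         homeomorphic_map
           (rmod_Spec_topology (degree_zero_ring A) :: ('a, 'u) rmodule set topology)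
           (dg_SpecZ_topology A)
           (spec_bij A)"
proof -
  interpret nonpos_dg A
    using assms(1,3) by (simp add: nonpos_dg_def nonpos_dg_axioms_def)
  show ?thesis using SuppZ_eq[OF assms(5,2)] homeomorphic_spec_bij[OF assms(5,2)] by blast
qed

end
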